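(* Let $\mathscr G$ be an ample groupoid and $\Bbbk$ a commutative ring with unit. Let $\mathrm{mod}\text{-}\Bbbk\mathscr G$ be the category of unitary right $\Bbbk\mathscr G$-modules and $\mathcal B_\Bbbk\mathscr G$ the category of $\mathscr G$-sheaves of $\Bbbk$-modules. Let $\Gamma_c\colon \mathcal B_\Bbbk\mathscr G\to \mathrm{mod}\text{-}\Bbbk\mathscr G$ be the functor of compactly supported global sections, and let $\mathrm{Sh}\colon \mathrm{mod}\text{-}\Bbbk\mathscr G\to \mathcal B_\Bbbk\mathscr G$ be the functor sending a module to its associated $\mathscr G$-sheaf of germs (both defined in the context). Then there are natural isomorphisms $\Gamma_c\circ \mathrm{Sh}\cong 1_{\mathrm{mod}\text{-}\Bbbk\mathscr G}$ and $\mathrm{Sh}\circ\Gamma_c\cong 1_{\mathcal B_\Bbbk\mathscr G}$. Hence the categories $\mathrm{mod}\text{-}\Bbbk\mathscr G$ and $\mathcal B_\Bbbk\mathscr G$ are equivalent.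
   Context: Conventions. "Compact" means Hausdorff and every open cover has a finite subcover. A topological groupoid $\mathscr G$ is a groupoid (small category with all arrows invertible) with topological spaces of units $\mathscr G^{(0)}$ and arrows $\mathscr G^{(1)}$ such that domain $\boldsymbol d$, range $\boldsymbol r$, multiplication, inversion and the unit map are continuous; $\mathscr G^{(0)}$ is identified with the subspace of identity arrows of $\mathscr G^{(1)}$. The product $gh$ is defined when $\boldsymbol d(g)=\boldsymbol r(h)$, and then $\boldsymbol d(gh)=\boldsymbol d(h)$, $\boldsymbol r(gh)=\boldsymbol r(g)$. $\mathscr G$ is étale if $\boldsymbol d$ is a local homeomorphism (then $\mathscr G^{(0)}$ is open in $\mathscr G^{(1)}$); it is ample if it is étale and $\mathscr G^{(0)}$ is Hausdorff with a basis of compact open sets ($\mathscr G^{(1)}$ need not be Hausdorff). A local bisection is an open $U\subseteq \mathscr G^{(1)}$ such that $\boldsymbol d|_U$ and $\boldsymbol r|_U$ are homeomorphisms onto their images. $\mathrm{Bis}_c(\mathscr G)$ is the set of compact open local bisections, with $UV=\{uv\mid u\in U, v\in V, \boldsymbol d(u)=\boldsymbol r(v)\}$ and $U^{-1}=\{u^{-1}\mid u\in U\}$. The algebra. $\Bbbk\mathscr G$ is the $\Bbbk$-submodule of $\Bbbk^{\mathscr G^{(1)}}$ spanned by the characteristic functions $\chi_U$, $U\in\mathrm{Bis}_c(\mathscr G)$, with convolution product $(f_1\ast f_2)(g)=\sum_{\boldsymbol d(h)=\boldsymbol d(g)}f_1(gh^{-1})f_2(h)$ (a finite sum); one has $\chi_U\chi_V=\chi_{UV}$.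 It is an associative $\Bbbk$-algebra with local units (each finite subset is fixed under left and right multiplication by some idempotent), in general non-unital. Unitary modules. A right module $M$ over a ring $R$ with local units is unitary if $MR=M$, equivalently for each $m\in M$ there is an idempotent $e\in R$ with $me=m$. Morphisms in $\mathrm{mod}\text{-}R$ are $R$-module homomorphisms. If $R$ is a $\Bbbk$-algebra, a unitary $M$ is a $\Bbbk$-module via $cm=m(ce)$ for any idempotent $e$ with $me=m$. $\mathscr G$-sheaves of $\Bbbk$-modules. A $\mathscr G$-sheaf is a space $E$ with a local homeomorphism $p\colon E\to\mathscr G^{(0)}$ and a continuous action map $E\times_{\mathscr G^{(0)}}\mathscr G^{(1)}\to E$, $(e,g)\mapsto eg$, defined when $p(e)=\boldsymbol r(g)$, such that $e\,p(e)=e$, $p(eg)=\boldsymbol d(g)$, and $(eg)h=e(gh)$ whenever $p(e)=\boldsymbol r(g)$ and $\boldsymbol d(g)=\boldsymbol r(h)$. The stalk at $x$ is $E_x=p^{-1}(x)$. A $\mathscr G$-sheaf of $\Bbbk$-modules is a $\mathscr G$-sheaf with a $\Bbbk$-module structure on each stalk such that the zero section $\mathscr G^{(0)}\to E$, addition $E\times_{\mathscr G^{(0)}}E\to E$, and scalar multiplication $\Bbbk\times E\to E$ ($\Bbbk$ discrete) are continuous, and each map $R_g\colon E_{\boldsymbol r(g)}\to E_{\boldsymbol d(g)}$, $e\mapsto eg$, is $\Bbbk$-linear. A morphism $(E,p)\to(F,q)$ is a continuous map $\varphi\colon E\to F$ with $q\varphi=p$, $\varphi(eg)=\varphi(e)g$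 whenever $p(e)=\boldsymbol r(g)$, and $\varphi$ $\Bbbk$-linear on stalks. The functor $\Gamma_c$. $\Gamma_c(E,p)$ is the set of continuous sections $s\colon\mathscr G^{(0)}\to E$ of $p$ with compact support, with pointwise addition and right $\Bbbk\mathscr G$-action $(sf)(x)=\sum_{\boldsymbol d(g)=x}f(g)\,\bigl(s(\boldsymbol r(g))g\bigr)$ (a finite sum); it is a unitary module. On morphisms, $\Gamma_c(\varphi)(s)=\varphi\circ s$. The functor $\mathrm{Sh}$. Let $M$ be a unitary right $\Bbbk\mathscr G$-module. For compact open $U\subseteq \mathscr G^{(0)}$ put $M(U)=M\chi_U$, so that $M=\bigcup_U M(U)$ (union over compact open $U\subseteq \mathscr G^{(0)}$), and for $V\subseteq U$ let $\rho^U_V\colon M(U)\to M(V)$, $m\mapsto m\chi_V$. For $x\in\mathscr G^{(0)}$ let $M_x=\varinjlim_{x\in U}M(U)$ (over compact open neighborhoods $U$ of $x$), and let $[m]_x\in M_x$ be the class of $m$; this is defined for every $m\in M$, $m\mapsto[m]_x$ is $\Bbbk$-linear, and $[m]_x=[n]_x$ iff $m\chi_W=n\chi_W$ for some compact open neighborhood $W$ of $x$. Put $\widetilde M=\coprod_{x}M_x$, $p_M(M_x)=x$, with topology having basis the sets $(U,m)=\{[m]_x\mid x\in U\}$ for $U\subseteq\mathscr G^{(0)}$ compact open and $m\in M$. The action is $[m]_{\boldsymbol r(g)}g=[m\chi_U]_{\boldsymbol d(g)}$ for any $U\in\mathrm{Bis}_c(\mathscr G)$ containing $g$ (independent of choices).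 Then $\mathrm{Sh}(M)=(\widetilde M,p_M)$ is a $\mathscr G$-sheaf of $\Bbbk$-modules. For a homomorphism $f\colon M\to N$, $\mathrm{Sh}(f)([m]_x)=[f(m)]_x$. *)

theory Defs
  imports
    "HOL-Analysis.Analysis"
    "HOL-Algebra.Module"
    "HOL-Algebra.Generated_Groups"
    "HOL-Library.Equipollence"
begin

section \<open>Categories, functors, equivalence\<close>

text \<open>Composition receives the three objects involved, because the morphisms used below are
  extensional functions and do not determine their source and target:
  \<open>Cmp C a b c g f\<close> is \<open>g \<circ> f\<close> for \<open>f : a \<rightarrow> b\<close> and \<open>g : b \<rightarrow> c\<close>.\<close>

record ('o, 'a) category =
  Obj :: "'o set"
  Hom :: "'o \<Rightarrow> 'o \<Rightarrow> 'a set"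
  Idn :: "'o \<Rightarrow> 'a"
  Cmp :: "'o \<Rightarrow> 'o \<Rightarrow> 'o \<Rightarrow> 'a \<Rightarrow> 'a \<Rightarrow> 'a"

definition is_category :: "('o, 'a) category \<Rightarrow> bool" where
  "is_category C \<longleftrightarrow>
     (\<forall>a\<in>Obj C. Idn C a \<in> Hom C a a) \<and>
     (\<forall>a\<in>Obj C. \<forall>b\<in>Obj C. \<forall>c\<in>Obj C. \<forall>f\<in>Hom C a b. \<forall>g\<in>Hom C b c. Cmp C a b c g f \<in> Hom C a c) \<and>
     (\<forall>a\<in>Obj C. \<forall>b\<in>Obj C. \<forall>f\<in>Hom C a b.
        Cmp C a a b f (Idn C a) = f \<and> Cmp C a b b (Idn C b) f = f) \<and>
     (\<forall>a\<in>Obj C. \<forall>b\<in>Obj C. \<forall>c\<in>Obj C. \<forall>d\<in>Obj C.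
        \<forall>f\<in>Hom C a b. \<forall>g\<in>Hom C b c. \<forall>h\<in>Hom C c d.
        Cmp C a c d h (Cmp C a b c g f) = Cmp C a b d (Cmp C b c d h g) f)"

record ('o, 'a, 'p, 'b) cfunctor =
  on_obj :: "'o \<Rightarrow> 'p"
  on_arr :: "'o \<Rightarrow> 'o \<Rightarrow> 'a \<Rightarrow> 'b"

definition is_functor ::
  "('o, 'a) category \<Rightarrow> ('p, 'b) category \<Rightarrow> ('o, 'a, 'p, 'b) cfunctor \<Rightarrow> bool" where
  "is_functor C D F \<longleftrightarrow> is_category C \<and> is_category D \<and>
     (\<forall>a\<in>Obj C. on_obj F a \<in> Obj D) \<and>
     (\<forall>a\<in>Obj C. \<forall>b\<in>Obj C. \<forall>f\<in>Hom C a b. on_arr F a b f \<in> Hom D (on_obj F a) (on_obj F b)) \<and>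
     (\<forall>a\<in>Obj C. on_arr F a a (Idn C a) = Idn D (on_obj F a)) \<and>
     (\<forall>a\<in>Obj C. \<forall>b\<in>Obj C. \<forall>c\<in>Obj C. \<forall>f\<in>Hom C a b. \<forall>g\<in>Hom C b c.
        on_arr F a c (Cmp C a b c g f) =
        Cmp D (on_obj F a) (on_obj F b) (on_obj F c) (on_arr F b c g) (on_arr F a b f))"

definition id_functor :: "('o, 'a, 'o, 'a) cfunctor" where
  "id_functor = \<lparr>on_obj = (\<lambda>a. a), on_arr = (\<lambda>a b f. f)\<rparr>"

definition comp_functor ::
  "('p, 'b, 'q, 'c) cfunctor \<Rightarrow> ('o, 'a, 'p, 'b) cfunctor \<Rightarrow> ('o, 'a, 'q, 'c) cfunctor" where
  "comp_functor F' F =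
     \<lparr>on_obj = (\<lambda>a. on_obj F' (on_obj F a)),
      on_arr = (\<lambda>a b f. on_arr F' (on_obj F a) (on_obj F b) (on_arr F a b f))\<rparr>"

definition is_iso :: "('o, 'a) category \<Rightarrow> 'o \<Rightarrow> 'o \<Rightarrow> 'a \<Rightarrow> bool" where
  "is_iso C a b f \<longleftrightarrow> f \<in> Hom C a b \<and>
     (\<exists>g\<in>Hom C b a. Cmp C a b a g f = Idn C a \<and> Cmp C b a b f g = Idn C b)"

definition naturally_isomorphic ::
  "('o, 'a) category \<Rightarrow> ('p, 'b) category \<Rightarrow> ('o, 'a, 'p, 'b) cfunctor \<Rightarrow> ('o, 'a, 'p, 'b) cfunctor \<Rightarrow> bool"
where
  "naturally_isomorphic C D F F' \<longleftrightarrow>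
     (\<exists>\<eta>. (\<forall>a\<in>Obj C. is_iso D (on_obj F a) (on_obj F' a) (\<eta> a)) \<and>
       (\<forall>a\<in>Obj C. \<forall>b\<in>Obj C. \<forall>f\<in>Hom C a b.
          Cmp D (on_obj F a) (on_obj F' a) (on_obj F' b) (on_arr F' a b f) (\<eta> a) =
          Cmp D (on_obj F a) (on_obj F b) (on_obj F' b) (\<eta> b) (on_arr F a b f)))"

definition equivalent_categories :: "('o, 'a) category \<Rightarrow> ('p, 'b) category \<Rightarrow> bool" where
  "equivalent_categories C D \<longleftrightarrow>
     (\<exists>F F'. is_functor C D F \<and> is_functor D C F' \<and>
        naturally_isomorphic C C (comp_functor F' F) id_functor \<and>
        naturally_isomorphic D D (comp_functor F F') id_functor)"


section \<open>Ample groupoids\<close>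

definition local_homeomorphism :: "'a topology \<Rightarrow> 'b topology \<Rightarrow> ('a \<Rightarrow> 'b) \<Rightarrow> bool" where
  "local_homeomorphism X Y f \<longleftrightarrow>
     (\<forall>x\<in>topspace X. \<exists>U. x \<in> U \<and> openin X U \<and> openin Y (f ` U) \<and>
        homeomorphic_map (subtopology X U) (subtopology Y (f ` U)) f)"

text \<open>``Compact'' includes Hausdorff.\<close>

definition compact_open :: "'a topology \<Rightarrow> 'a set \<Rightarrow> bool" where
  "compact_open X U \<longleftrightarrow> openin X U \<and> compactin X U \<and> Hausdorff_space (subtopology X U)"

text \<open>The unit space is the subspace of identity arrows, so a groupoid is given by its space of
  arrows; \<open>src\<close> and \<open>rng\<close> are the maps usually called \<open>d\<close> and \<open>r\<close>, and \<open>gmul G g h\<close> is relevant only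
  when \<open>src G g = rng G h\<close>.\<close>

record 'g groupoid =
  arr_top :: "'g topology"
  src :: "'g \<Rightarrow> 'g"
  rng :: "'g \<Rightarrow> 'g"
  gmul :: "'g \<Rightarrow> 'g \<Rightarrow> 'g"
  ginv :: "'g \<Rightarrow> 'g"

definition arrows :: "'g groupoid \<Rightarrow> 'g set" where
  "arrows G = topspace (arr_top G)"

definition units :: "'g groupoid \<Rightarrow> 'g set" where
  "units G = {x \<in> arrows G. src G x = x}"

definition unit_top :: "'g groupoid \<Rightarrow> 'g topology" where
  "unit_top G = subtopology (arr_top G) (units G)"

locale topological_groupoid =
  fixes G :: "'g groupoid"
  assumes src_unit: "g \<in> arrows G \<Longrightarrow> src G g \<in> units G"
    and rng_unit: "g \<in> arrows G \<Longrightarrow> rng G g \<in> units G"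
    and rng_of_unit: "x \<in> units G \<Longrightarrow> rng G x = x"
    and gmul_closed: "\<lbrakk>g \<in> arrows G; h \<in> arrows G; src G g = rng G h\<rbrakk> \<Longrightarrow> gmul G g h \<in> arrows G"
    and src_gmul: "\<lbrakk>g \<in> arrows G; h \<in> arrows G; src G g = rng G h\<rbrakk> \<Longrightarrow> src G (gmul G g h) = src G h"
    and rng_gmul: "\<lbrakk>g \<in> arrows G; h \<in> arrows G; src G g = rng G h\<rbrakk> \<Longrightarrow> rng G (gmul G g h) = rng G g"
    and gmul_assoc: "\<lbrakk>g \<in> arrows G; h \<in> arrows G; j \<in> arrows G; src G g = rng G h; src G h = rng G j\<rbrakk>
        \<Longrightarrow> gmul G (gmul G g h) j = gmul G g (gmul G h j)"
    and gmul_src: "g \<in> arrows G \<Longrightarrow> gmul G g (src G g) = g"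
    and gmul_rng: "g \<in> arrows G \<Longrightarrow> gmul G (rng G g) g = g"
    and ginv_closed: "g \<in> arrows G \<Longrightarrow> ginv G g \<in> arrows G"
    and src_ginv: "g \<in> arrows G \<Longrightarrow> src G (ginv G g) = rng G g"
    and rng_ginv: "g \<in> arrows G \<Longrightarrow> rng G (ginv G g) = src G g"
    and gmul_ginv_right: "g \<in> arrows G \<Longrightarrow> gmul G g (ginv G g) = rng G g"
    and gmul_ginv_left: "g \<in> arrows G \<Longrightarrow> gmul G (ginv G g) g = src G g"
    and continuous_src: "continuous_map (arr_top G) (unit_top G) (src G)"
    and continuous_rng: "continuous_map (arr_top G) (unit_top G) (rng G)"
    and continuous_ginv: "continuous_map (arr_top G) (arr_top G) (ginv G)"
    and continuous_gmul: "continuous_map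
          (subtopology (prod_topology (arr_top G) (arr_top G)) {(g, h). src G g = rng G h})
          (arr_top G) (\<lambda>(g, h). gmul G g h)"

locale etale_groupoid = topological_groupoid +
  assumes local_homeomorphism_src: "local_homeomorphism (arr_top G) (unit_top G) (src G)"

locale ample_groupoid = etale_groupoid +
  assumes Hausdorff_units: "Hausdorff_space (unit_top G)"
    and compact_open_basis:
      "\<lbrakk>openin (unit_top G) W; x \<in> W\<rbrakk> \<Longrightarrow> \<exists>U. compact_open (unit_top G) U \<and> x \<in> U \<and> U \<subseteq> W"

definition local_bisection :: "'g groupoid \<Rightarrow> 'g set \<Rightarrow> bool" where
  "local_bisection G U \<longleftrightarrow> openin (arr_top G) U \<and>
     embedding_map (subtopology (arr_top G) U) (unit_top G) (src G) \<and>
     embedding_map (subtopology (arr_top G) U) (unit_top G) (rng G)"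

definition Bis_c :: "'g groupoid \<Rightarrow> 'g set set" where
  "Bis_c G = {U. compact_open (arr_top G) U \<and> local_bisection G U}"


section \<open>The groupoid algebra\<close>

definition char_fn :: "'k ring \<Rightarrow> 'g set \<Rightarrow> 'g \<Rightarrow> 'k" where
  "char_fn R U = (\<lambda>g. if g \<in> U then \<one>\<^bsub>R\<^esub> else \<zero>\<^bsub>R\<^esub>)"

text \<open>The \<open>R\<close>-linear span of the characteristic functions. A function on the arrows is represented
  by its extension by zero to the whole type.\<close>

inductive_set alg_span :: "'k ring \<Rightarrow> 'g groupoid \<Rightarrow> ('g \<Rightarrow> 'k) set"
  for R :: "'k ring" and G :: "'g groupoid" where
  zero: "(\<lambda>g. \<zero>\<^bsub>R\<^esub>) \<in> alg_span R G"
| add_scaled: "\<lbrakk>c \<in> carrier R; U \<in> Bis_c G; f \<in> alg_span R G\<rbrakk>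
    \<Longrightarrow> (\<lambda>g. c \<otimes>\<^bsub>R\<^esub> char_fn R U g \<oplus>\<^bsub>R\<^esub> f g) \<in> alg_span R G"

text \<open>The algebra is non-unital in general: the \<open>one\<close> field belongs to the carrier only if the unit
  space is compact, and it is not used below. In the convolution only the finitely many \<open>h\<close> with
  \<open>f2 h \<noteq> 0\<close> are kept, since \<open>finsum\<close> over an infinite set is zero by convention.\<close>

definition groupoid_algebra :: "'k ring \<Rightarrow> 'g groupoid \<Rightarrow> ('k, 'g \<Rightarrow> 'k) module" where
  "groupoid_algebra R G =
     \<lparr>carrier = alg_span R G,
      mult = (\<lambda>f1 f2 g. if g \<in> arrows G
         then (\<Oplus>\<^bsub>R\<^esub>h\<in>{h \<in> arrows G. src G h = src G g \<and> f2 h \<noteq> \<zero>\<^bsub>R\<^esub>}.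
                f1 (gmul G g (ginv G h)) \<otimes>\<^bsub>R\<^esub> f2 h)
         else \<zero>\<^bsub>R\<^esub>),
      one = char_fn R (units G),
      zero = (\<lambda>g. \<zero>\<^bsub>R\<^esub>),
      add = (\<lambda>f1 f2 g. f1 g \<oplus>\<^bsub>R\<^esub> f2 g),
      smult = (\<lambda>c f g. c \<otimes>\<^bsub>R\<^esub> f g)\<rparr>"


section \<open>Unitary right modules\<close>

text \<open>Right modules over a possibly non-unital \<open>A\<close> are stored in the library record for modules:
  \<open>a \<odot>\<^bsub>M\<^esub> m\<close> stands for the right action \<open>m a\<close>, as the axiom \<open>action_mult\<close> shows. The fields
  \<open>mult\<close> and \<open>one\<close> of \<open>M\<close> play no role.\<close>

locale right_module = abelian_group M
  for A :: "('r, 'x) ring_scheme" and M :: "('r, 'm) module" +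
  assumes action_closed: "\<lbrakk>a \<in> carrier A; m \<in> carrier M\<rbrakk> \<Longrightarrow> a \<odot>\<^bsub>M\<^esub> m \<in> carrier M"
    and action_add_right: "\<lbrakk>a \<in> carrier A; b \<in> carrier A; m \<in> carrier M\<rbrakk>
        \<Longrightarrow> (a \<oplus>\<^bsub>A\<^esub> b) \<odot>\<^bsub>M\<^esub> m = a \<odot>\<^bsub>M\<^esub> m \<oplus>\<^bsub>M\<^esub> b \<odot>\<^bsub>M\<^esub> m"
    and action_add_left: "\<lbrakk>a \<in> carrier A; m \<in> carrier M; n \<in> carrier M\<rbrakk>
        \<Longrightarrow> a \<odot>\<^bsub>M\<^esub> (m \<oplus>\<^bsub>M\<^esub> n) = a \<odot>\<^bsub>M\<^esub> m \<oplus>\<^bsub>M\<^esub> a \<odot>\<^bsub>M\<^esub> n"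
    and action_mult: "\<lbrakk>a \<in> carrier A; b \<in> carrier A; m \<in> carrier M\<rbrakk>
        \<Longrightarrow> (a \<otimes>\<^bsub>A\<^esub> b) \<odot>\<^bsub>M\<^esub> m = b \<odot>\<^bsub>M\<^esub> (a \<odot>\<^bsub>M\<^esub> m)"

text \<open>\<open>M A = M\<close>, where \<open>M A\<close> is the additive subgroup generated by the products.\<close>

definition unitary_module :: "('r, 'x) ring_scheme \<Rightarrow> ('r, 'm) module \<Rightarrow> bool" where
  "unitary_module A M \<longleftrightarrow> right_module A M \<and>
     generate (add_monoid M) {a \<odot>\<^bsub>M\<^esub> m |a m. a \<in> carrier A \<and> m \<in> carrier M} = carrier M"

definition right_module_hom ::
  "('r, 'x) ring_scheme \<Rightarrow> ('r, 'm) module \<Rightarrow> ('r, 'n) module \<Rightarrow> ('m \<Rightarrow> 'n) set" where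
  "right_module_hom A M N = {f \<in> carrier M \<rightarrow>\<^sub>E carrier N.
     (\<forall>m\<in>carrier M. \<forall>n\<in>carrier M. f (m \<oplus>\<^bsub>M\<^esub> n) = f m \<oplus>\<^bsub>N\<^esub> f n) \<and>
     (\<forall>a\<in>carrier A. \<forall>m\<in>carrier M. f (a \<odot>\<^bsub>M\<^esub> m) = a \<odot>\<^bsub>N\<^esub> f m)}"

definition right_module_iso ::
  "('r, 'x) ring_scheme \<Rightarrow> ('r, 'm) module \<Rightarrow> ('r, 'n) module \<Rightarrow> ('m \<Rightarrow> 'n) \<Rightarrow> bool" where
  "right_module_iso A M N f \<longleftrightarrow> f \<in> right_module_hom A M N \<and>
     (\<exists>g\<in>right_module_hom A N M. (\<forall>m\<in>carrier M. g (f m) = m) \<and> (\<forall>n\<in>carrier N. f (g n) = n))"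

definition right_module_cat ::
  "'k ring \<Rightarrow> 'g groupoid \<Rightarrow> (('g \<Rightarrow> 'k, 'm) module, 'm \<Rightarrow> 'm) category" where
  "right_module_cat R G =
     \<lparr>Obj = {M. unitary_module (groupoid_algebra R G) M},
      Hom = right_module_hom (groupoid_algebra R G),
      Idn = (\<lambda>M. \<lambda>m\<in>carrier M. m),
      Cmp = (\<lambda>M N P g f. compose (carrier M) g f)\<rparr>"

text \<open>The induced \<open>R\<close>-module structure \<open>c m = m (c e)\<close>, independent of the idempotent \<open>e\<close> with \<open>m e = m\<close>.\<close>

definition scale :: "'k ring \<Rightarrow> 'g groupoid \<Rightarrow> ('g \<Rightarrow> 'k, 'm) module \<Rightarrow> 'k \<Rightarrow> 'm \<Rightarrow> 'm" where
  "scale R G M c m =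
     (let A = groupoid_algebra R G;
          e = (SOME e. e \<in> carrier A \<and> e \<otimes>\<^bsub>A\<^esub> e = e \<and> e \<odot>\<^bsub>M\<^esub> m = m)
      in (c \<odot>\<^bsub>A\<^esub> e) \<odot>\<^bsub>M\<^esub> m)"


section \<open>Sheaves of modules over a groupoid\<close>

record ('g, 'k, 'e) gsheaf =
  sh_top :: "'e topology"
  sh_proj :: "'e \<Rightarrow> 'g"
  sh_act :: "'e \<Rightarrow> 'g \<Rightarrow> 'e"
  sh_add :: "'e \<Rightarrow> 'e \<Rightarrow> 'e"
  sh_zero :: "'g \<Rightarrow> 'e"
  sh_smult :: "'k \<Rightarrow> 'e \<Rightarrow> 'e"

definition stalk :: "('g, 'k, 'e) gsheaf \<Rightarrow> 'g \<Rightarrow> ('k, 'e) module" where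
  "stalk E x =
     \<lparr>carrier = {e \<in> topspace (sh_top E). sh_proj E e = x},
      mult = (\<lambda>_ _. undefined), one = undefined,
      zero = sh_zero E x, add = sh_add E, smult = sh_smult E\<rparr>"

definition linear_on ::
  "'k ring \<Rightarrow> ('k, 'e) module \<Rightarrow> ('k, 'f) module \<Rightarrow> ('e \<Rightarrow> 'f) \<Rightarrow> bool" where
  "linear_on R M N f \<longleftrightarrow> f \<in> carrier M \<rightarrow> carrier N \<and>
     (\<forall>u\<in>carrier M. \<forall>v\<in>carrier M. f (u \<oplus>\<^bsub>M\<^esub> v) = f u \<oplus>\<^bsub>N\<^esub> f v) \<and>
     (\<forall>c\<in>carrier R. \<forall>u\<in>carrier M. f (c \<odot>\<^bsub>M\<^esub> u) = c \<odot>\<^bsub>N\<^esub> f u)"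

locale gsheaf_of_modules =
  fixes R :: "'k ring" and G :: "'g groupoid" and E :: "('g, 'k, 'e) gsheaf"
  assumes local_homeomorphism_proj: "local_homeomorphism (sh_top E) (unit_top G) (sh_proj E)"
    and continuous_act: "continuous_map
          (subtopology (prod_topology (sh_top E) (arr_top G)) {(e, g). sh_proj E e = rng G g})
          (sh_top E) (\<lambda>(e, g). sh_act E e g)"
    and act_unit: "e \<in> topspace (sh_top E) \<Longrightarrow> sh_act E e (sh_proj E e) = e"
    and proj_act: "\<lbrakk>e \<in> topspace (sh_top E); g \<in> arrows G; sh_proj E e = rng G g\<rbrakk>
        \<Longrightarrow> sh_proj E (sh_act E e g) = src G g"
    and act_act: "\<lbrakk>e \<in> topspace (sh_top E); g \<in> arrows G; h \<in> arrows G; sh_proj E e = rng G g; src G g = rng G h\<rbrakk>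
        \<Longrightarrow> sh_act E (sh_act E e g) h = sh_act E e (gmul G g h)"
    and module_stalk: "x \<in> units G \<Longrightarrow> Module.module R (stalk E x)"
    and continuous_zero: "continuous_map (unit_top G) (sh_top E) (sh_zero E)"
    and continuous_add: "continuous_map
          (subtopology (prod_topology (sh_top E) (sh_top E)) {(e, e'). sh_proj E e = sh_proj E e'})
          (sh_top E) (\<lambda>(e, e'). sh_add E e e')"
    and continuous_smult: "continuous_map
          (prod_topology (discrete_topology (carrier R)) (sh_top E))
          (sh_top E) (\<lambda>(c, e). sh_smult E c e)"
    and linear_act: "g \<in> arrows G \<Longrightarrow>
          linear_on R (stalk E (rng G g)) (stalk E (src G g)) (\<lambda>e. sh_act E e g)"

definition sheaf_hom ::
  "'k ring \<Rightarrow> 'g groupoid \<Rightarrow> ('g, 'k, 'e) gsheaf \<Rightarrow> ('g, 'k, 'f) gsheaf \<Rightarrow> ('e \<Rightarrow> 'f) set" where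
  "sheaf_hom R G E F = {\<phi> \<in> extensional (topspace (sh_top E)).
     continuous_map (sh_top E) (sh_top F) \<phi> \<and>
     (\<forall>e\<in>topspace (sh_top E). sh_proj F (\<phi> e) = sh_proj E e) \<and>
     (\<forall>e\<in>topspace (sh_top E). \<forall>g\<in>arrows G. sh_proj E e = rng G g \<longrightarrow> \<phi> (sh_act E e g) = sh_act F (\<phi> e) g) \<and>
     (\<forall>x\<in>units G. linear_on R (stalk E x) (stalk F x) \<phi>)}"

definition sheaf_iso ::
  "'k ring \<Rightarrow> 'g groupoid \<Rightarrow> ('g, 'k, 'e) gsheaf \<Rightarrow> ('g, 'k, 'f) gsheaf \<Rightarrow> ('e \<Rightarrow> 'f) \<Rightarrow> bool" where
  "sheaf_iso R G E F \<phi> \<longleftrightarrow> \<phi> \<in> sheaf_hom R G E F \<and>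
     (\<exists>\<psi>\<in>sheaf_hom R G F E.
        (\<forall>e\<in>topspace (sh_top E). \<psi> (\<phi> e) = e) \<and> (\<forall>e\<in>topspace (sh_top F). \<phi> (\<psi> e) = e))"

definition sheaf_cat :: "'k ring \<Rightarrow> 'g groupoid \<Rightarrow> (('g, 'k, 'e) gsheaf, 'e \<Rightarrow> 'e) category" where
  "sheaf_cat R G =
     \<lparr>Obj = {E. gsheaf_of_modules R G E},
      Hom = sheaf_hom R G,
      Idn = (\<lambda>E. \<lambda>e\<in>topspace (sh_top E). e),
      Cmp = (\<lambda>E F H \<psi> \<phi>. compose (topspace (sh_top E)) \<psi> \<phi>)\<rparr>"


section \<open>The functor of compactly supported sections\<close>

definition sections_c :: "'g groupoid \<Rightarrow> ('g, 'k, 'e) gsheaf \<Rightarrow> ('g \<Rightarrow> 'e) set" where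
  "sections_c G E = {s \<in> extensional (units G).
     continuous_map (unit_top G) (sh_top E) s \<and>
     (\<forall>x\<in>units G. sh_proj E (s x) = x) \<and>
     compactin (unit_top G) (unit_top G closure_of {x \<in> units G. s x \<noteq> sh_zero E x})}"

definition Gamma_c_obj :: "'k ring \<Rightarrow> 'g groupoid \<Rightarrow> ('g, 'k, 'e) gsheaf \<Rightarrow> ('g \<Rightarrow> 'k, 'g \<Rightarrow> 'e) module" where
  "Gamma_c_obj R G E =
     \<lparr>carrier = sections_c G E,
      mult = (\<lambda>_ _. undefined), one = undefined,
      zero = (\<lambda>x\<in>units G. sh_zero E x),
      add = (\<lambda>s t. \<lambda>x\<in>units G. sh_add E (s x) (t x)),
      smult = (\<lambda>f s. \<lambda>x\<in>units G.
        (\<Oplus>\<^bsub>stalk E x\<^esub>g\<in>{g \<in> arrows G. src G g = x \<and> f g \<noteq> \<zero>\<^bsub>R\<^esub>}.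
           sh_smult E (f g) (sh_act E (s (rng G g)) g)))\<rparr>"

definition Gamma_c ::
  "'k ring \<Rightarrow> 'g groupoid \<Rightarrow>
    (('g, 'k, 'e) gsheaf, 'e \<Rightarrow> 'f, ('g \<Rightarrow> 'k, 'g \<Rightarrow> 'e) module, ('g \<Rightarrow> 'e) \<Rightarrow> ('g \<Rightarrow> 'f)) cfunctor" where
  "Gamma_c R G =
     \<lparr>on_obj = Gamma_c_obj R G,
      on_arr = (\<lambda>E F \<phi>. \<lambda>s\<in>sections_c G E. compose (units G) \<phi> s)\<rparr>"


section \<open>The functor of germs\<close>

definition nbhds_co :: "'g groupoid \<Rightarrow> 'g \<Rightarrow> 'g set set" where
  "nbhds_co G x = {U. compact_open (unit_top G) U \<and> x \<in> U}"

text \<open>\<open>M(U) = M \<chi>\<^sub>U\<close>.\<close>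

definition local_part :: "'k ring \<Rightarrow> ('g \<Rightarrow> 'k, 'm) module \<Rightarrow> 'g set \<Rightarrow> 'm set" where
  "local_part R M U = {char_fn R U \<odot>\<^bsub>M\<^esub> m |m. m \<in> carrier M}"

text \<open>The colimit of the modules \<open>M(U)\<close> over the compact open neighbourhoods \<open>U\<close> of \<open>x\<close> consists of the
  classes of this relation on pairs \<open>(U, m)\<close> with \<open>m \<in> M(U)\<close>.\<close>

definition germ_rel ::
  "'k ring \<Rightarrow> 'g groupoid \<Rightarrow> ('g \<Rightarrow> 'k, 'm) module \<Rightarrow> 'g \<Rightarrow> (('g set \<times> 'm) \<times> ('g set \<times> 'm)) set" where
  "germ_rel R G M x = {((U, m), (V, n)) |U m V n.
     U \<in> nbhds_co G x \<and> m \<in> local_part R M U \<and> V \<in> nbhds_co G x \<and> n \<in> local_part R M V \<and>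
     (\<exists>W\<in>nbhds_co G x. W \<subseteq> U \<inter> V \<and> char_fn R W \<odot>\<^bsub>M\<^esub> m = char_fn R W \<odot>\<^bsub>M\<^esub> n)}"

text \<open>\<open>germ R G M x m\<close> is \<open>(x, [m]\<^sub>x)\<close>, the base point making the union of the stalks disjoint. For
  \<open>m\<close> in a unitary module the neighbourhood in the choice exists: \<open>m\<close> lies in some \<open>M(U)\<close>, and \<open>U\<close>
  can be enlarged so as to contain \<open>x\<close>.\<close>

type_synonym ('g, 'm) germ = "'g \<times> ('g set \<times> 'm) set"

definition germ ::
  "'k ring \<Rightarrow> 'g groupoid \<Rightarrow> ('g \<Rightarrow> 'k, 'm) module \<Rightarrow> 'g \<Rightarrow> 'm \<Rightarrow> ('g, 'm) germ" where
  "germ R G M x m =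
     (x, germ_rel R G M x `` {(SOME U. U \<in> nbhds_co G x \<and> m \<in> local_part R M U, m)})"

text \<open>A representative \<open>m\<close> of the germ \<open>e = [m]\<^sub>x\<close>. The operations below do not depend on it.\<close>

definition germ_rep ::
  "'k ring \<Rightarrow> 'g groupoid \<Rightarrow> ('g \<Rightarrow> 'k, 'm) module \<Rightarrow> ('g, 'm) germ \<Rightarrow> 'm" where
  "germ_rep R G M e = (SOME m. m \<in> carrier M \<and> germ R G M (fst e) m = e)"

definition germ_basis ::
  "'k ring \<Rightarrow> 'g groupoid \<Rightarrow> ('g \<Rightarrow> 'k, 'm) module \<Rightarrow> ('g, 'm) germ set set" where
  "germ_basis R G M =
     {(\<lambda>x. germ R G M x m) ` U |U m. compact_open (unit_top G) U \<and> m \<in> carrier M}"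

definition Sh_obj ::
  "'k ring \<Rightarrow> 'g groupoid \<Rightarrow> ('g \<Rightarrow> 'k, 'm) module \<Rightarrow> ('g, 'k, ('g, 'm) germ) gsheaf" where
  "Sh_obj R G M =
     \<lparr>sh_top = topology (arbitrary union_of (\<lambda>S. S \<in> germ_basis R G M)),
      sh_proj = fst,
      sh_act = (\<lambda>e g. germ R G M (src G g)
        (char_fn R (SOME U. U \<in> Bis_c G \<and> g \<in> U) \<odot>\<^bsub>M\<^esub> germ_rep R G M e)),
      sh_add = (\<lambda>e e'. germ R G M (fst e) (germ_rep R G M e \<oplus>\<^bsub>M\<^esub> germ_rep R G M e')),
      sh_zero = (\<lambda>x. germ R G M x \<zero>\<^bsub>M\<^esub>),
      sh_smult = (\<lambda>c e. germ R G M (fst e) (scale R G M c (germ_rep R G M e)))\<rparr>"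

definition Sh ::
  "'k ring \<Rightarrow> 'g groupoid \<Rightarrow>
    (('g \<Rightarrow> 'k, 'm) module, 'm \<Rightarrow> 'm, ('g, 'k, ('g, 'm) germ) gsheaf, ('g, 'm) germ \<Rightarrow> ('g, 'm) germ) cfunctor" where
  "Sh R G =
     \<lparr>on_obj = Sh_obj R G,
      on_arr = (\<lambda>M N f. \<lambda>e\<in>topspace (sh_top (Sh_obj R G M)).
        germ R G N (fst e) (f (germ_rep R G M e)))\<rparr>"


section \<open>Size of the carrier types\<close>

text \<open>\<open>right_module_cat\<close> and \<open>sheaf_cat\<close> consist of the modules, respectively sheaves, whose elements have a
  given type \<open>'m\<close>, respectively \<open>'e\<close>. Since HOL has no type containing all types, comparing these two
  categories requires \<open>'m\<close> to have room for the sections of the sheaves on \<open>'e\<close>, and \<open>'e\<close> to have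
  room for the germs of the modules on \<open>'m\<close>.\<close>

definition large_enough :: "'g groupoid \<Rightarrow> 'm itself \<Rightarrow> 'e itself \<Rightarrow> bool" where
  "large_enough G _ _ \<longleftrightarrow>
     (units G \<rightarrow>\<^sub>E (UNIV :: 'e set)) \<lesssim> (UNIV :: 'm set) \<and>
     units G \<times> (UNIV :: 'm set) \<lesssim> (UNIV :: 'e set)"

text \<open>A type containing a copy of any given type \<open>'v\<close> and large enough on both sides.\<close>

lemma large_enough_example:
  fixes G :: "'g groupoid"
  shows "large_enough G TYPE(('g list \<times> 'v) set) TYPE(('g list \<times> 'v) set)"
proof -
  let ?u = "UNIV :: ('g list \<times> 'v) set set"
  have "inj_on (\<lambda>f. {(x # l, v) |x l v. x \<in> units G \<and> (l, v) \<in> f x}) (units G \<rightarrow>\<^sub>E ?u)"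
  proof (rule inj_onI)
    fix f f' :: "'g \<Rightarrow> ('g list \<times> 'v) set"
    assume f: "f \<in> units G \<rightarrow>\<^sub>E ?u" "f' \<in> units G \<rightarrow>\<^sub>E ?u"
      and eq: "{(x # l, v) |x l v. x \<in> units G \<and> (l, v) \<in> f x} =
               {(x # l, v) |x l v. x \<in> units G \<and> (l, v) \<in> f' x}"
    show "f = f'"
    proof (rule PiE_ext[OF f])
      fix x assume x: "x \<in> units G"
      have "(l, v) \<in> f x \<longleftrightarrow> (l, v) \<in> f' x" for l v
        using x eq[unfolded set_eq_iff, rule_format, of "(x # l, v)"] by simp
      then show "f x = f' x" by auto
    qed
  qed
  then have 1: "(units G \<rightarrow>\<^sub>E ?u) \<lesssim> ?u"
    unfolding lepoll_def by blast
  let ?j = "\<lambda>(x::'g, S::('g list \<times> 'v) set). {([x], v) |v. True} \<union> {(x # x # l, v) |l v. (l, v) \<in> S}"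
  have "inj_on ?j (units G \<times> ?u)"
  proof (rule inj_onI, clarify)
    fix x y :: 'g and S T :: "('g list \<times> 'v) set"
    assume eq: "{([x], v) |v. True} \<union> {(x # x # l, v) |l v. (l, v) \<in> S} =
                {([y], v) |v. True} \<union> {(y # y # l, v) |l v. (l, v) \<in> T}"
    note eq' = eq[unfolded set_eq_iff, rule_format]
    have xy: "x = y" using eq'[of "([x], undefined)"] by simp
    have "(l, v) \<in> S \<longleftrightarrow> (l, v) \<in> T" for l v
      using eq'[of "(x # x # l, v)"] xy by simp
    then show "x = y \<and> S = T" using xy by auto
  qed
  then have 2: "units G \<times> ?u \<lesssim> ?u"
    unfolding lepoll_def by blast
  from 1 2 show ?thesis unfolding large_enough_def by simp
qed

end

theory Submission
  imports Defs
begin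

text \<open>For a compact open set \<open>W\<close> of units, \<open>\<chi>\<^sub>W\<close> acts on a module as restriction to \<open>W\<close>. A module \<open>M\<close> is
  isomorphic to \<open>\<Gamma>\<^sub>c (Sh M)\<close> by sending \<open>m\<close> to the section \<open>x \<mapsto> [m]\<^sub>x\<close>: the support of a section has a finite
  disjoint cover by compact open sets on which the section is the germ of an element, and such local
  elements, cut down to the members of the cover, can be added up. The functor \<open>\<Gamma>\<^sub>c\<close> is fully faithful,
  because every point of a sheaf lies on a compactly supported section and a module homomorphism
  respects germs of sections. Hence the isomorphism \<open>\<Gamma>\<^sub>c (Sh (\<Gamma>\<^sub>c E)) \<rightarrow> \<Gamma>\<^sub>c E\<close> comes from a sheaf
  isomorphism \<open>Sh (\<Gamma>\<^sub>c E) \<rightarrow> E\<close>, namely \<open>[s]\<^sub>x \<mapsto> s x\<close>. For the categories over fixed types, the sheaf of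
  germs and the module of sections are copied along injections; full faithfulness of \<open>\<Gamma>\<^sub>c\<close> still
  matches the morphisms.\<close>

section \<open>Groupoids and their bisections\<close>

text \<open>The arrow space and the total space of a sheaf need not be Hausdorff. Compact open sets
  are therefore relied on to stay compact under intersection and difference only inside the unit
  space, where they are also closed; and two sections are compared on an open neighbourhood of a
  point where they agree, which comes from local injectivity of the projection. The algebra has no
  unit in general. Its place is taken by the functions \<open>\<chi>\<^sub>V\<close>,
  \<open>V\<close> compact open in the unit space: each module element is fixed by one of them, and
  this yields the scalar action, the existence of germs and the compact support of
  \<open>x \<mapsto> [m]\<^sub>x\<close>. Identities for convolution and for the action on sections
  are reduced by additivity to multiples of \<open>\<chi>\<^sub>U\<close> with \<open>U\<close> a
  compact open bisection. Such a \<open>U\<close> has at most one arrow over a given source, so sums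
  over fibres collapse to one term. \<open>Sh\<close> and \<open>\<Gamma>\<^sub>c\<close> change the
  element types, so they cannot run back and forth between two fixed categories; there, functors are
  chosen object by object.\<close>

lemma continuous_map_locally:
  assumes "\<And>x. x \<in> topspace X \<Longrightarrow> \<exists>N. openin X N \<and> x \<in> N \<and> continuous_map (subtopology X N) Y f"
  shows "continuous_map X Y f"
proof -
  obtain N where N: "\<And>x. x \<in> topspace X \<Longrightarrow> openin X (N x) \<and> x \<in> N x \<and> continuous_map (subtopology X (N x)) Y f"
    using assms by metis
  show ?thesis
    by (rule pasting_lemma[where I = "topspace X" and T = N and f = "\<lambda>_. f"]) (use N in auto)
qed

lemma compact_open_openin: "compact_open X U \<Longrightarrow> openin X U"
  by (simp add: compact_open_def)

lemma compact_open_compactin: "compact_open X U \<Longrightarrow> compactin X U"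
  by (simp add: compact_open_def)

lemma compact_open_iff_Hausdorff:
  "Hausdorff_space X \<Longrightarrow> compact_open X U \<longleftrightarrow> openin X U \<and> compactin X U"
  by (auto simp: compact_open_def Hausdorff_space_subtopology)

lemma local_homeomorphism_imp_continuous_map:
  assumes "local_homeomorphism X Y f"
  shows "continuous_map X Y f"
proof (rule continuous_map_locally)
  fix x assume "x \<in> topspace X"
  then obtain U where U: "x \<in> U" "openin X U"
    and h: "homeomorphic_map (subtopology X U) (subtopology Y (f ` U)) f"
    using assms unfolding local_homeomorphism_def by blast
  have "continuous_map (subtopology X U) Y f"
    using homeomorphic_imp_continuous_map[OF h] by (simp add: continuous_map_in_subtopology)
  with U show "\<exists>N. openin X N \<and> x \<in> N \<and> continuous_map (subtopology X N) Y f" by blast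
qed

lemma local_homeomorphism_imp_open_map:
  assumes "local_homeomorphism X Y f"
  shows "open_map X Y f"
  unfolding open_map_def
proof (intro allI impI)
  fix W assume W: "openin X W"
  show "openin Y (f ` W)"
  proof (subst openin_subopen, safe)
    fix x assume x: "x \<in> W"
    then have "x \<in> topspace X" using W openin_subset by blast
    then obtain U where U: "x \<in> U" "openin X U" "openin Y (f ` U)"
      and h: "homeomorphic_map (subtopology X U) (subtopology Y (f ` U)) f"
      using assms unfolding local_homeomorphism_def by blast
    have "openin (subtopology X U) (W \<inter> U)"
      using W by (simp add: openin_subtopology_Int)
    then have "openin (subtopology Y (f ` U)) (f ` (W \<inter> U))"
      using homeomorphic_imp_open_map[OF h] by (simp add: open_map_def)
    then have "openin Y (f ` (W \<inter> U))"
      using U(3) openin_trans_full by blast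
    then show "\<exists>T. openin Y T \<and> f x \<in> T \<and> T \<subseteq> f ` W"
      using x U(1) by (intro exI[of _ "f ` (W \<inter> U)"]) auto
  qed
qed

lemma local_homeomorphism_inj:
  assumes "local_homeomorphism X Y f" "x \<in> topspace X"
  obtains U where "x \<in> U" "openin X U" "inj_on f U"
proof -
  from assms obtain U where U: "x \<in> U" "openin X U"
    and h: "homeomorphic_map (subtopology X U) (subtopology Y (f ` U)) f"
    unfolding local_homeomorphism_def by blast
  have "inj_on f U"
    using homeomorphic_imp_injective_map[OF h] openin_subset[OF U(2)] by (simp add: Int_absorb1)
  with U that show ?thesis by blast
qed

text \<open>An injective open continuous map is an embedding, so no local inverse has to be
  exhibited. The projection of a sheaf of germs is treated in this way.\<close>

lemma local_homeomorphismI: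
  assumes "continuous_map X Y f" "open_map X Y f"
    and "\<And>x. x \<in> topspace X \<Longrightarrow> \<exists>U. x \<in> U \<and> openin X U \<and> inj_on f U"
  shows "local_homeomorphism X Y f"
  unfolding local_homeomorphism_def
proof
  fix x assume "x \<in> topspace X"
  then obtain U where U: "x \<in> U" "openin X U" "inj_on f U" using assms(3) by blast
  have sub: "U \<subseteq> topspace X" using U(2) by (rule openin_subset)
  have "embedding_map (subtopology X U) Y f"
    using assms(1,2) U sub
    by (intro injective_open_imp_embedding_map open_map_from_subtopology
        continuous_map_from_subtopology) (auto simp: Int_absorb1)
  then have "homeomorphic_map (subtopology X U) (subtopology Y (f ` U)) f"
    using sub by (simp add: embedding_map_def Int_absorb1)
  then show "\<exists>U. x \<in> U \<and> openin X U \<and> openin Y (f ` U) \<and>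
      homeomorphic_map (subtopology X U) (subtopology Y (f ` U)) f"
    using U assms(2) by (auto simp: open_map_def)
qed

text \<open>The preimage of an open \<open>U\<close> under the inverse is the image of
  \<open>N \<inter> U\<close>, which is open since \<open>f\<close> is. Applied to the source map
  this gives the arrows of a bisection as a continuous function of their source; applied to a sheaf
  projection it gives local sections.\<close>

lemma continuous_map_inv_into_open_map:
  assumes "open_map X Y f" "openin X N" "inj_on f N"
  shows "continuous_map (subtopology Y (f ` N)) X (inv_into N f)"
proof -
  have fN: "openin Y (f ` N)" using assms by (simp add: open_map_def)
  have sub: "N \<subseteq> topspace X" using assms(2) by (rule openin_subset)
  show ?thesis
    unfolding continuous_map_def
  proof (intro conjI allI impI)
    show "inv_into N f \<in> topspace (subtopology Y (f ` N)) \<rightarrow> topspace X"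
    proof
      fix x assume "x \<in> topspace (subtopology Y (f ` N))"
      then have "inv_into N f x \<in> N" by (intro inv_into_into) simp
      then show "inv_into N f x \<in> topspace X" using sub by blast
    qed
    fix U assume U: "openin X U"
    have "{x \<in> topspace (subtopology Y (f ` N)). inv_into N f x \<in> U} = f ` (N \<inter> U)"
      using openin_subset[OF fN] assms(3) by auto
    moreover have "openin Y (f ` (N \<inter> U))" using assms U by (auto simp: open_map_def)
    ultimately show "openin (subtopology Y (f ` N)) {x \<in> topspace (subtopology Y (f ` N)). inv_into N f x \<in> U}"
      using fN by (auto simp: openin_open_subtopology)
  qed
qed

section \<open>Calculus of arrows in a topological groupoid\<close>

context topological_groupoid
begin

lemma units_subset_arrows: "units G \<subseteq> arrows G"
  by (auto simp: units_def)

lemma unit_arrow: "x \<in> units G \<Longrightarrow> x \<in> arrows G"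
  by (simp add: units_def)

lemma src_of_unit: "x \<in> units G \<Longrightarrow> src G x = x"
  by (simp add: units_def)

lemma topspace_unit_top [simp]: "topspace (unit_top G) = units G"
  using units_subset_arrows by (auto simp: unit_top_def arrows_def)

lemma topspace_arr_top [simp]: "topspace (arr_top G) = arrows G"
  by (simp add: arrows_def)

lemma gmul_ginv_cancel:
  assumes "g \<in> arrows G" "h \<in> arrows G" "src G g = rng G h"
  shows "gmul G (gmul G g h) (ginv G h) = g"
  using assms gmul_assoc[of g h "ginv G h"] gmul_src[of g]
  by (simp add: ginv_closed rng_ginv gmul_ginv_right)

lemma gmul_ginv_cancel':
  assumes "g \<in> arrows G" "h \<in> arrows G" "src G g = src G h"
  shows "gmul G (gmul G g (ginv G h)) h = g"
  using assms gmul_assoc[of g "ginv G h" h] gmul_src[of g]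
  by (simp add: ginv_closed rng_ginv src_ginv gmul_ginv_left)

lemma ginv_ginv:
  assumes g: "g \<in> arrows G"
  shows "ginv G (ginv G g) = g"
proof -
  have "ginv G (ginv G g) = gmul G (ginv G (ginv G g)) (src G g)"
    using g gmul_src[of "ginv G (ginv G g)"] by (simp add: ginv_closed src_ginv rng_ginv)
  also have "\<dots> = gmul G (ginv G (ginv G g)) (gmul G (ginv G g) g)"
    using g by (simp add: gmul_ginv_left)
  also have "\<dots> = gmul G (src G (ginv G g)) g"
    using g by (subst gmul_assoc[symmetric]) (auto simp: ginv_closed src_ginv rng_ginv gmul_ginv_left)
  also have "\<dots> = g" using g by (simp add: src_ginv gmul_rng)
  finally show ?thesis .
qed

lemma ginv_unit:
  assumes x: "x \<in> units G"
  shows "ginv G x = x"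
proof -
  have a: "x \<in> arrows G" using x by (rule unit_arrow)
  have "ginv G x = gmul G x (ginv G x)"
    using gmul_rng[of "ginv G x"] a x by (simp add: ginv_closed rng_ginv src_of_unit)
  also have "\<dots> = x" using a x by (simp add: gmul_ginv_right rng_of_unit)
  finally show ?thesis .
qed

lemma continuous_map_gmul:
  assumes "continuous_map X (arr_top G) f" "continuous_map X (arr_top G) g"
    and "\<And>x. x \<in> topspace X \<Longrightarrow> src G (f x) = rng G (g x)"
  shows "continuous_map X (arr_top G) (\<lambda>x. gmul G (f x) (g x))"
proof -
  have "continuous_map X (subtopology (prod_topology (arr_top G) (arr_top G)) {(g, h). src G g = rng G h})
     (\<lambda>x. (f x, g x))"
    using assms by (auto simp: continuous_map_in_subtopology continuous_map_paired)
  from continuous_map_compose[OF this continuous_gmul] show ?thesis by (simp add: o_def)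
qed

end

section \<open>Open source and range maps, openness of the unit space\<close>

context etale_groupoid
begin

lemma open_map_src: "open_map (arr_top G) (unit_top G) (src G)"
  using local_homeomorphism_src by (rule local_homeomorphism_imp_open_map)

lemma openin_arr_src_preimage: "openin (unit_top G) W \<Longrightarrow> openin (arr_top G) {g \<in> arrows G. src G g \<in> W}"
  using openin_continuous_map_preimage[OF continuous_src] by simp

lemma openin_ginv_preimage: "openin (arr_top G) W \<Longrightarrow> openin (arr_top G) {g \<in> arrows G. ginv G g \<in> W}"
  using openin_continuous_map_preimage[OF continuous_ginv] by simp

text \<open>Inversion is a continuous involution that exchanges source and range, so the range image
  of \<open>W\<close> is the source image of an open set.\<close>

lemma open_map_rng: "open_map (arr_top G) (unit_top G) (rng G)"
  unfolding open_map_def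
proof (intro allI impI)
  fix W assume W: "openin (arr_top G) W"
  have sub: "W \<subseteq> arrows G" using openin_subset[OF W] by simp
  have "rng G ` W = src G ` {g \<in> arrows G. ginv G g \<in> W}"
  proof (intro equalityI subsetI)
    fix y assume "y \<in> rng G ` W"
    then obtain g where "g \<in> W" "y = rng G g" by blast
    then show "y \<in> src G ` {g \<in> arrows G. ginv G g \<in> W}"
      using sub by (intro image_eqI[of _ _ "ginv G g"]) (auto simp: src_ginv ginv_closed ginv_ginv)
  next
    fix y assume "y \<in> src G ` {g \<in> arrows G. ginv G g \<in> W}"
    then obtain g where "g \<in> arrows G" "ginv G g \<in> W" "y = src G g" by blast
    then show "y \<in> rng G ` W" by (intro image_eqI[of _ _ "ginv G g"]) (auto simp: rng_ginv)
  qed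
  then show "openin (unit_top G) (rng G ` W)"
    using open_map_src openin_ginv_preimage[OF W] by (simp add: open_map_def)
qed

text \<open>Let the source map be injective on an open \<open>U\<close> around a unit. If an arrow
  of \<open>U\<close> has its source in \<open>U\<close> as well, then the arrow and its source are
  two points of \<open>U\<close> with the same source, so the arrow is a unit.\<close>

lemma openin_units: "openin (arr_top G) (units G)"
proof (subst openin_subopen, rule ballI)
  fix x assume x: "x \<in> units G"
  then have "x \<in> topspace (arr_top G)" by (simp add: unit_arrow)
  then obtain U where U: "x \<in> U" "openin (arr_top G) U" "inj_on (src G) U"
    using local_homeomorphism_inj[OF local_homeomorphism_src] by metis
  define V where "V = {g \<in> arrows G. src G g \<in> U \<inter> units G} \<inter> U"
  have "openin (unit_top G) (U \<inter> units G)"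
    using U(2) by (simp add: unit_top_def openin_subtopology_Int)
  then have "openin (arr_top G) V"
    unfolding V_def using U(2) openin_arr_src_preimage by blast
  moreover have "x \<in> V" using x U(1) by (simp add: V_def src_of_unit unit_arrow)
  moreover have "V \<subseteq> units G"
  proof
    fix g assume g: "g \<in> V"
    then have "src G g = src G (src G g)" by (simp add: V_def src_of_unit)
    then have "g = src G g" using U(3) g by (auto simp: V_def inj_on_def)
    with g show "g \<in> units G" by (simp add: V_def)
  qed
  ultimately show "\<exists>T. openin (arr_top G) T \<and> x \<in> T \<and> T \<subseteq> units G" by blast
qed

lemma openin_unit_top_iff: "openin (unit_top G) U \<longleftrightarrow> openin (arr_top G) U \<and> U \<subseteq> units G"
  by (simp add: unit_top_def openin_open_subtopology[OF openin_units])

lemma openin_unit_top_imp_arr_top: "openin (unit_top G) U \<Longrightarrow> openin (arr_top G) U"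
  by (simp add: openin_unit_top_iff)

end

definition bis_mult :: "'g groupoid \<Rightarrow> 'g set \<Rightarrow> 'g set \<Rightarrow> 'g set" where
  "bis_mult G U V = {gmul G u v |u v. u \<in> U \<and> v \<in> V \<and> src G u = rng G v}"

section \<open>Compact open sets of units and compact open bisections\<close>

context ample_groupoid
begin

text \<open>Source and range are continuous and open, hence embeddings on any open set where they
  are injective. The Hausdorff property of \<open>U\<close> is pulled back from the unit space along
  the injective source map.\<close>

lemma Bis_c_iff:
  "U \<in> Bis_c G \<longleftrightarrow> openin (arr_top G) U \<and> compactin (arr_top G) U \<and> inj_on (src G) U \<and> inj_on (rng G) U"
proof
  assume "U \<in> Bis_c G"
  then have U: "openin (arr_top G) U" "compactin (arr_top G) U"
    and e: "embedding_map (subtopology (arr_top G) U) (unit_top G) (src G)"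
      "embedding_map (subtopology (arr_top G) U) (unit_top G) (rng G)"
    by (auto simp: Bis_c_def compact_open_def local_bisection_def)
  have "inj_on (src G) U" "inj_on (rng G) U"
    using e[THEN embedding_imp_closed_map_eq] openin_subset[OF U(1)]
      e[unfolded embedding_map_def, THEN homeomorphic_imp_injective_map]
    by (auto simp: Int_absorb1)
  with U show "openin (arr_top G) U \<and> compactin (arr_top G) U \<and> inj_on (src G) U \<and> inj_on (rng G) U"
    by simp
next
  assume U: "openin (arr_top G) U \<and> compactin (arr_top G) U \<and> inj_on (src G) U \<and> inj_on (rng G) U"
  then have sub: "U \<subseteq> arrows G" using openin_subset by fastforce
  have cs: "continuous_map (subtopology (arr_top G) U) (unit_top G) (src G)"
    by (rule continuous_map_from_subtopology[OF continuous_src])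
  have cr: "continuous_map (subtopology (arr_top G) U) (unit_top G) (rng G)"
    by (rule continuous_map_from_subtopology[OF continuous_rng])
  have "Hausdorff_space (subtopology (arr_top G) U)"
    using Hausdorff_space_injective_preimage[OF Hausdorff_units cs] U sub by (simp add: Int_absorb1)
  moreover have "embedding_map (subtopology (arr_top G) U) (unit_top G) (src G)"
    using U sub cs
    by (intro injective_open_imp_embedding_map open_map_from_subtopology[OF open_map_src])
      (auto simp: Int_absorb1)
  moreover have "embedding_map (subtopology (arr_top G) U) (unit_top G) (rng G)"
    using U sub cr
    by (intro injective_open_imp_embedding_map open_map_from_subtopology[OF open_map_rng])
      (auto simp: Int_absorb1)
  ultimately show "U \<in> Bis_c G"
    using U by (auto simp: Bis_c_def compact_open_def local_bisection_def)
qed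

lemma Bis_c_subset: "U \<in> Bis_c G \<Longrightarrow> U \<subseteq> arrows G"
  using openin_subset by (fastforce simp: Bis_c_iff)

lemma compact_open_unit_iff:
  "compact_open (unit_top G) U \<longleftrightarrow> openin (unit_top G) U \<and> compactin (unit_top G) U"
  using compact_open_iff_Hausdorff[OF Hausdorff_units] .

lemma compact_open_subset_units: "compact_open (unit_top G) U \<Longrightarrow> U \<subseteq> units G"
  using openin_subset by (fastforce simp: compact_open_def)

lemma compact_open_closedin: "compact_open (unit_top G) U \<Longrightarrow> closedin (unit_top G) U"
  by (simp add: compact_open_def compactin_imp_closedin[OF Hausdorff_units])

lemma compact_open_empty: "compact_open (unit_top G) {}"
  by (simp add: compact_open_unit_iff)

lemma compact_open_Un:
  "compact_open (unit_top G) U \<Longrightarrow> compact_open (unit_top G) V \<Longrightarrow> compact_open (unit_top G) (U \<union> V)"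
  by (simp add: compact_open_unit_iff openin_Un compactin_Un)

lemma compact_open_Int:
  "compact_open (unit_top G) U \<Longrightarrow> compact_open (unit_top G) V \<Longrightarrow> compact_open (unit_top G) (U \<inter> V)"
  by (simp add: compact_open_unit_iff openin_Int compactin_Int[OF Hausdorff_units])

lemma compact_open_Diff:
  assumes "compact_open (unit_top G) U" "compact_open (unit_top G) V"
  shows "compact_open (unit_top G) (U - V)"
proof -
  have "openin (unit_top G) (U - V)"
    using assms compact_open_closedin openin_diff by (auto simp: compact_open_unit_iff)
  moreover have "U - V = U \<inter> (topspace (unit_top G) - V)"
    using compact_open_subset_units[OF assms(1)] by auto
  then have "compactin (unit_top G) (U - V)"
    using assms compact_Int_closedin[of "unit_top G" U "units G - V"]
      openin_closedin_eq[of "unit_top G" V] by (simp add: compact_open_unit_iff)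
  ultimately show ?thesis by (simp add: compact_open_unit_iff)
qed

lemma compact_open_Union:
  "finite F \<Longrightarrow> (\<And>U. U \<in> F \<Longrightarrow> compact_open (unit_top G) U) \<Longrightarrow> compact_open (unit_top G) (\<Union>F)"
  by (induction F rule: finite_induct) (auto simp: compact_open_empty compact_open_Un)

lemma compactin_unit_arr: "compactin (unit_top G) U \<Longrightarrow> compactin (arr_top G) U"
  by (simp add: unit_top_def compactin_subtopology)

lemma compact_open_Bis_c: "compact_open (unit_top G) U \<Longrightarrow> U \<in> Bis_c G"
  using compact_open_subset_units[of U] openin_unit_top_imp_arr_top compactin_unit_arr
  by (auto simp: Bis_c_iff compact_open_def inj_on_def src_of_unit rng_of_unit subset_iff)

lemma compact_open_src_image: "U \<in> Bis_c G \<Longrightarrow> compact_open (unit_top G) (src G ` U)"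
  using open_map_src image_compactin[OF _ continuous_src]
  by (auto simp: Bis_c_iff compact_open_unit_iff open_map_def)

lemma compact_open_rng_image: "U \<in> Bis_c G \<Longrightarrow> compact_open (unit_top G) (rng G ` U)"
  using open_map_rng image_compactin[OF _ continuous_rng]
  by (auto simp: Bis_c_iff compact_open_unit_iff open_map_def)

text \<open>The compact open subsets of \<open>W\<close> cover \<open>K\<close>, and a finite union
  of them is again compact open. This encloses the closed support of a section in a compact open
  set.\<close>

lemma compact_open_between:
  assumes "compactin (unit_top G) K" "openin (unit_top G) W" "K \<subseteq> W"
  obtains U where "compact_open (unit_top G) U" "K \<subseteq> U" "U \<subseteq> W"
proof -
  let ?C = "{U. compact_open (unit_top G) U \<and> U \<subseteq> W}"
  have op: "\<And>U. U \<in> ?C \<Longrightarrow> openin (unit_top G) U" by (auto simp: compact_open_def)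
  have cov: "K \<subseteq> \<Union>?C" using compact_open_basis[OF assms(2)] assms(3) by blast
  obtain F where F: "finite F" "F \<subseteq> ?C" "K \<subseteq> \<Union>F"
    using compactinD[OF assms(1) op cov] by blast
  have "compact_open (unit_top G) (\<Union>F)" using F by (intro compact_open_Union) auto
  moreover have "\<Union>F \<subseteq> W" using F by blast
  ultimately show ?thesis using F(3) by (intro that)
qed

text \<open>Differences of compact open sets are compact open, so a finite cover can be made disjoint.\<close>

lemma compact_open_disjoint_induct:
  assumes U: "compact_open (unit_top G) U"
    and local: "\<And>x. x \<in> U \<Longrightarrow> \<exists>W. compact_open (unit_top G) W \<and> x \<in> W \<and> P W"
    and empty: "P {}"
    and subset: "\<And>V W. compact_open (unit_top G) V \<Longrightarrow> compact_open (unit_top G) W \<Longrightarrow> V \<subseteq> W \<Longrightarrow> P W \<Longrightarrow> P V"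
    and union: "\<And>V W. compact_open (unit_top G) V \<Longrightarrow> compact_open (unit_top G) W \<Longrightarrow> V \<inter> W = {} \<Longrightarrow>
      P V \<Longrightarrow> P W \<Longrightarrow> P (V \<union> W)"
  shows "P U"
proof -
  let ?C = "{W. compact_open (unit_top G) W \<and> P W}"
  have op: "\<And>W. W \<in> ?C \<Longrightarrow> openin (unit_top G) W" by (auto simp: compact_open_def)
  have cov: "U \<subseteq> \<Union>?C" using local by blast
  obtain F where F: "finite F" "F \<subseteq> ?C" "U \<subseteq> \<Union>F"
    using compactinD[OF compact_open_compactin[OF U] op cov] by blast
  have "compact_open (unit_top G) (\<Union>F) \<and> P (\<Union>F)" using F(1,2)
  proof (induction F rule: finite_induct)
    case empty
    then show ?case using assms(3) by (simp add: compact_open_empty)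
  next
    case (insert A F)
    then have A: "compact_open (unit_top G) A" "P A"
      and F: "compact_open (unit_top G) (\<Union>F)" "P (\<Union>F)" by auto
    have D: "compact_open (unit_top G) (A - \<Union>F)" using A(1) F(1) by (rule compact_open_Diff)
    have "P (A - \<Union>F)" using subset[OF D A(1) _ A(2)] by blast
    from union[OF D F(1) _ this F(2)] have "P (A \<union> \<Union>F)" by (simp add: Int_commute Diff_disjoint)
    then show ?case using A F by (simp add: compact_open_Un)
  qed
  then show ?thesis using subset[OF U] F(3) by blast
qed

text \<open>\<open>N\<close> is first shrunk to an open \<open>L\<close> on which source and range
  are injective, the range being the source of the inverse. Compactness then comes from the unit
  space: the arrows of \<open>L\<close> with source in a compact open \<open>W\<close> are the image
  of \<open>W\<close> under the continuous inverse of the source map on \<open>L\<close>.\<close>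

lemma Bis_c_basis:
  assumes "openin (arr_top G) N" "g \<in> N"
  obtains U where "U \<in> Bis_c G" "g \<in> U" "U \<subseteq> N"
proof -
  have g: "g \<in> arrows G" using assms openin_subset by fastforce
  obtain U1 where U1: "g \<in> U1" "openin (arr_top G) U1" "inj_on (src G) U1"
    using local_homeomorphism_inj[OF local_homeomorphism_src, of g] g by auto
  obtain U2 where U2: "ginv G g \<in> U2" "openin (arr_top G) U2" "inj_on (src G) U2"
    using local_homeomorphism_inj[OF local_homeomorphism_src, of "ginv G g"] g
    by (auto simp: ginv_closed)
  define L where "L = N \<inter> U1 \<inter> {h \<in> arrows G. ginv G h \<in> U2}"
  have L: "openin (arr_top G) L"
    unfolding L_def using assms(1) U1(2) openin_ginv_preimage[OF U2(2)] by blast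
  have gL: "g \<in> L" using assms U1 U2 g by (simp add: L_def)
  have Larr: "L \<subseteq> arrows G" by (auto simp: L_def)
  have injs: "inj_on (src G) L" using U1(3) by (rule inj_on_subset) (auto simp: L_def)
  have injr: "inj_on (rng G) L"
  proof (rule inj_onI)
    fix h k assume hk: "h \<in> L" "k \<in> L" "rng G h = rng G k"
    then have "src G (ginv G h) = src G (ginv G k)" by (simp add: L_def src_ginv)
    then have "ginv G h = ginv G k" using U2(3) hk by (auto simp: L_def inj_on_def)
    then show "h = k" using ginv_ginv hk Larr by (metis subsetD)
  qed
  have oL: "openin (unit_top G) (src G ` L)" using open_map_src L by (simp add: open_map_def)
  obtain W where W: "compact_open (unit_top G) W" "src G g \<in> W" "W \<subseteq> src G ` L"
    using compact_open_basis[OF oL] gL by blast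
  define U where "U = L \<inter> {h \<in> arrows G. src G h \<in> W}"
  have "openin (arr_top G) U"
    unfolding U_def using L openin_arr_src_preimage[of W] W(1) by (auto simp: compact_open_def)
  moreover have "compactin (arr_top G) U"
  proof -
    have "U = inv_into L (src G) ` W"
    proof (intro equalityI subsetI)
      fix h assume "h \<in> U"
      then show "h \<in> inv_into L (src G) ` W"
        using injs by (intro image_eqI[of _ _ "src G h"]) (auto simp: U_def)
    next
      fix h assume "h \<in> inv_into L (src G) ` W"
      then obtain x where x: "x \<in> W" "h = inv_into L (src G) x" by blast
      then have "x \<in> src G ` L" using W(3) by blast
      then have "h \<in> L" "src G h = x" using x(2) by (auto simp: inv_into_into f_inv_into_f)
      then show "h \<in> U" using x(1) Larr by (auto simp: U_def)
    qed
    moreover have "compactin (subtopology (unit_top G) (src G ` L)) W"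
      using W by (simp add: compactin_subtopology compact_open_def)
    ultimately show ?thesis
      using image_compactin continuous_map_inv_into_open_map[OF open_map_src L injs] by metis
  qed
  moreover have "inj_on (src G) U" using injs by (rule inj_on_subset) (auto simp: U_def)
  moreover have "inj_on (rng G) U" using injr by (rule inj_on_subset) (auto simp: U_def)
  ultimately have "U \<in> Bis_c G" by (simp add: Bis_c_iff)
  moreover have "g \<in> U" using gL g W(2) by (simp add: U_def)
  moreover have "U \<subseteq> N" by (auto simp: U_def L_def)
  ultimately show ?thesis using that by blast
qed

lemma arrow_in_Bis_c:
  assumes "g \<in> arrows G"
  obtains U where "U \<in> Bis_c G" "g \<in> U"
proof -
  have "openin (arr_top G) (arrows G)" using openin_topspace[of "arr_top G"] by simp
  from Bis_c_basis[OF this assms] that show ?thesis by metis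
qed

lemma nbhds_co_basis:
  assumes "openin (unit_top G) W" "x \<in> W"
  obtains U where "U \<in> nbhds_co G x" "U \<subseteq> W"
  using compact_open_basis[OF assms] by (auto simp: nbhds_co_def)

lemma nbhds_co_ex:
  assumes "x \<in> units G"
  obtains U where "U \<in> nbhds_co G x"
proof -
  have "openin (unit_top G) (units G)" using openin_topspace[of "unit_top G"] by simp
  from nbhds_co_basis[OF this assms] that show ?thesis by metis
qed

lemma nbhds_co_Int: "U \<in> nbhds_co G x \<Longrightarrow> V \<in> nbhds_co G x \<Longrightarrow> U \<inter> V \<in> nbhds_co G x"
  by (simp add: nbhds_co_def compact_open_Int)

text \<open>For a bisection \<open>U\<close> this is the unique arrow of \<open>U\<close> starting
  at a given unit, the index of the single term that survives in sums over a source fibre. Outside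
  the source image of \<open>U\<close> the value is arbitrary, so it appears only under a membership
  test.\<close>

definition lift :: "'a set \<Rightarrow> 'a \<Rightarrow> 'a" where
  "lift U = inv_into U (src G)"

lemma lift_src: "U \<in> Bis_c G \<Longrightarrow> g \<in> U \<Longrightarrow> lift U (src G g) = g"
  by (simp add: lift_def Bis_c_iff)

lemma lift_in: "x \<in> src G ` U \<Longrightarrow> lift U x \<in> U"
  unfolding lift_def by (rule inv_into_into)

lemma src_lift: "x \<in> src G ` U \<Longrightarrow> src G (lift U x) = x"
  unfolding lift_def by (rule f_inv_into_f)

lemma lift_arrow: "U \<in> Bis_c G \<Longrightarrow> x \<in> src G ` U \<Longrightarrow> lift U x \<in> arrows G"
  using lift_in Bis_c_subset by blast

lemma lift_unit:
  assumes "compact_open (unit_top G) U" "x \<in> U"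
  shows "lift U x = x"
proof -
  have x: "x \<in> units G" using assms compact_open_subset_units by blast
  then show ?thesis
    using lift_src[OF compact_open_Bis_c[OF assms(1)] assms(2)] by (simp add: src_of_unit)
qed

lemma src_image_units: "U \<subseteq> units G \<Longrightarrow> src G ` U = U"
proof -
  assume "U \<subseteq> units G"
  then have "src G ` U = (\<lambda>x. x) ` U" by (intro image_cong) (auto simp: src_of_unit)
  then show ?thesis by simp
qed

lemma continuous_map_lift:
  "U \<in> Bis_c G \<Longrightarrow> continuous_map (subtopology (unit_top G) (src G ` U)) (arr_top G) (lift U)"
  unfolding lift_def
  by (rule continuous_map_inv_into_open_map[OF open_map_src]) (auto simp: Bis_c_iff)

text \<open>A factorisation of \<open>g\<close> is forced: the right factor is the arrow of
  \<open>V\<close> with the same source as \<open>g\<close>, and the left factor is \<open>g\<close>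
  times its inverse. The condition is the one met when convolution with
  \<open>\<chi>\<^sub>V\<close> is evaluated, and it presents the product as a preimage of
  \<open>U\<close>.\<close>

lemma bis_mult_iff:
  assumes U: "U \<in> Bis_c G" and V: "V \<in> Bis_c G"
  shows "g \<in> bis_mult G U V \<longleftrightarrow>
    g \<in> arrows G \<and> src G g \<in> src G ` V \<and> gmul G g (ginv G (lift V (src G g))) \<in> U"
proof
  assume "g \<in> bis_mult G U V"
  then obtain u v where uv: "g = gmul G u v" "u \<in> U" "v \<in> V" "src G u = rng G v"
    by (auto simp: bis_mult_def)
  then have a: "u \<in> arrows G" "v \<in> arrows G" using Bis_c_subset U V by auto
  have s: "src G g = src G v" using uv a by (simp add: src_gmul)
  have "g \<in> arrows G" using uv a by (simp add: gmul_closed)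
  moreover have "lift V (src G g) = v" using s V uv(3) by (simp add: lift_src)
  ultimately show "g \<in> arrows G \<and> src G g \<in> src G ` V \<and> gmul G g (ginv G (lift V (src G g))) \<in> U"
    using uv a s by (simp add: gmul_ginv_cancel)
next
  assume r: "g \<in> arrows G \<and> src G g \<in> src G ` V \<and> gmul G g (ginv G (lift V (src G g))) \<in> U"
  define v where "v = lift V (src G g)"
  have v: "v \<in> V" "v \<in> arrows G" "src G v = src G g"
    using r V lift_in lift_arrow src_lift by (auto simp: v_def)
  have "g = gmul G (gmul G g (ginv G v)) v" using r v by (simp add: gmul_ginv_cancel')
  moreover have "src G (gmul G g (ginv G v)) = rng G v"
    using r v by (simp add: src_gmul ginv_closed src_ginv rng_ginv)
  ultimately show "g \<in> bis_mult G U V" using r v unfolding v_def bis_mult_def by blast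
qed

text \<open>Openness follows from the description of the product as the preimage of \<open>U\<close>
  under a continuous map on the open set \<open>D\<close>; compactness needs the product from the
  other side, as an image of composable pairs.\<close>

lemma bis_mult_closed:
  assumes U: "U \<in> Bis_c G" and V: "V \<in> Bis_c G"
  shows "bis_mult G U V \<in> Bis_c G"
proof -
  note sub = Bis_c_subset[OF U] Bis_c_subset[OF V]
  define D where "D = {g \<in> arrows G. src G g \<in> src G ` V}"
  have D: "openin (arr_top G) D"
    unfolding D_def using compact_open_src_image[OF V]
    by (intro openin_arr_src_preimage) (simp add: compact_open_def)
  let ?X = "subtopology (arr_top G) D"
  have "continuous_map ?X (subtopology (unit_top G) (src G ` V)) (src G)"
    using continuous_map_from_subtopology[OF continuous_src]
    by (auto simp: continuous_map_in_subtopology D_def)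
  from continuous_map_compose[OF this continuous_map_lift[OF V]]
  have cl: "continuous_map ?X (arr_top G) (\<lambda>g. lift V (src G g))" by (simp add: o_def)
  from continuous_map_compose[OF this continuous_ginv]
  have ci: "continuous_map ?X (arr_top G) (\<lambda>g. ginv G (lift V (src G g)))" by (simp add: o_def)
  have cid: "continuous_map ?X (arr_top G) (\<lambda>g. g)"
    using continuous_map_from_subtopology[OF continuous_map_id] by (simp add: id_def)
  have cg: "continuous_map ?X (arr_top G) (\<lambda>g. gmul G g (ginv G (lift V (src G g))))"
    by (rule continuous_map_gmul[OF cid ci])
      (auto simp: D_def rng_ginv lift_arrow[OF V] src_lift)
  have "openin ?X {g \<in> topspace ?X. gmul G g (ginv G (lift V (src G g))) \<in> U}"
    using cg U by (intro openin_continuous_map_preimage[OF cg]) (simp add: Bis_c_iff)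
  then have "openin (arr_top G) {g \<in> topspace ?X. gmul G g (ginv G (lift V (src G g))) \<in> U}"
    using D openin_trans_full by blast
  moreover have "{g \<in> topspace ?X. gmul G g (ginv G (lift V (src G g))) \<in> U} = bis_mult G U V"
    using bis_mult_iff[OF U V] by (auto simp: D_def)
  ultimately have op: "openin (arr_top G) (bis_mult G U V)" by simp

  \<comment> \<open>Composability equates two continuous maps into the Hausdorff unit space, so it
    is a closed condition. The composable pairs in \<open>U \<times> V\<close> are thus compact, and
    multiplication maps them onto the product.\<close>
  let ?P = "prod_topology (arr_top G) (arr_top G)"
  let ?K = "{z \<in> topspace ?P. (src G \<circ> fst) z = (rng G \<circ> snd) z}"
  have "closedin ?P ?K"
    by (rule closedin_continuous_maps_eq[OF Hausdorff_units])
      (rule continuous_map_compose[OF continuous_map_fst continuous_src]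
        continuous_map_compose[OF continuous_map_snd continuous_rng])+
  then have "compactin ?P (?K \<inter> U \<times> V)"
    using U V by (intro closed_Int_compactin) (auto simp: compactin_Times Bis_c_iff)
  then have "compactin (subtopology ?P {(g, h). src G g = rng G h}) (?K \<inter> U \<times> V)"
    by (auto simp: compactin_subtopology)
  from image_compactin[OF this continuous_gmul]
  have "compactin (arr_top G) ((\<lambda>(g, h). gmul G g h) ` (?K \<inter> U \<times> V))" .
  moreover have "?K \<inter> U \<times> V = {(u, v). u \<in> U \<and> v \<in> V \<and> src G u = rng G v}"
    using sub by auto
  then have "(\<lambda>(g, h). gmul G g h) ` (?K \<inter> U \<times> V) = bis_mult G U V"
    by (auto simp: bis_mult_def)
  ultimately have co: "compactin (arr_top G) (bis_mult G U V)" by simp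

  have "inj_on (src G) (bis_mult G U V)" "inj_on (rng G) (bis_mult G U V)"
  proof -
    \<comment> \<open>The source of a product determines its right factor and the range its left
      factor; either factor then determines the other because source and range meet in the
      middle.\<close>
    have *: "gmul G u v = gmul G u' v'"
      if "u \<in> U" "u' \<in> U" "v \<in> V" "v' \<in> V" "src G u = rng G v" "src G u' = rng G v'"
        and "src G (gmul G u v) = src G (gmul G u' v') \<or> rng G (gmul G u v) = rng G (gmul G u' v')"
      for u u' v v'
    proof -
      have a: "u \<in> arrows G" "u' \<in> arrows G" "v \<in> arrows G" "v' \<in> arrows G" using that sub by auto
      have "src G v = src G v' \<or> rng G u = rng G u'"
        using that a by (simp add: src_gmul rng_gmul)
      then show ?thesis
      proof
        assume "src G v = src G v'"
        then have "v = v'" using V that inj_onD[of "src G" V v v'] by (simp add: Bis_c_iff)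
        moreover from this have "u = u'" using U that(1,2,5,6) inj_onD[of "src G" U u u'] by (simp add: Bis_c_iff)
        ultimately show ?thesis by simp
      next
        assume "rng G u = rng G u'"
        then have "u = u'" using U that inj_onD[of "rng G" U u u'] by (simp add: Bis_c_iff)
        moreover from this have "v = v'" using V that(3-6) inj_onD[of "rng G" V v v'] by (simp add: Bis_c_iff)
        ultimately show ?thesis by simp
      qed
    qed
    show "inj_on (src G) (bis_mult G U V)"
      by (rule inj_onI, unfold bis_mult_def, clarify) (rule *, simp_all)
    show "inj_on (rng G) (bis_mult G U V)"
      by (rule inj_onI, unfold bis_mult_def, clarify) (rule *, simp_all)
  qed
  with op co show ?thesis by (simp add: Bis_c_iff)
qed

lemma bis_mult_units:
  assumes U: "U \<in> Bis_c G" and V: "V \<subseteq> units G"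
  shows "bis_mult G U V = {g \<in> U. src G g \<in> V}"
proof -
  have 1: "gmul G u v = u" "v = src G u" if "u \<in> U" "v \<in> V" "src G u = rng G v" for u v
  proof -
    have "u \<in> arrows G" "rng G v = v" using that V Bis_c_subset[OF U] rng_of_unit by auto
    with that show "gmul G u v = u" "v = src G u" using gmul_src[of u] by auto
  qed
  have 2: "\<exists>u v. g = gmul G u v \<and> u \<in> U \<and> v \<in> V \<and> src G u = rng G v" if "g \<in> U" "src G g \<in> V" for g
  proof -
    have "g = gmul G g (src G g)" "src G g = rng G (src G g)"
      using that V Bis_c_subset[OF U] by (auto simp: gmul_src rng_of_unit)
    then show ?thesis using that by blast
  qed
  show ?thesis
    unfolding bis_mult_def
  proof (intro equalityI subsetI)
    fix g assume "g \<in> {gmul G u v |u v. u \<in> U \<and> v \<in> V \<and> src G u = rng G v}"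
    then obtain u v where "g = gmul G u v" "u \<in> U" "v \<in> V" "src G u = rng G v" by blast
    with 1[of u v] show "g \<in> {g \<in> U. src G g \<in> V}" by simp
  qed (use 2 in blast)
qed

text \<open>Read from the source: first the arrow of \<open>V\<close> at \<open>x\<close>, then the
  arrow of \<open>U\<close> at the range of that arrow. This compares two successive actions on a
  section with the action of the product.\<close>

lemma lift_bis_mult:
  assumes U: "U \<in> Bis_c G" and V: "V \<in> Bis_c G"
  shows "x \<in> src G ` bis_mult G U V \<longleftrightarrow> x \<in> src G ` V \<and> rng G (lift V x) \<in> src G ` U"
    and "x \<in> src G ` V \<Longrightarrow> rng G (lift V x) \<in> src G ` U \<Longrightarrow>
      lift (bis_mult G U V) x = gmul G (lift U (rng G (lift V x))) (lift V x)"
proof -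
  have *: "gmul G (lift U (rng G (lift V x))) (lift V x) \<in> bis_mult G U V \<and>
      src G (gmul G (lift U (rng G (lift V x))) (lift V x)) = x"
    if "x \<in> src G ` V" "rng G (lift V x) \<in> src G ` U"
  proof -
    have "lift V x \<in> V" "lift V x \<in> arrows G" "src G (lift V x) = x"
      "lift U (rng G (lift V x)) \<in> U" "lift U (rng G (lift V x)) \<in> arrows G"
      "src G (lift U (rng G (lift V x))) = rng G (lift V x)"
      using that U V by (simp_all add: lift_in lift_arrow src_lift)
    then show ?thesis unfolding bis_mult_def by (auto simp: src_gmul)
  qed
  have "x \<in> src G ` V \<and> rng G (lift V x) \<in> src G ` U" if "x \<in> src G ` bis_mult G U V"
  proof -
    from that obtain u v where uv: "x = src G (gmul G u v)" "u \<in> U" "v \<in> V" "src G u = rng G v"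
      by (auto simp: bis_mult_def)
    moreover have "u \<in> arrows G" "v \<in> arrows G"
      using uv Bis_c_subset[OF U] Bis_c_subset[OF V] by auto
    ultimately have "x = src G v" by (simp add: src_gmul)
    then have "lift V x = v" using lift_src[OF V uv(3)] by simp
    with uv \<open>x = src G v\<close> show ?thesis by (metis imageI)
  qed
  with * show "x \<in> src G ` bis_mult G U V \<longleftrightarrow> x \<in> src G ` V \<and> rng G (lift V x) \<in> src G ` U"
    by (metis imageI)
  show "lift (bis_mult G U V) x = gmul G (lift U (rng G (lift V x))) (lift V x)"
    if "x \<in> src G ` V" "rng G (lift V x) \<in> src G ` U"
    using *[OF that] lift_src[OF bis_mult_closed[OF U V]] by metis
qed

lemma bis_mult_unit_sets:
  assumes "compact_open (unit_top G) U" "compact_open (unit_top G) V"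
  shows "bis_mult G U V = U \<inter> V"
  using bis_mult_units[OF compact_open_Bis_c[OF assms(1)] compact_open_subset_units[OF assms(2)]]
    compact_open_subset_units[OF assms(1)] by (auto simp: src_of_unit)

end

section \<open>The groupoid algebra\<close>

locale ample_groupoid_over_ring = cring R + ample_groupoid G
  for R :: "'k ring" (structure) and G :: "'g groupoid"
begin

text \<open>The multiple \<open>c \<chi>\<^sub>U\<close> with the scalar stored as a value.
  Inductions over the span then need no separate treatment of scalars, and
  \<open>\<chi>\<^sub>U\<close> is the case \<open>c = \<one>\<close>.\<close>

definition ind :: "'k \<Rightarrow> 'g set \<Rightarrow> 'g \<Rightarrow> 'k" where
  "ind c U = (\<lambda>g. if g \<in> U then c else \<zero>)"

lemma char_fn_eq_ind: "char_fn R U = ind \<one> U"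
  by (simp add: char_fn_def ind_def)

lemma ind_empty: "ind c {} = (\<lambda>_. \<zero>)"
  by (simp add: ind_def)

lemma ind_carrier: "c \<in> carrier R \<Longrightarrow> ind c U g \<in> carrier R"
  by (simp add: ind_def)

lemma ind_eq_smult_char: "c \<in> carrier R \<Longrightarrow> ind c U g = c \<otimes> char_fn R U g"
  by (simp add: ind_def char_fn_def)

lemma carrier_groupoid_algebra [simp]: "carrier (groupoid_algebra R G) = alg_span R G"
  by (simp add: groupoid_algebra_def)

lemma add_groupoid_algebra [simp]: "f \<oplus>\<^bsub>groupoid_algebra R G\<^esub> h = (\<lambda>g. f g \<oplus> h g)"
  by (simp add: groupoid_algebra_def)

lemma smult_groupoid_algebra [simp]: "c \<odot>\<^bsub>groupoid_algebra R G\<^esub> f = (\<lambda>g. c \<otimes> f g)"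
  by (simp add: groupoid_algebra_def)

lemma alg_span_induct [consumes 1, case_names zero add]:
  assumes "f \<in> alg_span R G"
    and "P (\<lambda>_. \<zero>)"
    and "\<And>c U f. c \<in> carrier R \<Longrightarrow> U \<in> Bis_c G \<Longrightarrow> f \<in> alg_span R G \<Longrightarrow> P f \<Longrightarrow> P (\<lambda>g. ind c U g \<oplus> f g)"
  shows "P f"
  using assms(1)
proof (induction rule: alg_span.induct)
  case zero
  then show ?case by (rule assms(2))
next
  case (add_scaled c U f)
  then show ?case using assms(3)[of c U f] by (simp add: ind_eq_smult_char)
qed

lemma alg_span_carrier: "f \<in> alg_span R G \<Longrightarrow> f g \<in> carrier R"
  by (induction arbitrary: g rule: alg_span_induct) (auto simp: ind_carrier)

lemma alg_span_add_ind:
  "c \<in> carrier R \<Longrightarrow> U \<in> Bis_c G \<Longrightarrow> f \<in> alg_span R G \<Longrightarrow> (\<lambda>g. ind c U g \<oplus> f g) \<in> alg_span R G"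
  using alg_span.add_scaled[of c R U G f] by (simp add: ind_eq_smult_char)

lemma ind_in_alg_span: "c \<in> carrier R \<Longrightarrow> U \<in> Bis_c G \<Longrightarrow> ind c U \<in> alg_span R G"
  using alg_span_add_ind[OF _ _ alg_span.zero, of c U] by (simp add: ind_carrier)

lemma alg_span_add:
  assumes "f \<in> alg_span R G" "h \<in> alg_span R G"
  shows "(\<lambda>g. f g \<oplus> h g) \<in> alg_span R G"
  using assms(1)
proof (induction rule: alg_span_induct)
  case zero
  then show ?case using assms(2) by (simp add: alg_span_carrier)
next
  case (add c U f)
  have "(\<lambda>g. ind c U g \<oplus> f g \<oplus> h g) = (\<lambda>g. ind c U g \<oplus> (f g \<oplus> h g))"
    using add assms(2) by (simp add: a_assoc ind_carrier alg_span_carrier)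
  then show ?case using alg_span_add_ind[OF add(1,2,4)] by simp
qed

lemma alg_span_outside_arrows: "f \<in> alg_span R G \<Longrightarrow> g \<notin> arrows G \<Longrightarrow> f g = \<zero>"
  by (induction rule: alg_span_induct) (use Bis_c_subset in \<open>auto simp: ind_def\<close>)

text \<open>Each bisection contributes at most one arrow to the fibre over \<open>x\<close>.
  Finiteness matters because \<open>finsum\<close> over an infinite set is zero by
  convention.\<close>

lemma finite_fibre:
  assumes "f \<in> alg_span R G"
  shows "finite {g \<in> arrows G. src G g = x \<and> f g \<noteq> \<zero>}"
  using assms
proof (induction rule: alg_span_induct)
  case zero
  then show ?case by simp
next
  case (add c U f)
  have "{g \<in> arrows G. src G g = x \<and> ind c U g \<oplus> f g \<noteq> \<zero>} \<subseteq>
      {lift U x} \<union> {g \<in> arrows G. src G g = x \<and> f g \<noteq> \<zero>}"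
    using lift_src[OF add(2)] by (auto simp: ind_def)
  then show ?case using add(4) finite_subset by blast
qed

text \<open>The source images of the finitely many bisections involved have a compact open union.
  For such \<open>V\<close> the function \<open>\<chi>\<^sub>V\<close> is a right local unit for
  \<open>f\<close>.\<close>

lemma alg_span_src_support:
  assumes "f \<in> alg_span R G"
  obtains V where "compact_open (unit_top G) V" "\<And>g. f g \<noteq> \<zero> \<Longrightarrow> src G g \<in> V"
proof -
  have "\<exists>V. compact_open (unit_top G) V \<and> (\<forall>g. f g \<noteq> \<zero> \<longrightarrow> src G g \<in> V)"
    using assms
  proof (induction rule: alg_span_induct)
    case zero
    then show ?case using compact_open_empty by blast
  next
    case (add c U f)
    then obtain V where V: "compact_open (unit_top G) V" "\<forall>g. f g \<noteq> \<zero> \<longrightarrow> src G g \<in> V" by blast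
    then show ?case
      using compact_open_Un[OF compact_open_src_image[OF add(2)] V(1)]
        alg_span_carrier[OF add(3)]
      by (intro exI[of _ "src G ` U \<union> V"]) (auto simp: ind_def)
  qed
  with that show ?thesis by blast
qed

section \<open>Convolution\<close>

abbreviation conv (infixl "\<star>" 70) where
  "f \<star> h \<equiv> f \<otimes>\<^bsub>groupoid_algebra R G\<^esub> h"

lemma conv_outside_arrows: "g \<notin> arrows G \<Longrightarrow> (f \<star> h) g = \<zero>"
  by (simp add: groupoid_algebra_def)

text \<open>The range of summation in the convolution depends on the right factor. Enlarging it to
  any finite part \<open>F\<close> of the fibre only adds zero terms, so the sums for two right
  factors can be taken over the same set and added termwise.\<close>

lemma conv_eq_finsum:
  assumes f: "f \<in> alg_span R G" and h: "h \<in> alg_span R G" and g: "g \<in> arrows G"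
    and F: "finite F" "F \<subseteq> {k \<in> arrows G. src G k = src G g}"
    and supp: "\<And>k. k \<in> arrows G \<Longrightarrow> src G k = src G g \<Longrightarrow> h k \<noteq> \<zero> \<Longrightarrow> k \<in> F"
  shows "(f \<star> h) g = (\<Oplus>k\<in>F. f (gmul G g (ginv G k)) \<otimes> h k)"
proof -
  have "(f \<star> h) g = (\<Oplus>k\<in>{k \<in> arrows G. src G k = src G g \<and> h k \<noteq> \<zero>}. f (gmul G g (ginv G k)) \<otimes> h k)"
    using g by (simp add: groupoid_algebra_def)
  also have "\<dots> = (\<Oplus>k\<in>F. f (gmul G g (ginv G k)) \<otimes> h k)"
    using F supp alg_span_carrier[OF f] alg_span_carrier[OF h]
    by (intro add.finprod_mono_neutral_cong_left) auto
  finally show ?thesis .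
qed

lemma conv_add_right:
  assumes f: "f \<in> alg_span R G" and h: "h \<in> alg_span R G" and k: "k \<in> alg_span R G"
  shows "f \<star> (\<lambda>g. h g \<oplus> k g) = (\<lambda>g. (f \<star> h) g \<oplus> (f \<star> k) g)"
proof
  fix g
  show "(f \<star> (\<lambda>g. h g \<oplus> k g)) g = (f \<star> h) g \<oplus> (f \<star> k) g"
  proof (cases "g \<in> arrows G")
    case True
    define F where "F = {l \<in> arrows G. src G l = src G g \<and> h l \<noteq> \<zero>} \<union> {l \<in> arrows G. src G l = src G g \<and> k l \<noteq> \<zero>}"
    have F: "finite F" "F \<subseteq> {l \<in> arrows G. src G l = src G g}"
      using finite_fibre[OF h] finite_fibre[OF k] by (auto simp: F_def)
    note car = alg_span_carrier[OF f] alg_span_carrier[OF h] alg_span_carrier[OF k]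
    have "(f \<star> (\<lambda>g. h g \<oplus> k g)) g = (\<Oplus>l\<in>F. f (gmul G g (ginv G l)) \<otimes> (h l \<oplus> k l))"
      by (rule conv_eq_finsum[OF f alg_span_add[OF h k] True F]) (auto simp: F_def)
    also have "\<dots> = (\<Oplus>l\<in>F. f (gmul G g (ginv G l)) \<otimes> h l \<oplus> f (gmul G g (ginv G l)) \<otimes> k l)"
      using car by (intro finsum_cong') (auto simp: r_distr)
    also have "\<dots> = (\<Oplus>l\<in>F. f (gmul G g (ginv G l)) \<otimes> h l) \<oplus> (\<Oplus>l\<in>F. f (gmul G g (ginv G l)) \<otimes> k l)"
      using car by (intro finsum_addf) auto
    also have "(\<Oplus>l\<in>F. f (gmul G g (ginv G l)) \<otimes> h l) = (f \<star> h) g"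
      by (rule conv_eq_finsum[OF f h True F, symmetric]) (auto simp: F_def)
    also have "(\<Oplus>l\<in>F. f (gmul G g (ginv G l)) \<otimes> k l) = (f \<star> k) g"
      by (rule conv_eq_finsum[OF f k True F, symmetric]) (auto simp: F_def)
    finally show ?thesis .
  qed (simp add: conv_outside_arrows)
qed

lemma conv_add_left:
  assumes f: "f \<in> alg_span R G" and h: "h \<in> alg_span R G" and k: "k \<in> alg_span R G"
  shows "(\<lambda>g. f g \<oplus> h g) \<star> k = (\<lambda>g. (f \<star> k) g \<oplus> (h \<star> k) g)"
proof
  fix g
  note car = alg_span_carrier[OF f] alg_span_carrier[OF h] alg_span_carrier[OF k]
  show "((\<lambda>g. f g \<oplus> h g) \<star> k) g = (f \<star> k) g \<oplus> (h \<star> k) g"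
    using car by (simp add: groupoid_algebra_def l_distr finsum_addf Pi_def)
qed

lemma conv_zero_left: "h \<in> alg_span R G \<Longrightarrow> (\<lambda>_. \<zero>) \<star> h = (\<lambda>_. \<zero>)"
  by (auto simp: groupoid_algebra_def alg_span_carrier)

lemma conv_zero_right:
  assumes "f \<in> alg_span R G"
  shows "f \<star> (\<lambda>_. \<zero>) = (\<lambda>_. \<zero>)"
proof
  fix g
  show "(f \<star> (\<lambda>_. \<zero>)) g = \<zero>"
    using conv_eq_finsum[OF assms alg_span.zero, of g "{}"] conv_outside_arrows
    by (cases "g \<in> arrows G") auto
qed

text \<open>Among the arrows with the source of \<open>g\<close> at most one lies in
  \<open>V\<close>, so a single term of the sum remains.\<close>

lemma conv_ind_right:
  assumes f: "f \<in> alg_span R G" and V: "V \<in> Bis_c G" and c: "c \<in> carrier R"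
  shows "(f \<star> ind c V) g =
    (if g \<in> arrows G \<and> src G g \<in> src G ` V then f (gmul G g (ginv G (lift V (src G g)))) \<otimes> c else \<zero>)"
proof (cases "g \<in> arrows G")
  case True
  note Vc = ind_in_alg_span[OF c V]
  show ?thesis
  proof (cases "src G g \<in> src G ` V")
    case s: True
    let ?l = "lift V (src G g)"
    have l: "?l \<in> V" "?l \<in> arrows G" "src G ?l = src G g"
      using s lift_in lift_arrow[OF V] src_lift by auto
    have "k \<in> {?l}" if "src G k = src G g" "ind c V k \<noteq> \<zero>" for k
      using that lift_src[OF V, of k] by (simp add: ind_def split: if_splits)
    moreover have "finite {?l}" "{?l} \<subseteq> {k \<in> arrows G. src G k = src G g}" using l by auto
    ultimately have "(f \<star> ind c V) g = (\<Oplus>k\<in>{?l}. f (gmul G g (ginv G k)) \<otimes> ind c V k)"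
      by (intro conv_eq_finsum[OF f Vc True])
    also have "\<dots> = f (gmul G g (ginv G ?l)) \<otimes> c"
      using l c alg_span_carrier[OF f] by (simp add: ind_def)
    finally show ?thesis using s True by simp
  next
    case s: False
    have "(f \<star> ind c V) g = (\<Oplus>k\<in>{}. f (gmul G g (ginv G k)) \<otimes> ind c V k)"
      using s by (intro conv_eq_finsum[OF f Vc True]) (auto simp: ind_def image_iff split: if_splits)
    then show ?thesis using s by simp
  qed
qed (simp add: conv_outside_arrows)

lemma conv_ind_ind:
  assumes "U \<in> Bis_c G" "V \<in> Bis_c G" "c \<in> carrier R" "d \<in> carrier R"
  shows "ind c U \<star> ind d V = ind (c \<otimes> d) (bis_mult G U V)"
  using assms bis_mult_iff[OF assms(1,2)]
  by (auto simp: fun_eq_iff conv_ind_right ind_in_alg_span) (auto simp: ind_def)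

lemma conv_closed:
  assumes "f \<in> alg_span R G" "h \<in> alg_span R G"
  shows "f \<star> h \<in> alg_span R G"
  using assms(2)
proof (induction rule: alg_span_induct)
  case zero
  then show ?case using assms(1) by (simp add: conv_zero_right alg_span.zero)
next
  case (add d V h)
  note V = ind_in_alg_span[OF add(1,2)]
  have "f \<star> ind d V \<in> alg_span R G"
    using assms(1)
  proof (induction rule: alg_span_induct)
    case zero
    then show ?case using V by (simp add: conv_zero_left alg_span.zero)
  next
    case ad: (add c U f)
    then show ?case
      using conv_add_left[OF ind_in_alg_span[OF ad(1,2)] ad(3) V] add(1,2)
      by (simp add: conv_ind_ind alg_span_add_ind bis_mult_closed)
  qed
  then show ?case
    using conv_add_right[OF assms(1) V add(3)] add(4) by (simp add: alg_span_add)
qed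

lemma conv_ind_units:
  assumes f: "f \<in> alg_span R G" and V: "compact_open (unit_top G) V" and c: "c \<in> carrier R"
  shows "f \<star> ind c V = (\<lambda>g. if src G g \<in> V then f g \<otimes> c else \<zero>)"
proof
  fix g
  have sV: "src G ` V = V" using src_image_units[OF compact_open_subset_units[OF V]] .
  show "(f \<star> ind c V) g = (if src G g \<in> V then f g \<otimes> c else \<zero>)"
  proof (cases "g \<in> arrows G")
    case True
    then show ?thesis
      using conv_ind_right[OF f compact_open_Bis_c[OF V] c] V sV
      by (simp add: lift_unit ginv_unit src_unit gmul_src)
  next
    case False
    then show ?thesis using c alg_span_outside_arrows[OF f] by (simp add: conv_outside_arrows)
  qed
qed

text \<open>Multiplying by \<open>c \<chi>\<^sub>V\<close> scales the values at arrows with source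
  in \<open>V\<close> and erases the others, which are zero here anyway. For
  \<open>c = \<one>\<close> this is the local unit property; for general \<open>c\<close> it
  realises scalars by elements of the algebra.\<close>

lemma conv_ind_units_eq_smult:
  assumes "f \<in> alg_span R G" "compact_open (unit_top G) V" "c \<in> carrier R"
    and "\<And>g. f g \<noteq> \<zero> \<Longrightarrow> src G g \<in> V"
  shows "f \<star> ind c V = (\<lambda>g. c \<otimes> f g)"
proof
  fix g
  show "(f \<star> ind c V) g = c \<otimes> f g"
    using assms(4)[of g] alg_span_carrier[OF assms(1), of g] assms(3)
    by (cases "f g = \<zero>") (auto simp: conv_ind_units[OF assms(1-3)] m_comm)
qed

lemma conv_ind_unit_sets:
  assumes "compact_open (unit_top G) U" "compact_open (unit_top G) V" "c \<in> carrier R" "d \<in> carrier R"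
  shows "ind c U \<star> ind d V = ind (c \<otimes> d) (U \<inter> V)"
  using assms by (simp add: conv_ind_ind compact_open_Bis_c bis_mult_unit_sets)

end

section \<open>Unitary modules and their germs\<close>

locale unitary_groupoid_module = ample_groupoid_over_ring R G
  for R :: "'k ring" (structure) and G :: "'g groupoid" +
  fixes M :: "('g \<Rightarrow> 'k, 'm) module"
  assumes unitary: "unitary_module (groupoid_algebra R G) M"

sublocale unitary_groupoid_module \<subseteq> M: right_module "groupoid_algebra R G" M
  using unitary by (simp add: unitary_module_def)

context unitary_groupoid_module
begin

lemma act_closed: "f \<in> alg_span R G \<Longrightarrow> m \<in> carrier M \<Longrightarrow> f \<odot>\<^bsub>M\<^esub> m \<in> carrier M"
  using M.action_closed by simp

lemma act_add_left: "f \<in> alg_span R G \<Longrightarrow> m \<in> carrier M \<Longrightarrow> n \<in> carrier M \<Longrightarrow>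
    f \<odot>\<^bsub>M\<^esub> (m \<oplus>\<^bsub>M\<^esub> n) = f \<odot>\<^bsub>M\<^esub> m \<oplus>\<^bsub>M\<^esub> f \<odot>\<^bsub>M\<^esub> n"
  using M.action_add_left by simp

lemma act_add_right: "f \<in> alg_span R G \<Longrightarrow> h \<in> alg_span R G \<Longrightarrow> m \<in> carrier M \<Longrightarrow>
    (\<lambda>g. f g \<oplus> h g) \<odot>\<^bsub>M\<^esub> m = f \<odot>\<^bsub>M\<^esub> m \<oplus>\<^bsub>M\<^esub> h \<odot>\<^bsub>M\<^esub> m"
  using M.action_add_right[of f h m] by simp

lemma act_conv: "f \<in> alg_span R G \<Longrightarrow> h \<in> alg_span R G \<Longrightarrow> m \<in> carrier M \<Longrightarrow>
    h \<odot>\<^bsub>M\<^esub> (f \<odot>\<^bsub>M\<^esub> m) = (f \<star> h) \<odot>\<^bsub>M\<^esub> m"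
  using M.action_mult[of f h m] by simp

lemma act_zero_fun: "m \<in> carrier M \<Longrightarrow> (\<lambda>_. \<zero>) \<odot>\<^bsub>M\<^esub> m = \<zero>\<^bsub>M\<^esub>"
  using act_add_right[OF alg_span.zero alg_span.zero, of m] act_closed[OF alg_span.zero, of m]
  by (metis M.add.r_cancel_one' l_zero zero_closed)

lemma act_zero: "f \<in> alg_span R G \<Longrightarrow> f \<odot>\<^bsub>M\<^esub> \<zero>\<^bsub>M\<^esub> = \<zero>\<^bsub>M\<^esub>"
  using act_add_left[of f "\<zero>\<^bsub>M\<^esub>" "\<zero>\<^bsub>M\<^esub>"] act_closed[of f "\<zero>\<^bsub>M\<^esub>"]
  by (metis M.add.r_cancel_one' M.l_zero M.zero_closed)

lemma act_uminus:
  assumes "f \<in> alg_span R G" "m \<in> carrier M"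
  shows "f \<odot>\<^bsub>M\<^esub> (\<ominus>\<^bsub>M\<^esub> m) = \<ominus>\<^bsub>M\<^esub> (f \<odot>\<^bsub>M\<^esub> m)"
  using act_add_left[of f m "\<ominus>\<^bsub>M\<^esub> m"] assms
  by (metis M.a_inv_closed M.minus_equality M.add.m_comm M.r_neg act_closed act_zero)

section \<open>Restriction of module elements to compact open sets\<close>

definition cut :: "'g set \<Rightarrow> 'm \<Rightarrow> 'm" where
  "cut V m = char_fn R V \<odot>\<^bsub>M\<^esub> m"

lemma char_fn_in_alg_span: "U \<in> Bis_c G \<Longrightarrow> char_fn R U \<in> alg_span R G"
  by (simp add: char_fn_eq_ind ind_in_alg_span)

lemma cut_closed: "compact_open (unit_top G) V \<Longrightarrow> m \<in> carrier M \<Longrightarrow> cut V m \<in> carrier M"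
  by (simp add: cut_def act_closed char_fn_in_alg_span compact_open_Bis_c)

lemma cut_add: "compact_open (unit_top G) V \<Longrightarrow> m \<in> carrier M \<Longrightarrow> n \<in> carrier M \<Longrightarrow>
    cut V (m \<oplus>\<^bsub>M\<^esub> n) = cut V m \<oplus>\<^bsub>M\<^esub> cut V n"
  by (simp add: cut_def act_add_left char_fn_in_alg_span compact_open_Bis_c)

lemma cut_uminus: "compact_open (unit_top G) V \<Longrightarrow> m \<in> carrier M \<Longrightarrow> cut V (\<ominus>\<^bsub>M\<^esub> m) = \<ominus>\<^bsub>M\<^esub> cut V m"
  by (simp add: cut_def act_uminus char_fn_in_alg_span compact_open_Bis_c)

lemma cut_zero: "compact_open (unit_top G) V \<Longrightarrow> cut V \<zero>\<^bsub>M\<^esub> = \<zero>\<^bsub>M\<^esub>"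
  by (simp add: cut_def act_zero char_fn_in_alg_span compact_open_Bis_c)

lemma cut_empty: "m \<in> carrier M \<Longrightarrow> cut {} m = \<zero>\<^bsub>M\<^esub>"
  by (simp add: cut_def char_fn_eq_ind ind_empty act_zero_fun)

lemma cut_ind:
  assumes "compact_open (unit_top G) U" "compact_open (unit_top G) V" "m \<in> carrier M" "c \<in> carrier R"
  shows "cut U (ind c V \<odot>\<^bsub>M\<^esub> m) = ind c (U \<inter> V) \<odot>\<^bsub>M\<^esub> m"
  using assms
  by (simp add: cut_def char_fn_eq_ind act_conv ind_in_alg_span compact_open_Bis_c conv_ind_unit_sets Int_commute)

lemma ind_cut:
  assumes "compact_open (unit_top G) U" "compact_open (unit_top G) V" "m \<in> carrier M" "c \<in> carrier R"
  shows "ind c U \<odot>\<^bsub>M\<^esub> cut V m = ind c (U \<inter> V) \<odot>\<^bsub>M\<^esub> m"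
  using assms
  by (simp add: cut_def char_fn_eq_ind act_conv ind_in_alg_span compact_open_Bis_c conv_ind_unit_sets Int_commute)

lemma cut_cut:
  "compact_open (unit_top G) U \<Longrightarrow> compact_open (unit_top G) V \<Longrightarrow> m \<in> carrier M \<Longrightarrow>
    cut U (cut V m) = cut (U \<inter> V) m"
  using cut_ind[of U V m \<one>] by (simp add: cut_def char_fn_eq_ind)

text \<open>On an overlap the two characteristic functions would add up to
  \<open>\<one> \<oplus> \<one>\<close>. This is why covers are made disjoint before local elements
  are added.\<close>

lemma cut_Un:
  assumes "compact_open (unit_top G) U" "compact_open (unit_top G) V" "U \<inter> V = {}" "m \<in> carrier M"
  shows "cut (U \<union> V) m = cut U m \<oplus>\<^bsub>M\<^esub> cut V m"
proof -
  have "char_fn R (U \<union> V) = (\<lambda>g. char_fn R U g \<oplus> char_fn R V g)"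
    using assms(3) by (auto simp: char_fn_def fun_eq_iff)
  then show ?thesis
    using act_add_right[of "char_fn R U" "char_fn R V" m] assms
    by (simp add: cut_def char_fn_in_alg_span compact_open_Bis_c)
qed

lemma cut_eq_mono:
  assumes "compact_open (unit_top G) V" "compact_open (unit_top G) W" "V \<subseteq> W"
    and "m \<in> carrier M" "n \<in> carrier M" "cut W m = cut W n"
  shows "cut V m = cut V n"
  using assms cut_cut[of V W m] cut_cut[of V W n] by (simp add: Int_absorb2)

lemma cut_fixed_mono:
  assumes "compact_open (unit_top G) V" "compact_open (unit_top G) W" "V \<subseteq> W"
    and "m \<in> carrier M" "cut V m = m"
  shows "cut W m = m"
  using assms cut_cut[of W V m] by (simp add: Int_absorb1)

lemma cut_act:
  assumes "f \<in> alg_span R G" "compact_open (unit_top G) V" "\<And>g. f g \<noteq> \<zero> \<Longrightarrow> src G g \<in> V" "m \<in> carrier M"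
  shows "cut V (f \<odot>\<^bsub>M\<^esub> m) = f \<odot>\<^bsub>M\<^esub> m"
proof -
  have "f \<star> ind \<one> V = (\<lambda>g. \<one> \<otimes> f g)"
    using assms by (intro conv_ind_units_eq_smult) auto
  then have "f \<star> ind \<one> V = f" using alg_span_carrier[OF assms(1)] by simp
  then show ?thesis
    using assms by (simp add: cut_def char_fn_eq_ind act_conv ind_in_alg_span compact_open_Bis_c)
qed

text \<open>A product of a module element with \<open>a\<close> is fixed by
  \<open>\<chi>\<^sub>V\<close> as soon as \<open>V\<close> contains the sources of the support of
  \<open>a\<close>. An element fixed by \<open>\<chi>\<^sub>V\<close> stays fixed when
  \<open>V\<close> grows, so sums are handled by the union of the two sets, and every element of a
  unitary module is reached.\<close>

lemma fixed_by_cut: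
  assumes "m \<in> carrier M"
  obtains V where "compact_open (unit_top G) V" "cut V m = m"
proof -
  let ?S = "{a \<odot>\<^bsub>M\<^esub> m |a m. a \<in> carrier (groupoid_algebra R G) \<and> m \<in> carrier M}"
  have gen: "generate (add_monoid M) ?S = carrier M"
    using unitary by (simp add: unitary_module_def)
  have act: "\<exists>V. compact_open (unit_top G) V \<and> cut V n = n" if "n \<in> ?S" for n
  proof -
    from that obtain a k where n: "n = a \<odot>\<^bsub>M\<^esub> k" "a \<in> alg_span R G" "k \<in> carrier M" by auto
    obtain V where "compact_open (unit_top G) V" "\<And>g. a g \<noteq> \<zero> \<Longrightarrow> src G g \<in> V"
      using alg_span_src_support[OF n(2)] by blast
    then show ?thesis using cut_act n by blast
  qed
  have S: "?S \<subseteq> carrier M" using M.action_closed by auto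
  have "\<exists>V. compact_open (unit_top G) V \<and> cut V m = m" if "m \<in> generate (add_monoid M) ?S"
    using that
  proof (induction rule: generate.induct)
    case one
    then show ?case using compact_open_empty cut_zero by auto
  next
    case (incl h)
    then show ?case by (rule act)
  next
    case (inv h)
    then obtain V where "compact_open (unit_top G) V" "cut V h = h" using act by blast
    moreover have "h \<in> carrier M" using inv S by blast
    ultimately have "cut V (\<ominus>\<^bsub>M\<^esub> h) = \<ominus>\<^bsub>M\<^esub> h" by (simp add: cut_uminus)
    with \<open>compact_open (unit_top G) V\<close> show ?case unfolding a_inv_def by blast
  next
    case (eng h k)
    then obtain V W where V: "compact_open (unit_top G) V" "cut V h = h"
      and W: "compact_open (unit_top G) W" "cut W k = k" by blast
    have hk: "h \<in> carrier M" "k \<in> carrier M" using eng gen by auto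
    note VW = compact_open_Un[OF V(1) W(1)]
    have "cut (V \<union> W) h = h" "cut (V \<union> W) k = k"
      using cut_fixed_mono[OF V(1) VW] cut_fixed_mono[OF W(1) VW] V W hk by auto
    then have "cut (V \<union> W) (h \<oplus>\<^bsub>M\<^esub> k) = h \<oplus>\<^bsub>M\<^esub> k" using VW hk by (simp add: cut_add)
    with VW show ?case by auto
  qed
  with assms gen that show ?thesis by blast
qed

lemma fixed_by_cut2:
  assumes "m \<in> carrier M" "n \<in> carrier M"
  obtains V where "compact_open (unit_top G) V" "cut V m = m" "cut V n = n"
proof -
  obtain V W where V: "compact_open (unit_top G) V" "cut V m = m"
    and W: "compact_open (unit_top G) W" "cut W n = n"
    using fixed_by_cut assms by metis
  note VW = compact_open_Un[OF V(1) W(1)]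
  have "cut (V \<union> W) m = m" "cut (V \<union> W) n = n"
    using cut_fixed_mono[OF V(1) VW] cut_fixed_mono[OF W(1) VW] V W assms by auto
  with VW that show ?thesis by blast
qed

section \<open>The induced scalar action\<close>

lemma scale_eq:
  assumes m: "m \<in> carrier M" and c: "c \<in> carrier R"
    and V: "compact_open (unit_top G) V" "cut V m = m"
  shows "scale R G M c m = ind c V \<odot>\<^bsub>M\<^esub> m"
proof -
  let ?Q = "\<lambda>e. e \<in> carrier (groupoid_algebra R G) \<and> e \<star> e = e \<and> e \<odot>\<^bsub>M\<^esub> m = m"
  define e where "e = (SOME e. ?Q e)"
  have "?Q (char_fn R V)"
    using V by (simp add: char_fn_eq_ind ind_in_alg_span compact_open_Bis_c conv_ind_unit_sets
        cut_def)
  then have e: "e \<in> alg_span R G" "e \<odot>\<^bsub>M\<^esub> m = m"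
    unfolding e_def using someI[of ?Q] by (metis (no_types, lifting) carrier_groupoid_algebra)+
  obtain W where W: "compact_open (unit_top G) W" "\<And>g. e g \<noteq> \<zero> \<Longrightarrow> src G g \<in> W"
    using alg_span_src_support[OF e(1)] by blast
  note VW = compact_open_Un[OF V(1) W(1)]
  \<comment> \<open>\<open>V \<union> W\<close> contains the sources of the support of the chosen
    idempotent \<open>e\<close>, so scaling \<open>e\<close> is multiplication by one element of the
    algebra. Since \<open>e\<close> fixes \<open>m\<close> it then drops out, and
    \<open>cut V m = m\<close> shrinks the set back to \<open>V\<close>.\<close>
  have "(\<lambda>g. c \<otimes> e g) = e \<star> ind c (V \<union> W)"
    using e(1) VW c W by (subst conv_ind_units_eq_smult) auto
  then have "scale R G M c m = (e \<star> ind c (V \<union> W)) \<odot>\<^bsub>M\<^esub> m"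
    by (simp add: scale_def Let_def e_def)
  also have "\<dots> = ind c (V \<union> W) \<odot>\<^bsub>M\<^esub> m"
    using act_conv[OF e(1) ind_in_alg_span[OF c compact_open_Bis_c[OF VW]] m] e(2) by simp
  also have "\<dots> = ind c (V \<union> W) \<odot>\<^bsub>M\<^esub> cut V m" using V by simp
  also have "\<dots> = ind c ((V \<union> W) \<inter> V) \<odot>\<^bsub>M\<^esub> m" using VW V(1) m c by (rule ind_cut)
  also have "(V \<union> W) \<inter> V = V" by blast
  finally show ?thesis .
qed

lemma scale_closed: "c \<in> carrier R \<Longrightarrow> m \<in> carrier M \<Longrightarrow> scale R G M c m \<in> carrier M"
  by (rule fixed_by_cut[of m]) (auto simp: scale_eq act_closed ind_in_alg_span compact_open_Bis_c)

lemma cut_scale: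
  assumes "c \<in> carrier R" "m \<in> carrier M" "compact_open (unit_top G) W"
  shows "cut W (scale R G M c m) = ind c W \<odot>\<^bsub>M\<^esub> m"
proof -
  obtain V where V: "compact_open (unit_top G) V" "cut V m = m" using fixed_by_cut assms by metis
  have "cut W (scale R G M c m) = ind c (W \<inter> V) \<odot>\<^bsub>M\<^esub> m"
    using assms V by (simp add: scale_eq[OF _ _ V] cut_ind)
  also have "\<dots> = ind c W \<odot>\<^bsub>M\<^esub> cut V m"
    using assms V(1) by (intro ind_cut[symmetric])
  finally show ?thesis using V(2) by simp
qed

lemma scale_add_right:
  assumes "c \<in> carrier R" "m \<in> carrier M" "n \<in> carrier M"
  shows "scale R G M c (m \<oplus>\<^bsub>M\<^esub> n) = scale R G M c m \<oplus>\<^bsub>M\<^esub> scale R G M c n"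
proof -
  obtain V where V: "compact_open (unit_top G) V" "cut V m = m" "cut V n = n"
    using fixed_by_cut2 assms by metis
  then have "cut V (m \<oplus>\<^bsub>M\<^esub> n) = m \<oplus>\<^bsub>M\<^esub> n" using assms by (simp add: cut_add)
  with V show ?thesis
    using assms by (simp add: scale_eq[OF _ _ V(1)] act_add_left ind_in_alg_span compact_open_Bis_c)
qed

lemma scale_add_left:
  assumes "c \<in> carrier R" "d \<in> carrier R" "m \<in> carrier M"
  shows "scale R G M (c \<oplus> d) m = scale R G M c m \<oplus>\<^bsub>M\<^esub> scale R G M d m"
proof -
  obtain V where V: "compact_open (unit_top G) V" "cut V m = m" using fixed_by_cut assms by metis
  have "ind (c \<oplus> d) V = (\<lambda>g. ind c V g \<oplus> ind d V g)" by (auto simp: ind_def)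
  with V show ?thesis
    using assms by (simp add: scale_eq[OF _ _ V(1)] act_add_right ind_in_alg_span compact_open_Bis_c)
qed

lemma scale_mult:
  assumes "c \<in> carrier R" "d \<in> carrier R" "m \<in> carrier M"
  shows "scale R G M (c \<otimes> d) m = scale R G M c (scale R G M d m)"
proof -
  obtain V where V: "compact_open (unit_top G) V" "cut V m = m" using fixed_by_cut assms by metis
  have "cut V (scale R G M d m) = scale R G M d m"
    using assms V by (simp add: cut_ind scale_eq[OF _ _ V])
  with V show ?thesis
    using assms by (simp add: scale_eq[OF _ _ V(1)] act_closed act_conv ind_in_alg_span
        compact_open_Bis_c conv_ind_unit_sets m_comm)
qed

lemma scale_one: "m \<in> carrier M \<Longrightarrow> scale R G M \<one> m = m"
  by (rule fixed_by_cut[of m]) (auto simp: scale_eq cut_def char_fn_eq_ind)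

lemma scale_act:
  assumes "c \<in> carrier R" "f \<in> alg_span R G" "m \<in> carrier M"
  shows "scale R G M c (f \<odot>\<^bsub>M\<^esub> m) = (\<lambda>g. c \<otimes> f g) \<odot>\<^bsub>M\<^esub> m"
proof -
  obtain V where V: "compact_open (unit_top G) V" "\<And>g. f g \<noteq> \<zero> \<Longrightarrow> src G g \<in> V"
    using alg_span_src_support[OF assms(2)] by blast
  have "scale R G M c (f \<odot>\<^bsub>M\<^esub> m) = ind c V \<odot>\<^bsub>M\<^esub> (f \<odot>\<^bsub>M\<^esub> m)"
    using assms V by (intro scale_eq cut_act) (auto simp: act_closed)
  also have "\<dots> = (f \<star> ind c V) \<odot>\<^bsub>M\<^esub> m"
    using assms V by (simp add: act_conv ind_in_alg_span compact_open_Bis_c)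
  also have "f \<star> ind c V = (\<lambda>g. c \<otimes> f g)"
    using assms V by (intro conv_ind_units_eq_smult) auto
  finally show ?thesis .
qed

lemma ind_act_eq_scale:
  assumes "c \<in> carrier R" "U \<in> Bis_c G" "m \<in> carrier M"
  shows "ind c U \<odot>\<^bsub>M\<^esub> m = scale R G M c (char_fn R U \<odot>\<^bsub>M\<^esub> m)"
proof -
  have "(\<lambda>g. c \<otimes> char_fn R U g) = ind c U" using assms(1) by (simp add: ind_eq_smult_char fun_eq_iff)
  then show ?thesis using scale_act[OF assms(1) char_fn_in_alg_span[OF assms(2)] assms(3)] by simp
qed

section \<open>Germs of module elements\<close>

lemma local_part_fixed:
  assumes "compact_open (unit_top G) U" "m \<in> carrier M" "cut U m = m"
  shows "m \<in> local_part R M U"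
  using assms unfolding local_part_def cut_def by force

lemma local_part_carrier: "compact_open (unit_top G) U \<Longrightarrow> m \<in> local_part R M U \<Longrightarrow> m \<in> carrier M"
  using cut_closed by (auto simp: local_part_def cut_def)

text \<open>This makes the choice inside \<open>germ\<close> meaningful: a set \<open>V\<close> with
  \<open>cut V m = m\<close> may be enlarged by a neighbourhood of \<open>x\<close> without losing
  the property.\<close>

lemma germ_nbhd:
  assumes "x \<in> units G" "m \<in> carrier M"
  shows "\<exists>U. U \<in> nbhds_co G x \<and> m \<in> local_part R M U"
proof -
  obtain V where V: "compact_open (unit_top G) V" "cut V m = m" using fixed_by_cut assms by metis
  obtain W where "W \<in> nbhds_co G x" using nbhds_co_ex[OF assms(1)] by metis
  then have W: "compact_open (unit_top G) W" "x \<in> W" by (auto simp: nbhds_co_def)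
  note VW = compact_open_Un[OF V(1) W(1)]
  have "cut (V \<union> W) m = m" using cut_fixed_mono[OF V(1) VW] V assms by auto
  then have "m \<in> local_part R M (V \<union> W)" using VW assms by (intro local_part_fixed)
  then show ?thesis using VW W by (intro exI[of _ "V \<union> W"]) (auto simp: nbhds_co_def)
qed

text \<open>One representative is exchanged for another that agrees with it near \<open>x\<close>,
  the agreement being moved to the common neighbourhood \<open>W \<inter> W2 \<inter> U'\<close>.
  Used in both directions it shows that two classes coincide.\<close>

lemma germ_rel_transfer:
  assumes rel: "((U, m), (V, p)) \<in> germ_rel R G M x"
    and U': "U' \<in> nbhds_co G x" "n \<in> local_part R M U'" and m: "m \<in> carrier M" and n: "n \<in> carrier M"
    and W: "W \<in> nbhds_co G x" "cut W m = cut W n"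
  shows "((U', n), (V, p)) \<in> germ_rel R G M x"
proof -
  from rel obtain W2 where V: "V \<in> nbhds_co G x" "p \<in> local_part R M V"
    and W2: "W2 \<in> nbhds_co G x" "W2 \<subseteq> U \<inter> V" "cut W2 m = cut W2 p"
    by (auto simp: germ_rel_def cut_def)
  define W' where "W' = W \<inter> W2 \<inter> U'"
  have W': "W' \<in> nbhds_co G x" "W' \<subseteq> W" "W' \<subseteq> W2" "W' \<subseteq> U' \<inter> V"
    using W2 by (auto simp: W'_def intro!: nbhds_co_Int W(1) W2(1) U'(1))
  have p: "p \<in> carrier M" using V local_part_carrier by (auto simp: nbhds_co_def)
  have "cut W' n = cut W' m"
    using cut_eq_mono[of W' W m n] W W' m n by (simp add: nbhds_co_def)
  also have "\<dots> = cut W' p"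
    using cut_eq_mono[of W' W2 m p] W2 W' m p by (simp add: nbhds_co_def)
  finally show ?thesis using W' U' V by (auto simp: germ_rel_def cut_def)
qed

lemma fst_germ [simp]: "fst (germ R G M x m) = x"
  by (simp add: germ_def)

text \<open>Two distinct base points are allowed because germs carry their base point. This
  criterion is the only fact about the colimit that the construction of the sheaf uses.\<close>

lemma germ_eq_iff:
  assumes x: "x \<in> units G" and m: "m \<in> carrier M" and n: "n \<in> carrier M"
  shows "germ R G M x m = germ R G M y n \<longleftrightarrow> x = y \<and> (\<exists>W\<in>nbhds_co G x. cut W m = cut W n)"
proof (cases "x = y")
  case True
  define U where "U m = (SOME U. U \<in> nbhds_co G x \<and> m \<in> local_part R M U)" for m
  have U: "U k \<in> nbhds_co G x" "k \<in> local_part R M (U k)" if "k \<in> carrier M" for k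
    using someI_ex[OF germ_nbhd[OF x that]] unfolding U_def by auto
  have g: "germ R G M x k = (x, germ_rel R G M x `` {(U k, k)})" for k
    by (simp add: germ_def U_def)
  have "germ_rel R G M x `` {(U m, m)} = germ_rel R G M x `` {(U n, n)} \<longleftrightarrow>
      (\<exists>W\<in>nbhds_co G x. cut W m = cut W n)" (is "?L \<longleftrightarrow> ?R")
  proof
    assume ?L
    \<comment> \<open>Reflexivity at \<open>n\<close> puts its pair into its own class, hence into
      the class of \<open>m\<close>.\<close>
    moreover have "((U n, n), (U n, n)) \<in> germ_rel R G M x"
      using U[OF n] by (auto simp: germ_rel_def)
    ultimately have "((U m, m), (U n, n)) \<in> germ_rel R G M x" by blast
    then show ?R by (auto simp: germ_rel_def cut_def)
  next
    assume ?R
    then obtain W where W: "W \<in> nbhds_co G x" "cut W m = cut W n" by blast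
    show ?L
      using germ_rel_transfer[OF _ U[OF n] m n W] germ_rel_transfer[OF _ U[OF m] n m W(1) W(2)[symmetric]]
      by auto
  qed
  then show ?thesis using True g by simp
qed (simp add: germ_def)

lemma germ_rep:
  assumes "x \<in> units G" "m \<in> carrier M"
  shows germ_rep_closed: "germ_rep R G M (germ R G M x m) \<in> carrier M"
    and germ_germ_rep: "germ R G M x (germ_rep R G M (germ R G M x m)) = germ R G M x m"
proof -
  have "m \<in> carrier M \<and> germ R G M (fst (germ R G M x m)) m = germ R G M x m"
    using assms by simp
  from someI[of "\<lambda>k. k \<in> carrier M \<and> germ R G M (fst (germ R G M x m)) k = germ R G M x m", OF this]
  show "germ_rep R G M (germ R G M x m) \<in> carrier M"
    "germ R G M x (germ_rep R G M (germ R G M x m)) = germ R G M x m"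
    by (simp_all add: germ_rep_def)
qed

end

section \<open>Compactly supported sections\<close>

locale groupoid_sheaf = ample_groupoid_over_ring R G + gsheaf_of_modules R G E
  for R :: "'k ring" (structure) and G :: "'g groupoid" and E :: "('g, 'k, 'e) gsheaf"
begin

lemma continuous_proj: "continuous_map (sh_top E) (unit_top G) (sh_proj E)"
  using local_homeomorphism_proj by (rule local_homeomorphism_imp_continuous_map)

lemma open_map_proj: "open_map (sh_top E) (unit_top G) (sh_proj E)"
  using local_homeomorphism_proj by (rule local_homeomorphism_imp_open_map)

lemma proj_unit: "e \<in> topspace (sh_top E) \<Longrightarrow> sh_proj E e \<in> units G"
  using continuous_proj by (auto simp: continuous_map_def)

abbreviation st :: "'g \<Rightarrow> 'e set" where
  "st x \<equiv> carrier (stalk E x)"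

lemma st_iff: "e \<in> st x \<longleftrightarrow> e \<in> topspace (sh_top E) \<and> sh_proj E e = x"
  by (simp add: stalk_def)

lemma stalk_simps [simp]:
  "add (stalk E x) = sh_add E" "zero (stalk E x) = sh_zero E x" "smult (stalk E x) = sh_smult E"
  by (simp_all add: stalk_def)

text \<open>The negative of \<open>e\<close> is expressed as multiplication by
  \<open>\<ominus> \<one>\<close>. In this form it is continuous in \<open>e\<close>, so that
  negatives of sections are sections.\<close>

lemma stalk_algebra:
  assumes x: "x \<in> units G"
  shows add_closed: "e \<in> st x \<Longrightarrow> e' \<in> st x \<Longrightarrow> sh_add E e e' \<in> st x"
    and add_assoc: "e \<in> st x \<Longrightarrow> e' \<in> st x \<Longrightarrow> e'' \<in> st x \<Longrightarrow>
      sh_add E (sh_add E e e') e'' = sh_add E e (sh_add E e' e'')"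
    and add_comm: "e \<in> st x \<Longrightarrow> e' \<in> st x \<Longrightarrow> sh_add E e e' = sh_add E e' e"
    and zero_st: "sh_zero E x \<in> st x"
    and add_zero_left: "e \<in> st x \<Longrightarrow> sh_add E (sh_zero E x) e = e"
    and smult_st: "c \<in> carrier R \<Longrightarrow> e \<in> st x \<Longrightarrow> sh_smult E c e \<in> st x"
    and smult_add_right: "c \<in> carrier R \<Longrightarrow> e \<in> st x \<Longrightarrow> e' \<in> st x \<Longrightarrow>
      sh_smult E c (sh_add E e e') = sh_add E (sh_smult E c e) (sh_smult E c e')"
    and smult_add_left: "c \<in> carrier R \<Longrightarrow> d \<in> carrier R \<Longrightarrow> e \<in> st x \<Longrightarrow>
      sh_smult E (c \<oplus> d) e = sh_add E (sh_smult E c e) (sh_smult E d e)"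
    and smult_mult: "c \<in> carrier R \<Longrightarrow> d \<in> carrier R \<Longrightarrow> e \<in> st x \<Longrightarrow>
      sh_smult E (c \<otimes> d) e = sh_smult E c (sh_smult E d e)"
    and smult_one_st: "e \<in> st x \<Longrightarrow> sh_smult E \<one> e = e"
    and smult_zero_left: "e \<in> st x \<Longrightarrow> sh_smult E \<zero> e = sh_zero E x"
    and smult_zero_right: "c \<in> carrier R \<Longrightarrow> sh_smult E c (sh_zero E x) = sh_zero E x"
    and add_neg: "e \<in> st x \<Longrightarrow> sh_add E (sh_smult E (\<ominus> \<one>) e) e = sh_zero E x"
proof -
  interpret S: Module.module R "stalk E x" using x by (rule module_stalk)
  show "sh_add E e e' \<in> st x" if "e \<in> st x" "e' \<in> st x"
    using S.a_closed that by simp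
  show "sh_add E (sh_add E e e') e'' = sh_add E e (sh_add E e' e'')"
    if "e \<in> st x" "e' \<in> st x" "e'' \<in> st x"
    using S.a_assoc that by simp
  show "sh_add E e e' = sh_add E e' e" if "e \<in> st x" "e' \<in> st x"
    using S.a_comm that by simp
  show "sh_zero E x \<in> st x"
    using S.zero_closed by simp
  show "sh_add E (sh_zero E x) e = e" if "e \<in> st x"
    using S.l_zero that by simp
  show "sh_smult E c e \<in> st x" if "c \<in> carrier R" "e \<in> st x"
    using S.smult_closed that by simp
  show "sh_smult E c (sh_add E e e') = sh_add E (sh_smult E c e) (sh_smult E c e')"
    if "c \<in> carrier R" "e \<in> st x" "e' \<in> st x"
    using S.smult_r_distr that by simp
  show l: "sh_smult E (c \<oplus> d) e = sh_add E (sh_smult E c e) (sh_smult E d e)"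
    if "c \<in> carrier R" "d \<in> carrier R" "e \<in> st x" for c d e
    using S.smult_l_distr that by simp
  show "sh_smult E (c \<otimes> d) e = sh_smult E c (sh_smult E d e)"
    if "c \<in> carrier R" "d \<in> carrier R" "e \<in> st x"
    using S.smult_assoc1 that by simp
  show o: "sh_smult E \<one> e = e" if "e \<in> st x" for e
    using S.smult_one that by simp
  show z: "sh_smult E \<zero> e = sh_zero E x" if "e \<in> st x" for e
    using S.smult_l_null that by simp
  show "sh_smult E c (sh_zero E x) = sh_zero E x" if "c \<in> carrier R"
    using S.smult_r_null that by simp
  show "sh_add E (sh_smult E (\<ominus> \<one>) e) e = sh_zero E x" if "e \<in> st x"
    using l[of "\<ominus> \<one>" \<one> e] o z that by (simp add: l_neg)
qed

lemma stalk_action: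
  assumes "g \<in> arrows G"
  shows act_st: "e \<in> st (rng G g) \<Longrightarrow> sh_act E e g \<in> st (src G g)"
    and act_add: "e \<in> st (rng G g) \<Longrightarrow> e' \<in> st (rng G g) \<Longrightarrow>
      sh_act E (sh_add E e e') g = sh_add E (sh_act E e g) (sh_act E e' g)"
    and act_smult: "c \<in> carrier R \<Longrightarrow> e \<in> st (rng G g) \<Longrightarrow>
      sh_act E (sh_smult E c e) g = sh_smult E c (sh_act E e g)"
  using linear_act[OF assms] by (auto simp: linear_on_def Pi_iff)

lemma act_zero:
  assumes g: "g \<in> arrows G"
  shows "sh_act E (sh_zero E (rng G g)) g = sh_zero E (src G g)"
proof -
  have u: "rng G g \<in> units G" "src G g \<in> units G" using g by (simp_all add: rng_unit src_unit)
  then have "sh_act E (sh_zero E (rng G g)) g = sh_act E (sh_smult E \<zero> (sh_zero E (rng G g))) g"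
    by (simp add: smult_zero_right)
  also have "\<dots> = sh_smult E \<zero> (sh_act E (sh_zero E (rng G g)) g)"
    using g u by (simp add: act_smult zero_st)
  also have "\<dots> = sh_zero E (src G g)"
    using g u by (intro smult_zero_left act_st zero_st)
  finally show ?thesis .
qed

lemma continuous_map_sh_add:
  assumes "continuous_map X (sh_top E) f" "continuous_map X (sh_top E) h"
    and "\<And>x. x \<in> topspace X \<Longrightarrow> sh_proj E (f x) = sh_proj E (h x)"
  shows "continuous_map X (sh_top E) (\<lambda>x. sh_add E (f x) (h x))"
proof -
  have "continuous_map X (subtopology (prod_topology (sh_top E) (sh_top E)) {(e, e'). sh_proj E e = sh_proj E e'})
     (\<lambda>x. (f x, h x))"
    using assms by (auto simp: continuous_map_in_subtopology continuous_map_paired)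
  from continuous_map_compose[OF this continuous_add] show ?thesis by (simp add: o_def)
qed

lemma continuous_map_sh_act:
  assumes "continuous_map X (sh_top E) f" "continuous_map X (arr_top G) h"
    and "\<And>x. x \<in> topspace X \<Longrightarrow> sh_proj E (f x) = rng G (h x)"
  shows "continuous_map X (sh_top E) (\<lambda>x. sh_act E (f x) (h x))"
proof -
  have "continuous_map X (subtopology (prod_topology (sh_top E) (arr_top G)) {(e, g). sh_proj E e = rng G g})
     (\<lambda>x. (f x, h x))"
    using assms by (auto simp: continuous_map_in_subtopology continuous_map_paired)
  from continuous_map_compose[OF this continuous_act] show ?thesis by (simp add: o_def)
qed

lemma continuous_map_sh_smult:
  assumes "continuous_map X (sh_top E) f" "c \<in> carrier R"
  shows "continuous_map X (sh_top E) (\<lambda>x. sh_smult E c (f x))"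
proof -
  have "continuous_map X (prod_topology (discrete_topology (carrier R)) (sh_top E)) (\<lambda>x. (c, f x))"
    using assms by (simp add: continuous_map_paired)
  from continuous_map_compose[OF this continuous_smult] show ?thesis by (simp add: o_def)
qed

text \<open>Let the projection be injective on an open \<open>U\<close> around the common value.
  Wherever both sections take values in \<open>U\<close>, each value is the only point of
  \<open>U\<close> over the base point.\<close>

lemma continuous_sections_agree:
  assumes D: "openin (unit_top G) D" "x \<in> D"
    and s: "continuous_map (subtopology (unit_top G) D) (sh_top E) s" "\<And>y. y \<in> D \<Longrightarrow> sh_proj E (s y) = y"
    and t: "continuous_map (subtopology (unit_top G) D) (sh_top E) t" "\<And>y. y \<in> D \<Longrightarrow> sh_proj E (t y) = y"
    and eq: "s x = t x"
  obtains W where "W \<in> nbhds_co G x" "W \<subseteq> D" "\<And>y. y \<in> W \<Longrightarrow> s y = t y"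
proof -
  have Du: "D \<subseteq> units G" using openin_subset[OF D(1)] by simp
  have "s x \<in> topspace (sh_top E)" using s(1) D Du by (auto simp: continuous_map_def)
  then obtain U where U: "s x \<in> U" "openin (sh_top E) U" "inj_on (sh_proj E) U"
    using local_homeomorphism_inj[OF local_homeomorphism_proj] by metis
  let ?X = "subtopology (unit_top G) D"
  have "openin ?X ({y \<in> topspace ?X. s y \<in> U} \<inter> {y \<in> topspace ?X. t y \<in> U})"
    using U(2) s(1) t(1) by (intro openin_Int openin_continuous_map_preimage)
  then have op: "openin (unit_top G) ({y \<in> topspace ?X. s y \<in> U} \<inter> {y \<in> topspace ?X. t y \<in> U})"
    using D(1) openin_trans_full by blast
  have x: "x \<in> {y \<in> topspace ?X. s y \<in> U} \<inter> {y \<in> topspace ?X. t y \<in> U}"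
    using U(1) eq D Du by auto
  obtain W where W: "W \<in> nbhds_co G x" "W \<subseteq> {y \<in> topspace ?X. s y \<in> U} \<inter> {y \<in> topspace ?X. t y \<in> U}"
    using nbhds_co_basis[OF op x] by metis
  have "s y = t y" if "y \<in> W" for y
  proof (rule inj_onD[OF U(3)])
    show "sh_proj E (s y) = sh_proj E (t y)" using that W(2) s(2) t(2) by auto
  qed (use that W(2) in auto)
  moreover have "W \<subseteq> D" using W(2) by auto
  ultimately show ?thesis using W(1) by (intro that)
qed

text \<open>The closed support is compact and therefore contained in a compact open set; conversely
  compact open sets are closed, so they contain the closure of whatever they contain. Vanishing
  outside a compact open set passes directly to sums, multiples and images under morphisms.\<close>

lemma sections_c_iff:
  "s \<in> sections_c G E \<longleftrightarrow> s \<in> extensional (units G) \<and> continuous_map (unit_top G) (sh_top E) s \<and>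
    (\<forall>x\<in>units G. sh_proj E (s x) = x) \<and>
    (\<exists>U. compact_open (unit_top G) U \<and> (\<forall>x\<in>units G - U. s x = sh_zero E x))"
  (is "_ \<longleftrightarrow> ?R")
proof
  assume s: "s \<in> sections_c G E"
  let ?S = "{x \<in> units G. s x \<noteq> sh_zero E x}"
  have op: "openin (unit_top G) (units G)" using openin_topspace[of "unit_top G"] by simp
  have co: "compactin (unit_top G) ((unit_top G) closure_of ?S)" using s by (simp add: sections_c_def)
  have "(unit_top G) closure_of ?S \<subseteq> units G" using closure_of_subset_topspace[of "unit_top G" ?S] by simp
  from compact_open_between[OF co op this]
  obtain U where U: "compact_open (unit_top G) U" "(unit_top G) closure_of ?S \<subseteq> U" by metis
  have "?S \<subseteq> (unit_top G) closure_of ?S" by (rule closure_of_subset) auto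
  then have "\<forall>x\<in>units G - U. s x = sh_zero E x" using U(2) by blast
  then show ?R using s U(1) by (auto simp: sections_c_def)
next
  assume R: ?R
  then obtain U where U: "compact_open (unit_top G) U" "\<forall>x\<in>units G - U. s x = sh_zero E x" by blast
  let ?S = "{x \<in> units G. s x \<noteq> sh_zero E x}"
  have "(unit_top G) closure_of ?S \<subseteq> U"
    by (rule closure_of_minimal) (use U compact_open_closedin in auto)
  then have "compactin (unit_top G) (unit_top G closure_of ?S)"
    using closed_compactin[OF compact_open_compactin[OF U(1)]] by simp
  with R show "s \<in> sections_c G E" by (auto simp: sections_c_def)
qed

lemma section_st: "s \<in> sections_c G E \<Longrightarrow> x \<in> units G \<Longrightarrow> s x \<in> st x"
  by (auto simp: sections_c_def st_iff continuous_map_def)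

lemma section_continuous: "s \<in> sections_c G E \<Longrightarrow> continuous_map (unit_top G) (sh_top E) s"
  by (simp add: sections_c_def)

lemma section_extensional: "s \<in> sections_c G E \<Longrightarrow> s \<in> extensional (units G)"
  by (simp add: sections_c_def)

lemma section_ext:
  assumes "s \<in> sections_c G E" "t \<in> sections_c G E" "\<And>x. x \<in> units G \<Longrightarrow> s x = t x"
  shows "s = t"
  using extensionalityI[OF section_extensional[OF assms(1)] section_extensional[OF assms(2)]] assms(3)
  by blast

lemma section_support:
  assumes "s \<in> sections_c G E"
  obtains U where "compact_open (unit_top G) U" "\<And>x. x \<in> units G \<Longrightarrow> x \<notin> U \<Longrightarrow> s x = sh_zero E x"
  using assms unfolding sections_c_iff by blast

text \<open>\<open>W\<close> is open and closed, so the two pieces live on complementary open sets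
  and no continuity has to be checked at a boundary.\<close>

lemma extend_by_zero_section:
  assumes W: "compact_open (unit_top G) W"
    and f: "continuous_map (subtopology (unit_top G) W) (sh_top E) f" "\<And>x. x \<in> W \<Longrightarrow> sh_proj E (f x) = x"
  shows "(\<lambda>x\<in>units G. if x \<in> W then f x else sh_zero E x) \<in> sections_c G E" (is "?s \<in> _")
  unfolding sections_c_iff
proof (intro conjI)
  show "?s \<in> extensional (units G)" by simp
  show "\<exists>U. compact_open (unit_top G) U \<and> (\<forall>x\<in>units G - U. ?s x = sh_zero E x)"
    using W by (intro exI[of _ W]) auto
  have Wu: "W \<subseteq> units G" using W by (rule compact_open_subset_units)
  show "\<forall>x\<in>units G. sh_proj E (?s x) = x"
    using f(2) zero_st by (auto simp: st_iff)
  show "continuous_map (unit_top G) (sh_top E) ?s"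
  proof (rule continuous_map_locally)
    fix x assume x: "x \<in> topspace (unit_top G)"
    show "\<exists>N. openin (unit_top G) N \<and> x \<in> N \<and> continuous_map (subtopology (unit_top G) N) (sh_top E) ?s"
    proof (cases "x \<in> W")
      case True
      have "continuous_map (subtopology (unit_top G) W) (sh_top E) ?s"
        by (rule continuous_map_eq[OF f(1)]) auto
      then show ?thesis using True W compact_open_openin by blast
    next
      case False
      have "openin (unit_top G) (units G - W)"
        using compact_open_closedin[OF W] by (metis openin_closedin_eq closedin_def topspace_unit_top)
      moreover have "continuous_map (subtopology (unit_top G) (units G - W)) (sh_top E) ?s"
        by (rule continuous_map_eq[OF continuous_map_from_subtopology[OF continuous_zero]]) auto
      ultimately show ?thesis using False x by auto
    qed
  qed
qed

text \<open>A local inverse of the projection passes through \<open>e\<close>; it is cut down to a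
  compact open neighbourhood and extended by zero. In this way sections reach all points, and
  statements about points can be proved on sections.\<close>

lemma section_through:
  assumes e: "e \<in> topspace (sh_top E)"
  obtains s where "s \<in> sections_c G E" "s (sh_proj E e) = e"
proof -
  obtain U where U: "e \<in> U" "openin (sh_top E) U" "inj_on (sh_proj E) U"
    using local_homeomorphism_inj[OF local_homeomorphism_proj e] by metis
  have op: "openin (unit_top G) (sh_proj E ` U)" using open_map_proj U(2) by (simp add: open_map_def)
  have x: "sh_proj E e \<in> sh_proj E ` U" using U(1) by blast
  obtain W where W: "W \<in> nbhds_co G (sh_proj E e)" "W \<subseteq> sh_proj E ` U"
    using nbhds_co_basis[OF op x] by metis
  then have Wc: "compact_open (unit_top G) W" "sh_proj E e \<in> W" by (auto simp: nbhds_co_def)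
  let ?f = "inv_into U (sh_proj E)"
  have "continuous_map (subtopology (unit_top G) W) (sh_top E) ?f"
    using continuous_map_from_subtopology_mono[OF continuous_map_inv_into_open_map[OF open_map_proj U(2,3)] W(2)] .
  moreover have "sh_proj E (?f y) = y" if "y \<in> W" for y
    using that W(2) by (intro f_inv_into_f) blast
  ultimately have "(\<lambda>x\<in>units G. if x \<in> W then ?f x else sh_zero E x) \<in> sections_c G E"
    by (rule extend_by_zero_section[OF Wc(1)])
  moreover have "(\<lambda>x\<in>units G. if x \<in> W then ?f x else sh_zero E x) (sh_proj E e) = e"
    using Wc(2) proj_unit[OF e] U(1,3) by simp
  ultimately show ?thesis using that by metis
qed

section \<open>The module of compactly supported sections\<close>

abbreviation Gam :: "('g \<Rightarrow> 'k, 'g \<Rightarrow> 'e) module" where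
  "Gam \<equiv> Gamma_c_obj R G E"

lemma carrier_Gam [simp]: "carrier Gam = sections_c G E"
  by (simp add: Gamma_c_obj_def)

lemma zero_Gam: "\<zero>\<^bsub>Gam\<^esub> = (\<lambda>x\<in>units G. sh_zero E x)"
  by (simp add: Gamma_c_obj_def)

lemma add_Gam: "s \<oplus>\<^bsub>Gam\<^esub> t = (\<lambda>x\<in>units G. sh_add E (s x) (t x))"
  by (simp add: Gamma_c_obj_def)

lemma zero_section: "(\<lambda>x\<in>units G. sh_zero E x) \<in> sections_c G E"
proof -
  have "continuous_map (unit_top G) (sh_top E) (\<lambda>x\<in>units G. sh_zero E x)"
    by (rule continuous_map_eq[OF continuous_zero]) auto
  then show ?thesis
    using compact_open_empty zero_st unfolding sections_c_iff by (auto simp: st_iff)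
qed

lemma add_section:
  assumes s: "s \<in> sections_c G E" and t: "t \<in> sections_c G E"
  shows "(\<lambda>x\<in>units G. sh_add E (s x) (t x)) \<in> sections_c G E"
  unfolding sections_c_iff
proof (intro conjI)
  note st = section_st[OF s] section_st[OF t]
  obtain U where U: "compact_open (unit_top G) U" "\<And>x. x \<in> units G \<Longrightarrow> x \<notin> U \<Longrightarrow> s x = sh_zero E x"
    using section_support[OF s] by metis
  obtain V where V: "compact_open (unit_top G) V" "\<And>x. x \<in> units G \<Longrightarrow> x \<notin> V \<Longrightarrow> t x = sh_zero E x"
    using section_support[OF t] by metis
  have "\<forall>x\<in>units G - (U \<union> V). (\<lambda>x\<in>units G. sh_add E (s x) (t x)) x = sh_zero E x"
    using U(2) V(2) by (simp add: add_zero_left zero_st)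
  then show "\<exists>U. compact_open (unit_top G) U \<and> (\<forall>x\<in>units G - U. (\<lambda>x\<in>units G. sh_add E (s x) (t x)) x = sh_zero E x)"
    using compact_open_Un[OF U(1) V(1)] by blast
  have "continuous_map (unit_top G) (sh_top E) (\<lambda>x. sh_add E (s x) (t x))"
    using st by (intro continuous_map_sh_add section_continuous s t) (simp add: st_iff)
  then show "continuous_map (unit_top G) (sh_top E) (\<lambda>x\<in>units G. sh_add E (s x) (t x))"
    by (rule continuous_map_eq) auto
  show "\<forall>x\<in>units G. sh_proj E ((\<lambda>x\<in>units G. sh_add E (s x) (t x)) x) = x"
    using st add_closed by (simp add: st_iff)
qed simp

lemma smult_section:
  assumes s: "s \<in> sections_c G E" and c: "c \<in> carrier R"
  shows "(\<lambda>x\<in>units G. sh_smult E c (s x)) \<in> sections_c G E"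
  unfolding sections_c_iff
proof (intro conjI)
  note st = section_st[OF s]
  obtain U where U: "compact_open (unit_top G) U" "\<And>x. x \<in> units G \<Longrightarrow> x \<notin> U \<Longrightarrow> s x = sh_zero E x"
    using section_support[OF s] by metis
  have "\<forall>x\<in>units G - U. (\<lambda>x\<in>units G. sh_smult E c (s x)) x = sh_zero E x"
    using U(2) c by (simp add: smult_zero_right)
  then show "\<exists>U. compact_open (unit_top G) U \<and> (\<forall>x\<in>units G - U. (\<lambda>x\<in>units G. sh_smult E c (s x)) x = sh_zero E x)"
    using U(1) by blast
  have "continuous_map (unit_top G) (sh_top E) (\<lambda>x. sh_smult E c (s x))"
    using c by (intro continuous_map_sh_smult section_continuous s)
  then show "continuous_map (unit_top G) (sh_top E) (\<lambda>x\<in>units G. sh_smult E c (s x))"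
    by (rule continuous_map_eq) auto
  show "\<forall>x\<in>units G. sh_proj E ((\<lambda>x\<in>units G. sh_smult E c (s x)) x) = x"
    using st smult_st[OF _ c] by (simp add: st_iff)
qed simp

lemma abelian_group_Gam: "abelian_group Gam"
proof (rule abelian_groupI)
  fix s t assume s: "s \<in> carrier Gam" and t: "t \<in> carrier Gam"
  then show "s \<oplus>\<^bsub>Gam\<^esub> t \<in> carrier Gam" by (simp add: add_Gam add_section)
  from s t show "s \<oplus>\<^bsub>Gam\<^esub> t = t \<oplus>\<^bsub>Gam\<^esub> s"
    by (auto simp: add_Gam section_st intro!: restrict_ext add_comm)
  fix r assume r: "r \<in> carrier Gam"
  with s t show "s \<oplus>\<^bsub>Gam\<^esub> t \<oplus>\<^bsub>Gam\<^esub> r = s \<oplus>\<^bsub>Gam\<^esub> (t \<oplus>\<^bsub>Gam\<^esub> r)"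
    by (auto simp: add_Gam section_st intro!: restrict_ext add_assoc)
next
  show "\<zero>\<^bsub>Gam\<^esub> \<in> carrier Gam" by (simp add: zero_Gam zero_section)
  fix s assume s: "s \<in> carrier Gam"
  then show "\<zero>\<^bsub>Gam\<^esub> \<oplus>\<^bsub>Gam\<^esub> s = s"
    by (intro extensionalityI[where A = "units G"])
      (auto simp: add_Gam zero_Gam section_st add_zero_left section_extensional)
next
  fix s assume s: "s \<in> carrier Gam"
  have "(\<lambda>x\<in>units G. sh_smult E (\<ominus> \<one>) (s x)) \<oplus>\<^bsub>Gam\<^esub> s = \<zero>\<^bsub>Gam\<^esub>"
    using s by (auto simp: add_Gam zero_Gam section_st intro!: restrict_ext add_neg)
  then show "\<exists>t\<in>carrier Gam. t \<oplus>\<^bsub>Gam\<^esub> s = \<zero>\<^bsub>Gam\<^esub>"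
    using s by (intro bexI[of _ "\<lambda>x\<in>units G. sh_smult E (\<ominus> \<one>) (s x)"]) (auto intro!: smult_section)
qed

text \<open>As for convolution, the range of summation is freed from the support of
  \<open>f\<close>, so that the actions of two functions can be written as sums over a common
  set.\<close>

lemma Gam_act_eq_finsum:
  assumes s: "s \<in> sections_c G E" and f: "f \<in> alg_span R G" and x: "x \<in> units G"
    and F: "finite F" "F \<subseteq> {g \<in> arrows G. src G g = x}"
    and supp: "\<And>g. g \<in> arrows G \<Longrightarrow> src G g = x \<Longrightarrow> f g \<noteq> \<zero> \<Longrightarrow> g \<in> F"
  shows "(f \<odot>\<^bsub>Gam\<^esub> s) x = (\<Oplus>\<^bsub>stalk E x\<^esub>g\<in>F. sh_smult E (f g) (sh_act E (s (rng G g)) g))"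
proof -
  interpret S: Module.module R "stalk E x" using x by (rule module_stalk)
  have st: "sh_act E (s (rng G g)) g \<in> st x" if "g \<in> F" for g
    using that F(2) act_st section_st[OF s] rng_unit by auto
  have "(f \<odot>\<^bsub>Gam\<^esub> s) x = (\<Oplus>\<^bsub>stalk E x\<^esub>g\<in>{g \<in> arrows G. src G g = x \<and> f g \<noteq> \<zero>}.
      sh_smult E (f g) (sh_act E (s (rng G g)) g))"
    using x by (simp add: Gamma_c_obj_def)
  also have "\<dots> = (\<Oplus>\<^bsub>stalk E x\<^esub>g\<in>F. sh_smult E (f g) (sh_act E (s (rng G g)) g))"
  proof (rule S.add.finprod_mono_neutral_cong_left)
    show "sh_smult E (f g) (sh_act E (s (rng G g)) g) = \<zero>\<^bsub>stalk E x\<^esub>"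
      if "g \<in> F - {g \<in> arrows G. src G g = x \<and> f g \<noteq> \<zero>}" for g
      using that F(2) st by (auto simp: smult_zero_left[OF x])
    show "(\<lambda>g. sh_smult E (f g) (sh_act E (s (rng G g)) g)) \<in> F \<rightarrow> st x"
      using st alg_span_carrier[OF f] by (auto simp: smult_st[OF x])
  qed (use F supp in auto)
  finally show ?thesis .
qed

lemma Gam_act_add:
  assumes s: "s \<in> sections_c G E" and f: "f \<in> alg_span R G" and h: "h \<in> alg_span R G"
  shows "(\<lambda>g. f g \<oplus> h g) \<odot>\<^bsub>Gam\<^esub> s = f \<odot>\<^bsub>Gam\<^esub> s \<oplus>\<^bsub>Gam\<^esub> h \<odot>\<^bsub>Gam\<^esub> s"
proof (rule extensionalityI[where A = "units G"])
  fix x assume x: "x \<in> units G"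
  interpret S: Module.module R "stalk E x" using x by (rule module_stalk)
  define F where "F = {g \<in> arrows G. src G g = x \<and> f g \<noteq> \<zero>} \<union> {g \<in> arrows G. src G g = x \<and> h g \<noteq> \<zero>}"
  have F: "finite F" "F \<subseteq> {g \<in> arrows G. src G g = x}"
    using finite_fibre[OF f] finite_fibre[OF h] by (auto simp: F_def)
  have st: "sh_act E (s (rng G g)) g \<in> st x" if "g \<in> F" for g
    using that F(2) act_st section_st[OF s] rng_unit by auto
  note car = alg_span_carrier[OF f] alg_span_carrier[OF h]
  let ?a = "\<lambda>g. sh_act E (s (rng G g)) g"
  have "((\<lambda>g. f g \<oplus> h g) \<odot>\<^bsub>Gam\<^esub> s) x = (\<Oplus>\<^bsub>stalk E x\<^esub>g\<in>F. sh_smult E (f g \<oplus> h g) (?a g))"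
    by (rule Gam_act_eq_finsum[OF s alg_span_add[OF f h] x F]) (auto simp: F_def)
  also have "\<dots> = (\<Oplus>\<^bsub>stalk E x\<^esub>g\<in>F. sh_smult E (f g) (?a g) \<oplus>\<^bsub>stalk E x\<^esub> sh_smult E (h g) (?a g))"
    using st car by (intro S.finsum_cong') (auto simp: smult_add_left[OF x] smult_st[OF x] add_closed[OF x])
  also have "\<dots> = (\<Oplus>\<^bsub>stalk E x\<^esub>g\<in>F. sh_smult E (f g) (?a g)) \<oplus>\<^bsub>stalk E x\<^esub> (\<Oplus>\<^bsub>stalk E x\<^esub>g\<in>F. sh_smult E (h g) (?a g))"
    using st car by (intro S.finsum_addf) (auto simp: smult_st[OF x])
  also have "(\<Oplus>\<^bsub>stalk E x\<^esub>g\<in>F. sh_smult E (f g) (?a g)) = (f \<odot>\<^bsub>Gam\<^esub> s) x"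
    by (rule Gam_act_eq_finsum[OF s f x F, symmetric]) (auto simp: F_def)
  also have "(\<Oplus>\<^bsub>stalk E x\<^esub>g\<in>F. sh_smult E (h g) (?a g)) = (h \<odot>\<^bsub>Gam\<^esub> s) x"
    by (rule Gam_act_eq_finsum[OF s h x F, symmetric]) (auto simp: F_def)
  finally show "((\<lambda>g. f g \<oplus> h g) \<odot>\<^bsub>Gam\<^esub> s) x = (f \<odot>\<^bsub>Gam\<^esub> s \<oplus>\<^bsub>Gam\<^esub> h \<odot>\<^bsub>Gam\<^esub> s) x"
    using x by (simp add: add_Gam)
qed (simp_all add: Gamma_c_obj_def)

text \<open>The fibre over \<open>x\<close> meets \<open>U\<close> in at most one arrow, which
  carries the value of \<open>s\<close> at its range to the stalk at \<open>x\<close>.\<close>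

lemma Gam_act_ind:
  assumes s: "s \<in> sections_c G E" and U: "U \<in> Bis_c G" and c: "c \<in> carrier R" and x: "x \<in> units G"
  shows "(ind c U \<odot>\<^bsub>Gam\<^esub> s) x =
    (if x \<in> src G ` U then sh_smult E c (sh_act E (s (rng G (lift U x))) (lift U x)) else sh_zero E x)"
proof -
  interpret S: Module.module R "stalk E x" using x by (rule module_stalk)
  note Uc = ind_in_alg_span[OF c U]
  show ?thesis
  proof (cases "x \<in> src G ` U")
    case True
    let ?l = "lift U x"
    have l: "?l \<in> U" "?l \<in> arrows G" "src G ?l = x"
      using True lift_in lift_arrow[OF U] src_lift by auto
    have "g \<in> {?l}" if "src G g = x" "ind c U g \<noteq> \<zero>" for g
      using that lift_src[OF U, of g] by (simp add: ind_def split: if_splits)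
    moreover have "finite {?l}" "{?l} \<subseteq> {g \<in> arrows G. src G g = x}" using l by auto
    ultimately have "(ind c U \<odot>\<^bsub>Gam\<^esub> s) x =
        (\<Oplus>\<^bsub>stalk E x\<^esub>g\<in>{?l}. sh_smult E (ind c U g) (sh_act E (s (rng G g)) g))"
      by (intro Gam_act_eq_finsum[OF s Uc x])
    also have "\<dots> = sh_smult E c (sh_act E (s (rng G ?l)) ?l)"
    proof -
      have "sh_act E (s (rng G ?l)) ?l \<in> st x"
        using act_st[OF l(2) section_st[OF s rng_unit[OF l(2)]]] l(3) by simp
      then have "sh_smult E c (sh_act E (s (rng G ?l)) ?l) \<in> st x" by (rule smult_st[OF x c])
      moreover have "ind c U ?l = c" using l(1) by (simp add: ind_def)
      ultimately show ?thesis using S.finsum_insert[of "{}" ?l] S.r_zero by (simp del: stalk_simps)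
    qed
    finally show ?thesis using True by simp
  next
    case False
    have "(ind c U \<odot>\<^bsub>Gam\<^esub> s) x =
        (\<Oplus>\<^bsub>stalk E x\<^esub>g\<in>{}. sh_smult E (ind c U g) (sh_act E (s (rng G g)) g))"
      using False by (intro Gam_act_eq_finsum[OF s Uc x]) (auto simp: ind_def image_iff split: if_splits)
    then show ?thesis using False by simp
  qed
qed

lemma Gam_act_zero: "(\<lambda>_. \<zero>) \<odot>\<^bsub>Gam\<^esub> s = \<zero>\<^bsub>Gam\<^esub>"
proof -
  have "(\<Oplus>\<^bsub>stalk E x\<^esub>g\<in>{}. e g) = sh_zero E x" if "x \<in> units G" for x and e :: "'g \<Rightarrow> 'e"
  proof -
    interpret S: Module.module R "stalk E x" using that by (rule module_stalk)
    show ?thesis by simp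
  qed
  then show ?thesis by (simp add: Gamma_c_obj_def cong: restrict_cong)
qed

lemma Gam_act_extensional: "f \<odot>\<^bsub>Gam\<^esub> s \<in> extensional (units G)"
  by (simp add: Gamma_c_obj_def)

text \<open>On the compact open source image of \<open>U\<close> the new section is assembled from
  the continuous lift, the range map, \<open>s\<close> and the sheaf operations; elsewhere it is
  zero.\<close>

lemma Gam_act_ind_closed:
  assumes s: "s \<in> sections_c G E" and U: "U \<in> Bis_c G" and c: "c \<in> carrier R"
  shows "ind c U \<odot>\<^bsub>Gam\<^esub> s \<in> sections_c G E"
proof -
  let ?W = "src G ` U"
  let ?f = "\<lambda>x. sh_smult E c (sh_act E (s (rng G (lift U x))) (lift U x))"
  have W: "compact_open (unit_top G) ?W" using U by (rule compact_open_src_image)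
  have Wu: "?W \<subseteq> units G" using W by (rule compact_open_subset_units)
  have la: "lift U x \<in> arrows G" "src G (lift U x) = x" if "x \<in> ?W" for x
    using that lift_arrow[OF U] src_lift by auto
  have cl: "continuous_map (subtopology (unit_top G) ?W) (arr_top G) (lift U)"
    using U by (rule continuous_map_lift)
  have cs: "continuous_map (subtopology (unit_top G) ?W) (sh_top E) (\<lambda>x. s (rng G (lift U x)))"
    using continuous_map_compose[OF continuous_map_compose[OF cl continuous_rng] section_continuous[OF s]]
    by (simp add: o_def)
  have sl: "s (rng G (lift U x)) \<in> st (rng G (lift U x))" if "x \<in> ?W" for x
    using section_st[OF s rng_unit[OF la(1)[OF that]]] .
  have cf: "continuous_map (subtopology (unit_top G) ?W) (sh_top E) ?f"
    using sl c by (intro continuous_map_sh_smult continuous_map_sh_act cs cl) (auto simp: st_iff)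
  have "?f x \<in> st x" if "x \<in> ?W" for x
    using act_st[OF la(1)[OF that] sl[OF that]] la(2)[OF that] smult_st[OF _ c] Wu that by auto
  then have "(\<lambda>x\<in>units G. if x \<in> ?W then ?f x else sh_zero E x) \<in> sections_c G E"
    by (intro extend_by_zero_section[OF W cf]) (simp add: st_iff)
  moreover have "ind c U \<odot>\<^bsub>Gam\<^esub> s = (\<lambda>x\<in>units G. if x \<in> ?W then ?f x else sh_zero E x)"
    by (rule extensionalityI[OF Gam_act_extensional restrict_extensional]) (simp add: Gam_act_ind[OF s U c])
  ultimately show ?thesis by simp
qed

lemma Gam_act_closed:
  assumes s: "s \<in> sections_c G E" and "f \<in> alg_span R G"
  shows "f \<odot>\<^bsub>Gam\<^esub> s \<in> sections_c G E"
  using assms(2)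
proof (induction rule: alg_span_induct)
  case zero
  show ?case unfolding Gam_act_zero zero_Gam by (rule zero_section)
next
  case (add c U f)
  have "ind c U \<odot>\<^bsub>Gam\<^esub> s \<oplus>\<^bsub>Gam\<^esub> f \<odot>\<^bsub>Gam\<^esub> s \<in> sections_c G E"
    unfolding add_Gam using add by (intro add_section Gam_act_ind_closed[OF s])
  then show ?case using add by (simp add: Gam_act_add[OF s] ind_in_alg_span)
qed

lemma Gam_act_add_left:
  assumes s: "s \<in> sections_c G E" and t: "t \<in> sections_c G E" and "f \<in> alg_span R G"
  shows "f \<odot>\<^bsub>Gam\<^esub> (s \<oplus>\<^bsub>Gam\<^esub> t) = f \<odot>\<^bsub>Gam\<^esub> s \<oplus>\<^bsub>Gam\<^esub> f \<odot>\<^bsub>Gam\<^esub> t"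
  using assms(3)
proof (induction rule: alg_span_induct)
  case zero
  interpret abelian_group Gam by (rule abelian_group_Gam)
  show ?case using l_zero[OF zero_closed] by (simp add: Gam_act_zero)
next
  case (add c U f)
  interpret abelian_group Gam by (rule abelian_group_Gam)
  have st: "s \<oplus>\<^bsub>Gam\<^esub> t \<in> sections_c G E" using a_closed s t by simp
  note cl = Gam_act_closed[OF s ind_in_alg_span[OF add(1,2)]] Gam_act_closed[OF t ind_in_alg_span[OF add(1,2)]]
    Gam_act_closed[OF s add(3)] Gam_act_closed[OF t add(3)]
  have "ind c U \<odot>\<^bsub>Gam\<^esub> (s \<oplus>\<^bsub>Gam\<^esub> t) = ind c U \<odot>\<^bsub>Gam\<^esub> s \<oplus>\<^bsub>Gam\<^esub> ind c U \<odot>\<^bsub>Gam\<^esub> t"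
  proof (rule extensionalityI[where A = "units G"])
    fix x assume x: "x \<in> units G"
    show "(ind c U \<odot>\<^bsub>Gam\<^esub> (s \<oplus>\<^bsub>Gam\<^esub> t)) x = (ind c U \<odot>\<^bsub>Gam\<^esub> s \<oplus>\<^bsub>Gam\<^esub> ind c U \<odot>\<^bsub>Gam\<^esub> t) x"
    proof (cases "x \<in> src G ` U")
      case True
      let ?l = "lift U x"
      have l: "?l \<in> arrows G" "src G ?l = x"
        using True lift_arrow[OF add(2)] src_lift by auto
      note ss = section_st[OF s rng_unit[OF l(1)]] section_st[OF t rng_unit[OF l(1)]]
      note as = act_st[OF l(1) ss(1)] act_st[OF l(1) ss(2)]
      show ?thesis
        using True x ss as l rng_unit[OF l(1)] add(1)
        by (simp add: Gam_act_ind[OF st add(2,1) x])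
          (simp add: Gam_act_ind[OF _ add(2,1)] s t add_Gam act_add smult_add_right[OF x])
    next
      case False
      then show ?thesis
        by (simp add: Gam_act_ind[OF st add(2,1) x])
          (simp add: Gam_act_ind[OF _ add(2,1)] s t x add_Gam add_zero_left zero_st)
    qed
  qed (simp_all add: Gam_act_extensional add_Gam)
  moreover have "a \<oplus>\<^bsub>Gam\<^esub> b \<oplus>\<^bsub>Gam\<^esub> (c \<oplus>\<^bsub>Gam\<^esub> d) = a \<oplus>\<^bsub>Gam\<^esub> c \<oplus>\<^bsub>Gam\<^esub> (b \<oplus>\<^bsub>Gam\<^esub> d)"
    if "a \<in> carrier Gam" "b \<in> carrier Gam" "c \<in> carrier Gam" "d \<in> carrier Gam" for a b c d
    using that by (simp add: a_ac del: carrier_Gam)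
  ultimately show ?case
    using add(4) cl by (simp add: Gam_act_add st s t ind_in_alg_span add(1-3))
qed

text \<open>At \<open>x\<close> the outer factor contributes an arrow \<open>v\<close> of
  \<open>V\<close> and the inner one an arrow \<open>u\<close> of \<open>U\<close> ending where
  \<open>v\<close> ends in the units. Associativity of the sheaf action replaces the two by
  \<open>gmul G u v\<close>; if one of them is missing, both sides are zero.\<close>

lemma Gam_act_ind_ind:
  assumes s: "s \<in> sections_c G E" and U: "U \<in> Bis_c G" "V \<in> Bis_c G" and c: "c \<in> carrier R" "d \<in> carrier R"
  shows "ind d V \<odot>\<^bsub>Gam\<^esub> (ind c U \<odot>\<^bsub>Gam\<^esub> s) = ind (c \<otimes> d) (bis_mult G U V) \<odot>\<^bsub>Gam\<^esub> s"
proof (rule extensionalityI[OF Gam_act_extensional Gam_act_extensional])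
  fix x assume x: "x \<in> units G"
  have Us: "ind c U \<odot>\<^bsub>Gam\<^esub> s \<in> sections_c G E" by (rule Gam_act_ind_closed[OF s U(1) c(1)])
  note UV = bis_mult_closed[OF U]
  have cd: "c \<otimes> d \<in> carrier R" using c by simp
  show "(ind d V \<odot>\<^bsub>Gam\<^esub> (ind c U \<odot>\<^bsub>Gam\<^esub> s)) x = (ind (c \<otimes> d) (bis_mult G U V) \<odot>\<^bsub>Gam\<^esub> s) x"
  proof (cases "x \<in> src G ` V")
    case xV: True
    define v where "v = lift V x"
    have v: "v \<in> arrows G" "src G v = x" using xV lift_arrow[OF U(2)] src_lift by (auto simp: v_def)
    have rv: "rng G v \<in> units G" using v(1) by (rule rng_unit)
    show ?thesis
    proof (cases "rng G v \<in> src G ` U")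
      case True
      define u where "u = lift U (rng G v)"
      have u: "u \<in> arrows G" "src G u = rng G v" using True lift_arrow[OF U(1)] src_lift by (auto simp: u_def)
      have su: "s (rng G u) \<in> st (rng G u)" by (rule section_st[OF s rng_unit[OF u(1)]])
      then have suu: "sh_act E (s (rng G u)) u \<in> st (rng G v)" using act_st[OF u(1)] u(2) by simp
      have suv: "sh_act E (sh_act E (s (rng G u)) u) v \<in> st x" using act_st[OF v(1) suu] v(2) by simp
      have aa: "sh_act E (sh_act E (s (rng G u)) u) v = sh_act E (s (rng G u)) (gmul G u v)"
        using su u v by (intro act_act) (auto simp: st_iff)
      have "(ind d V \<odot>\<^bsub>Gam\<^esub> (ind c U \<odot>\<^bsub>Gam\<^esub> s)) x =
          sh_smult E d (sh_act E (sh_smult E c (sh_act E (s (rng G u)) u)) v)"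
        using xV True rv x by (simp add: Gam_act_ind[OF Us U(2) c(2)] Gam_act_ind[OF s U(1) c(1)] v_def u_def)
      also have "\<dots> = sh_smult E (c \<otimes> d) (sh_act E (s (rng G u)) (gmul G u v))"
        using suu suv v c x by (simp add: act_smult smult_mult[OF x, symmetric] aa m_comm)
      also have "\<dots> = (ind (c \<otimes> d) (bis_mult G U V) \<odot>\<^bsub>Gam\<^esub> s) x"
        using lift_bis_mult[OF U, of x] xV True x u v
        by (simp add: Gam_act_ind[OF s UV cd] v_def[symmetric] u_def[symmetric] rng_gmul)
      finally show ?thesis .
    next
      case False
      then have "x \<notin> src G ` bis_mult G U V" using lift_bis_mult(1)[OF U, of x] by (simp add: v_def)
      \<comment> \<open>The inner section vanishes at \<open>rng G v\<close>, and \<open>v\<close>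
        carries zero to zero.\<close>
      moreover have "sh_act E (sh_zero E (rng G v)) v = sh_zero E x" using act_zero[OF v(1)] v(2) by simp
      ultimately show ?thesis
        using xV False rv x c
        by (simp add: Gam_act_ind[OF Us U(2) c(2)] Gam_act_ind[OF s U(1) c(1)] Gam_act_ind[OF s UV cd]
            v_def[symmetric] smult_zero_right)
    qed
  next
    case False
    then have "x \<notin> src G ` bis_mult G U V" using lift_bis_mult(1)[OF U, of x] by simp
    then show ?thesis
      using False x by (simp add: Gam_act_ind[OF Us U(2) c(2)] Gam_act_ind[OF s UV cd])
  qed
qed

lemma Gam_act_conv:
  assumes s: "s \<in> sections_c G E" and f: "f \<in> alg_span R G" and "h \<in> alg_span R G"
  shows "(f \<star> h) \<odot>\<^bsub>Gam\<^esub> s = h \<odot>\<^bsub>Gam\<^esub> (f \<odot>\<^bsub>Gam\<^esub> s)"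
  using assms(3)
proof (induction rule: alg_span_induct)
  case zero
  then show ?case by (simp add: conv_zero_right[OF f] Gam_act_zero)
next
  case (add d V h)
  note V = ind_in_alg_span[OF add(1,2)]
  have "(f \<star> ind d V) \<odot>\<^bsub>Gam\<^esub> s = ind d V \<odot>\<^bsub>Gam\<^esub> (f \<odot>\<^bsub>Gam\<^esub> s)"
    using f
  proof (induction rule: alg_span_induct)
    case zero
    interpret abelian_group Gam by (rule abelian_group_Gam)
    \<comment> \<open>An element equal to its own double is zero, so additivity gives preservation
      of zero.\<close>
    have "ind d V \<odot>\<^bsub>Gam\<^esub> \<zero>\<^bsub>Gam\<^esub> \<oplus>\<^bsub>Gam\<^esub> ind d V \<odot>\<^bsub>Gam\<^esub> \<zero>\<^bsub>Gam\<^esub> = ind d V \<odot>\<^bsub>Gam\<^esub> \<zero>\<^bsub>Gam\<^esub>"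
      using Gam_act_add_left[OF _ _ V, of "\<zero>\<^bsub>Gam\<^esub>" "\<zero>\<^bsub>Gam\<^esub>"] zero_closed by simp
    then have "ind d V \<odot>\<^bsub>Gam\<^esub> \<zero>\<^bsub>Gam\<^esub> = \<zero>\<^bsub>Gam\<^esub>"
      using Gam_act_closed[OF _ V, of "\<zero>\<^bsub>Gam\<^esub>"] zero_closed add.r_cancel_one' by (metis carrier_Gam)
    then show ?case by (simp add: conv_zero_left V Gam_act_zero)
  next
    case ad: (add c U f)
    note U = ind_in_alg_span[OF ad(1,2)]
    show ?case
      using ad(4) by (simp add: conv_add_left[OF U ad(3) V] Gam_act_add s U ad(3) conv_closed V
          Gam_act_add_left Gam_act_closed conv_ind_ind ad(1,2) add(1,2) Gam_act_ind_ind
          ind_in_alg_span bis_mult_closed)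
  qed
  then show ?case
    using add(4)
    by (simp add: conv_add_right[OF f V add(3)] Gam_act_add s conv_closed f V add(3) Gam_act_closed)
qed

text \<open>A unit \<open>x\<close> acts trivially on its stalk, so \<open>\<chi>\<^sub>V\<close>
  restricts a section to \<open>V\<close> and extends it by zero.\<close>

lemma Gam_act_char:
  assumes s: "s \<in> sections_c G E" and V: "compact_open (unit_top G) V" and x: "x \<in> units G"
  shows "(char_fn R V \<odot>\<^bsub>Gam\<^esub> s) x = (if x \<in> V then s x else sh_zero E x)"
proof -
  have "sh_smult E \<one> (sh_act E (s x) x) = s x"
    using section_st[OF s x] act_unit[of "s x"] smult_one_st[OF x] by (simp add: st_iff)
  then show ?thesis
    using Gam_act_ind[OF s compact_open_Bis_c[OF V] one_closed x] lift_unit[OF V] x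
      src_image_units[OF compact_open_subset_units[OF V]]
    by (simp add: char_fn_eq_ind rng_of_unit)
qed

lemma right_module_Gam: "right_module (groupoid_algebra R G) Gam"
proof -
  interpret abelian_group Gam by (rule abelian_group_Gam)
  show ?thesis
    by unfold_locales (simp_all add: Gam_act_closed Gam_act_add Gam_act_add_left Gam_act_conv)
qed

lemma unitary_module_Gam: "unitary_module (groupoid_algebra R G) Gam"
  unfolding unitary_module_def
proof (intro conjI right_module_Gam equalityI)
  interpret abelian_group Gam by (rule abelian_group_Gam)
  let ?S = "{a \<odot>\<^bsub>Gam\<^esub> m |a m. a \<in> carrier (groupoid_algebra R G) \<and> m \<in> carrier Gam}"
  have "?S \<subseteq> carrier (add_monoid Gam)" by (auto simp: Gam_act_closed)
  then show "generate (add_monoid Gam) ?S \<subseteq> carrier Gam"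
    using add.generate_incl by simp
  show "carrier Gam \<subseteq> generate (add_monoid Gam) ?S"
  proof
    fix s assume "s \<in> carrier Gam"
    then have s: "s \<in> sections_c G E" by simp
    obtain U where U: "compact_open (unit_top G) U" "\<And>x. x \<in> units G \<Longrightarrow> x \<notin> U \<Longrightarrow> s x = sh_zero E x"
      using section_support[OF s] by metis
    have c: "char_fn R U \<in> alg_span R G" by (simp add: char_fn_eq_ind ind_in_alg_span compact_open_Bis_c U)
    \<comment> \<open>\<open>U\<close> contains the support, so every section is itself one of the
      generating products.\<close>
    have "s = char_fn R U \<odot>\<^bsub>Gam\<^esub> s"
      by (rule section_ext[OF s Gam_act_closed[OF s c]]) (simp add: Gam_act_char[OF s U(1)] U(2))
    then have "s \<in> ?S" using c s by auto
    then show "s \<in> generate (add_monoid Gam) ?S" by (rule generate.incl)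
  qed
qed

end

section \<open>Sections determine sheaf morphisms\<close>

context groupoid_sheaf
begin

text \<open>Scalar multiplication on the stalk at \<open>x\<close> is visible through the algebra,
  so maps compatible with the algebra are linear on stalks.\<close>

lemma Gam_act_ind_unit:
  assumes s: "s \<in> sections_c G E" and V: "compact_open (unit_top G) V" and c: "c \<in> carrier R" and x: "x \<in> V"
  shows "(ind c V \<odot>\<^bsub>Gam\<^esub> s) x = sh_smult E c (s x)"
proof -
  have xu: "x \<in> units G" using x compact_open_subset_units[OF V] by blast
  have "sh_act E (s x) x = s x"
    using section_st[OF s xu] act_unit[of "s x"] by (simp add: st_iff)
  then show ?thesis
    using Gam_act_ind[OF s compact_open_Bis_c[OF V] c xu] lift_unit[OF V x] x xu
      src_image_units[OF compact_open_subset_units[OF V]]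
    by (simp add: rng_of_unit)
qed

text \<open>The action of a single arrow is recovered from the module structure by means of a
  bisection through it. This makes a module homomorphism compatible with the action on the
  sheaf.\<close>

lemma Gam_act_char_bisection:
  assumes s: "s \<in> sections_c G E" and U: "U \<in> Bis_c G" and g: "g \<in> U"
  shows "(char_fn R U \<odot>\<^bsub>Gam\<^esub> s) (src G g) = sh_act E (s (rng G g)) g"
proof -
  have ga: "g \<in> arrows G" using g Bis_c_subset[OF U] by blast
  have "sh_act E (s (rng G g)) g \<in> st (src G g)"
    by (rule act_st[OF ga section_st[OF s rng_unit[OF ga]]])
  then have "sh_smult E \<one> (sh_act E (s (rng G g)) g) = sh_act E (s (rng G g)) g"
    by (rule smult_one_st[OF src_unit[OF ga]])
  then show ?thesis
    using Gam_act_ind[OF s U one_closed src_unit[OF ga]] lift_src[OF U g] g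
    by (simp add: char_fn_eq_ind)
qed

text \<open>Near a point of the image choose an open \<open>U\<close> on which the projection is
  injective: if \<open>e'\<close> and the value of \<open>s\<close> below it both lie in
  \<open>U\<close>, they coincide. On this neighbourhood a map defined pointwise can be described by
  one section, which yields its continuity.\<close>

lemma openin_section_image:
  assumes s: "continuous_map (unit_top G) (sh_top E) s" "\<And>x. x \<in> units G \<Longrightarrow> sh_proj E (s x) = x"
  shows "openin (sh_top E) {e \<in> topspace (sh_top E). s (sh_proj E e) = e}" (is "openin _ ?N")
proof (subst openin_subopen, rule ballI)
  fix e assume e: "e \<in> ?N"
  then have et: "e \<in> topspace (sh_top E)" by simp
  obtain U where U: "e \<in> U" "openin (sh_top E) U" "inj_on (sh_proj E) U"
    using local_homeomorphism_inj[OF local_homeomorphism_proj et] by metis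
  have "continuous_map (sh_top E) (sh_top E) (\<lambda>e. s (sh_proj E e))"
    using continuous_map_compose[OF continuous_proj s(1)] by (simp add: o_def)
  from openin_continuous_map_preimage[OF this U(2)]
  have "openin (sh_top E) (U \<inter> {e \<in> topspace (sh_top E). s (sh_proj E e) \<in> U})"
    using U(2) by blast
  moreover have "e \<in> U \<inter> {e \<in> topspace (sh_top E). s (sh_proj E e) \<in> U}"
    using e U(1) by simp
  moreover have "U \<inter> {e \<in> topspace (sh_top E). s (sh_proj E e) \<in> U} \<subseteq> ?N"
  proof
    fix e' assume e': "e' \<in> U \<inter> {e \<in> topspace (sh_top E). s (sh_proj E e) \<in> U}"
    then have "sh_proj E (s (sh_proj E e')) = sh_proj E e'" using s(2) proj_unit by blast
    then have "s (sh_proj E e') = e'" using U(3) e' by (auto dest: inj_onD)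
    with e' show "e' \<in> ?N" by simp
  qed
  ultimately show "\<exists>T. openin (sh_top E) T \<and> e \<in> T \<and> T \<subseteq> ?N" by blast
qed

end

section \<open>Homomorphisms of modules and of sheaves\<close>

lemma compose_right_module_hom:
  assumes "f \<in> right_module_hom A M N" "g \<in> right_module_hom A N P"
    and "right_module A M"
  shows "compose (carrier M) g f \<in> right_module_hom A M P"
proof -
  interpret M: right_module A M by fact
  have f: "f m \<in> carrier N" if "m \<in> carrier M" for m
    using assms(1) that by (auto simp: right_module_hom_def)
  show ?thesis
    using assms(1,2) f M.action_closed
    by (auto simp: right_module_hom_def compose_def PiE_iff extensional_def)
qed

lemma identity_right_module_hom:
  assumes "right_module A M"
  shows "(\<lambda>m\<in>carrier M. m) \<in> right_module_hom A M M"
proof -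
  interpret M: right_module A M by fact
  show ?thesis by (auto simp: right_module_hom_def M.action_closed)
qed

lemma right_module_hom_closed: "f \<in> right_module_hom A M N \<Longrightarrow> m \<in> carrier M \<Longrightarrow> f m \<in> carrier N"
  by (auto simp: right_module_hom_def)

lemma right_module_hom_extensional: "f \<in> right_module_hom A M N \<Longrightarrow> f \<in> extensional (carrier M)"
  by (auto simp: right_module_hom_def PiE_def)

lemma right_module_hom_eqI:
  assumes "f \<in> right_module_hom A M N" "g \<in> right_module_hom A M P" "\<And>m. m \<in> carrier M \<Longrightarrow> f m = g m"
  shows "f = g"
  by (rule extensionalityI[OF right_module_hom_extensional[OF assms(1)] right_module_hom_extensional[OF assms(2)] assms(3)])

lemma right_module_isoI:
  assumes f: "f \<in> right_module_hom A M N" and bij: "bij_betw f (carrier M) (carrier N)"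
    and M: "right_module A M"
  shows "right_module_iso A M N f"
proof -
  interpret M: right_module A M by (rule M)
  define g where "g = (\<lambda>n\<in>carrier N. inv_into (carrier M) f n)"
  have gf: "g (f m) = m" if "m \<in> carrier M" for m
    using that bij by (auto simp: g_def bij_betw_def)
  have fg: "f (g n) = n" "g n \<in> carrier M" if "n \<in> carrier N" for n
    using that bij by (auto simp: g_def bij_betw_def f_inv_into_f inv_into_into)
  have "g \<in> right_module_hom A N M"
    unfolding right_module_hom_def
  proof (intro CollectI conjI ballI)
    show "g \<in> carrier N \<rightarrow>\<^sub>E carrier M" using fg(2) by (auto simp: g_def)
    fix n assume n: "n \<in> carrier N"
    { fix n' assume n': "n' \<in> carrier N"
      have "f (g n \<oplus>\<^bsub>M\<^esub> g n') = n \<oplus>\<^bsub>N\<^esub> n'"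
        using f fg n n' by (simp add: right_module_hom_def)
      then show "g (n \<oplus>\<^bsub>N\<^esub> n') = g n \<oplus>\<^bsub>M\<^esub> g n'"
        using gf[of "g n \<oplus>\<^bsub>M\<^esub> g n'"] fg n n' by simp }
    next
    fix a n assume a: "a \<in> carrier A" and n: "n \<in> carrier N"
    have "f (a \<odot>\<^bsub>M\<^esub> g n) = a \<odot>\<^bsub>N\<^esub> n"
      using f fg n a by (simp add: right_module_hom_def)
    then show "g (a \<odot>\<^bsub>N\<^esub> n) = a \<odot>\<^bsub>M\<^esub> g n"
      using gf[of "a \<odot>\<^bsub>M\<^esub> g n"] fg n a M.action_closed by simp
  qed
  with f gf fg show ?thesis unfolding right_module_iso_def by blast
qed

lemma sheaf_homD:
  assumes "\<phi> \<in> sheaf_hom R G E F"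
  shows sheaf_hom_extensional: "\<phi> \<in> extensional (topspace (sh_top E))"
    and sheaf_hom_continuous: "continuous_map (sh_top E) (sh_top F) \<phi>"
    and sheaf_hom_proj: "e \<in> topspace (sh_top E) \<Longrightarrow> sh_proj F (\<phi> e) = sh_proj E e"
    and sheaf_hom_act: "e \<in> topspace (sh_top E) \<Longrightarrow> g \<in> arrows G \<Longrightarrow> sh_proj E e = rng G g \<Longrightarrow>
      \<phi> (sh_act E e g) = sh_act F (\<phi> e) g"
    and sheaf_hom_stalk: "x \<in> units G \<Longrightarrow> e \<in> carrier (stalk E x) \<Longrightarrow> \<phi> e \<in> carrier (stalk F x)"
    and sheaf_hom_add: "x \<in> units G \<Longrightarrow> e \<in> carrier (stalk E x) \<Longrightarrow> e' \<in> carrier (stalk E x) \<Longrightarrow>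
      \<phi> (sh_add E e e') = sh_add F (\<phi> e) (\<phi> e')"
    and sheaf_hom_smult: "x \<in> units G \<Longrightarrow> c \<in> carrier R \<Longrightarrow> e \<in> carrier (stalk E x) \<Longrightarrow>
      \<phi> (sh_smult E c e) = sh_smult F c (\<phi> e)"
  using assms by (auto simp: sheaf_hom_def linear_on_def stalk_def Pi_iff)

lemma sheaf_hom_closed:
  "\<phi> \<in> sheaf_hom R G E F \<Longrightarrow> e \<in> topspace (sh_top E) \<Longrightarrow> \<phi> e \<in> topspace (sh_top F)"
  using sheaf_hom_continuous by (fastforce simp: continuous_map_def)

context ample_groupoid_over_ring
begin

lemma compose_sheaf_hom:
  assumes E: "gsheaf_of_modules R G E"
    and \<phi>: "\<phi> \<in> sheaf_hom R G E F" and \<psi>: "\<psi> \<in> sheaf_hom R G F H"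
  shows "compose (topspace (sh_top E)) \<psi> \<phi> \<in> sheaf_hom R G E H"
proof -
  interpret E: groupoid_sheaf R G E by (intro groupoid_sheaf.intro E ample_groupoid_over_ring_axioms)
  let ?c = "compose (topspace (sh_top E)) \<psi> \<phi>"
  have c: "?c e = \<psi> (\<phi> e)" if "e \<in> topspace (sh_top E)" for e
    using that by (simp add: compose_def)
  have cst: "?c e = \<psi> (\<phi> e)" if "e \<in> carrier (stalk E x)" for e x
    using that by (intro c) (simp add: E.st_iff)
  show ?thesis
    unfolding sheaf_hom_def
  proof (intro CollectI conjI ballI impI)
    show "?c \<in> extensional (topspace (sh_top E))" by (simp add: compose_def)
    have "continuous_map (sh_top E) (sh_top H) (\<psi> \<circ> \<phi>)"
      using sheaf_hom_continuous[OF \<phi>] sheaf_hom_continuous[OF \<psi>] by (rule continuous_map_compose)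
    then show "continuous_map (sh_top E) (sh_top H) ?c"
      by (rule continuous_map_eq) (simp add: c)
    fix e assume e: "e \<in> topspace (sh_top E)"
    then show "sh_proj H (?c e) = sh_proj E e"
      by (simp add: c sheaf_hom_proj[OF \<phi>] sheaf_hom_proj[OF \<psi>] sheaf_hom_closed[OF \<phi>])
    fix g assume g: "g \<in> arrows G" "sh_proj E e = rng G g"
    have "sh_act E e g \<in> topspace (sh_top E)"
      using E.act_st[OF g(1)] e g(2) by (simp add: E.st_iff)
    then show "?c (sh_act E e g) = sh_act H (?c e) g"
      using e g by (simp add: c sheaf_hom_act[OF \<phi>] sheaf_hom_act[OF \<psi>] sheaf_hom_closed[OF \<phi>] sheaf_hom_proj[OF \<phi>])
  next
    fix x assume x: "x \<in> units G"
    show "linear_on R (stalk E x) (stalk H x) ?c"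
      unfolding linear_on_def
    proof (intro conjI ballI)
      show "?c \<in> carrier (stalk E x) \<rightarrow> carrier (stalk H x)"
        using sheaf_hom_stalk[OF \<phi> x] sheaf_hom_stalk[OF \<psi> x] cst by simp
    next
      fix u v assume uv: "u \<in> carrier (stalk E x)" "v \<in> carrier (stalk E x)"
      have "sh_add E u v \<in> carrier (stalk E x)" using uv by (rule E.add_closed[OF x])
      with uv show "?c (u \<oplus>\<^bsub>stalk E x\<^esub> v) = ?c u \<oplus>\<^bsub>stalk H x\<^esub> ?c v"
        by (simp add: cst sheaf_hom_add[OF \<phi> x] sheaf_hom_add[OF \<psi> x] sheaf_hom_stalk[OF \<phi> x])
          (simp add: stalk_def)
    next
      fix a u assume au: "a \<in> carrier R" "u \<in> carrier (stalk E x)"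
      have "sh_smult E a u \<in> carrier (stalk E x)" using au by (rule E.smult_st[OF x])
      with au show "?c (a \<odot>\<^bsub>stalk E x\<^esub> u) = a \<odot>\<^bsub>stalk H x\<^esub> ?c u"
        by (simp add: cst sheaf_hom_smult[OF \<phi> x] sheaf_hom_smult[OF \<psi> x] sheaf_hom_stalk[OF \<phi> x])
          (simp add: stalk_def)
    qed
  qed
qed

lemma identity_sheaf_hom:
  assumes E: "gsheaf_of_modules R G E"
  shows "(\<lambda>e\<in>topspace (sh_top E). e) \<in> sheaf_hom R G E E"
proof -
  interpret E: groupoid_sheaf R G E by (intro groupoid_sheaf.intro E ample_groupoid_over_ring_axioms)
  let ?i = "\<lambda>e\<in>topspace (sh_top E). e"
  have i: "?i e = e" if "e \<in> topspace (sh_top E)" for e using that by simp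
  have ist: "?i e = e" if "e \<in> carrier (stalk E x)" for e x using that by (simp add: E.st_iff)
  show ?thesis
    unfolding sheaf_hom_def
  proof (intro CollectI conjI ballI impI)
    show "continuous_map (sh_top E) (sh_top E) ?i"
      by (rule continuous_map_eq[OF continuous_map_id]) simp
    fix e assume e: "e \<in> topspace (sh_top E)"
    then show "sh_proj E (?i e) = sh_proj E e" by simp
    fix g assume g: "g \<in> arrows G" "sh_proj E e = rng G g"
    have "sh_act E e g \<in> topspace (sh_top E)"
      using E.act_st[OF g(1)] e g(2) by (simp add: E.st_iff)
    then show "?i (sh_act E e g) = sh_act E (?i e) g" using e by simp
  next
    fix x assume x: "x \<in> units G"
    show "linear_on R (stalk E x) (stalk E x) ?i"
      unfolding linear_on_def
      using E.add_closed[OF x] E.smult_st[OF x] ist[of _ x] by (simp add: Pi_iff)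
  qed simp
qed

end

section \<open>Full faithfulness of the section functor\<close>

locale groupoid_sheaf_pair = ample_groupoid_over_ring R G + E: groupoid_sheaf R G E + F: groupoid_sheaf R G F
  for R :: "'k ring" (structure) and G :: "'g groupoid"
    and E :: "('g, 'k, 'e) gsheaf" and F :: "('g, 'k, 'f) gsheaf"
begin

text \<open>The zero of a stalk is its own multiple by \<open>\<zero>\<close>, so compatibility with
  scalars suffices.\<close>

lemma sheaf_hom_zero:
  assumes \<phi>: "\<phi> \<in> sheaf_hom R G E F" and x: "x \<in> units G"
  shows "\<phi> (sh_zero E x) = sh_zero F x"
proof -
  have "\<phi> (sh_zero E x) = \<phi> (sh_smult E \<zero> (sh_zero E x))"
    using x by (simp add: E.smult_zero_right)
  also have "\<dots> = sh_smult F \<zero> (\<phi> (sh_zero E x))"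
    using x by (simp add: sheaf_hom_smult[OF \<phi> x] E.zero_st)
  also have "\<dots> = sh_zero F x"
    using x by (intro F.smult_zero_left sheaf_hom_stalk[OF \<phi>] E.zero_st)
  finally show ?thesis .
qed

lemma compose_section:
  assumes \<phi>: "\<phi> \<in> sheaf_hom R G E F" and s: "s \<in> sections_c G E"
  shows "compose (units G) \<phi> s \<in> sections_c G F"
  unfolding F.sections_c_iff
proof (intro conjI)
  have c: "compose (units G) \<phi> s x = \<phi> (s x)" if "x \<in> units G" for x
    using that by (simp add: compose_def)
  show "compose (units G) \<phi> s \<in> extensional (units G)" by (simp add: compose_def)
  have "continuous_map (unit_top G) (sh_top F) (\<phi> \<circ> s)"
    using E.section_continuous[OF s] sheaf_hom_continuous[OF \<phi>] by (rule continuous_map_compose)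
  then show "continuous_map (unit_top G) (sh_top F) (compose (units G) \<phi> s)"
    by (rule continuous_map_eq) (simp add: c)
  show "\<forall>x\<in>units G. sh_proj F (compose (units G) \<phi> s x) = x"
    using E.section_st[OF s] by (simp add: c E.st_iff sheaf_hom_proj[OF \<phi>])
  obtain U where U: "compact_open (unit_top G) U" "\<And>x. x \<in> units G \<Longrightarrow> x \<notin> U \<Longrightarrow> s x = sh_zero E x"
    using E.section_support[OF s] by metis
  then show "\<exists>U. compact_open (unit_top G) U \<and> (\<forall>x\<in>units G - U. compose (units G) \<phi> s x = sh_zero F x)"
    by (intro exI[of _ U]) (simp add: c sheaf_hom_zero[OF \<phi>])
qed

lemma compose_section_apply: "x \<in> units G \<Longrightarrow> compose (units G) \<phi> s x = \<phi> (s x)"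
  by (simp add: compose_def)

lemma compose_section_add:
  assumes \<phi>: "\<phi> \<in> sheaf_hom R G E F" and s: "s \<in> sections_c G E" and t: "t \<in> sections_c G E"
  shows "compose (units G) \<phi> (s \<oplus>\<^bsub>E.Gam\<^esub> t) = compose (units G) \<phi> s \<oplus>\<^bsub>F.Gam\<^esub> compose (units G) \<phi> t"
  by (rule extensionalityI[where A = "units G"])
    (simp_all add: compose_section_apply E.add_Gam F.add_Gam sheaf_hom_add[OF \<phi>] E.section_st[OF s] E.section_st[OF t]
      compose_def)

lemma compose_section_act:
  assumes \<phi>: "\<phi> \<in> sheaf_hom R G E F" and s: "s \<in> sections_c G E" and "f \<in> alg_span R G"
  shows "compose (units G) \<phi> (f \<odot>\<^bsub>E.Gam\<^esub> s) = f \<odot>\<^bsub>F.Gam\<^esub> compose (units G) \<phi> s"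
  using assms(3)
proof (induction rule: alg_span_induct)
  case zero
  show ?case
    unfolding E.Gam_act_zero F.Gam_act_zero E.zero_Gam F.zero_Gam
    by (rule extensionalityI[where A = "units G"])
      (auto simp: compose_def sheaf_hom_zero[OF \<phi>] extensional_def)
next
  case (add c U f)
  note U = ind_in_alg_span[OF add(1,2)]
  note \<phi>s = compose_section[OF \<phi> s]
  have "compose (units G) \<phi> (ind c U \<odot>\<^bsub>E.Gam\<^esub> s) = ind c U \<odot>\<^bsub>F.Gam\<^esub> compose (units G) \<phi> s"
  proof (rule extensionalityI[OF _ F.Gam_act_extensional])
    fix x assume x: "x \<in> units G"
    show "compose (units G) \<phi> (ind c U \<odot>\<^bsub>E.Gam\<^esub> s) x = (ind c U \<odot>\<^bsub>F.Gam\<^esub> compose (units G) \<phi> s) x"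
    proof (cases "x \<in> src G ` U")
      case True
      let ?l = "lift U x"
      have l: "?l \<in> arrows G" "src G ?l = x" using True lift_arrow[OF add(2)] src_lift by auto
      have ru: "rng G ?l \<in> units G" using l(1) by (rule rng_unit)
      have a: "sh_act E (s (rng G ?l)) ?l \<in> carrier (stalk E x)"
        using E.act_st[OF l(1) E.section_st[OF s ru]] l(2) by simp
      have "\<phi> (sh_act E (s (rng G ?l)) ?l) = sh_act F (\<phi> (s (rng G ?l))) ?l"
        using E.section_st[OF s ru] by (intro sheaf_hom_act[OF \<phi> _ l(1)]) (simp_all add: E.st_iff)
      then show ?thesis
        using True x ru a
        by (simp add: compose_section_apply E.Gam_act_ind[OF s add(2,1)] F.Gam_act_ind[OF \<phi>s add(2,1)]
            sheaf_hom_smult[OF \<phi> x add(1)])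
    next
      case False
      then show ?thesis
        using x by (simp add: compose_section_apply E.Gam_act_ind[OF s add(2,1)]
            F.Gam_act_ind[OF \<phi>s add(2,1)] sheaf_hom_zero[OF \<phi>])
    qed
  qed (simp add: compose_def)
  then show ?case
    using add(3,4) s \<phi>s U
    by (simp add: E.Gam_act_add F.Gam_act_add compose_section_add[OF \<phi>] E.Gam_act_closed)
qed

lemma Gamma_c_hom:
  assumes \<phi>: "\<phi> \<in> sheaf_hom R G E F"
  shows "(\<lambda>s\<in>sections_c G E. compose (units G) \<phi> s) \<in> right_module_hom (groupoid_algebra R G) E.Gam F.Gam"
proof -
  have "s \<oplus>\<^bsub>E.Gam\<^esub> t \<in> sections_c G E" if "s \<in> sections_c G E" "t \<in> sections_c G E" for s t
    using E.add_section[OF that] by (simp only: E.add_Gam)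
  then show ?thesis
    using E.Gam_act_closed
    by (auto simp: right_module_hom_def compose_section[OF \<phi>] compose_section_add[OF \<phi>] compose_section_act[OF \<phi>])
qed

lemma sheaf_hom_eqI:
  assumes \<phi>: "\<phi> \<in> sheaf_hom R G E F" and \<psi>: "\<psi> \<in> sheaf_hom R G E F"
    and eq: "\<And>s x. s \<in> sections_c G E \<Longrightarrow> x \<in> units G \<Longrightarrow> \<phi> (s x) = \<psi> (s x)"
  shows "\<phi> = \<psi>"
proof (rule extensionalityI[OF sheaf_hom_extensional[OF \<phi>] sheaf_hom_extensional[OF \<psi>]])
  fix e assume e: "e \<in> topspace (sh_top E)"
  obtain s where "s \<in> sections_c G E" "s (sh_proj E e) = e" using E.section_through[OF e] by metis
  then show "\<phi> e = \<psi> e" using eq[of s "sh_proj E e"] E.proj_unit[OF e] by simp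
qed

text \<open>\<open>\<Gamma>\<^sub>c\<close> is full: two sections with the same value at \<open>x\<close> agree on a compact open
  neighbourhood \<open>W\<close> of \<open>x\<close>, and a homomorphism commutes with the restriction to \<open>W\<close>, that is, with the
  action of \<open>\<chi>\<^sub>W\<close>.\<close>

lemma sheaf_hom_of_module_hom:
  assumes \<theta>: "\<theta> \<in> right_module_hom (groupoid_algebra R G) E.Gam F.Gam"
  obtains \<phi> where "\<phi> \<in> sheaf_hom R G E F"
    "\<And>s x. s \<in> sections_c G E \<Longrightarrow> x \<in> units G \<Longrightarrow> \<phi> (s x) = \<theta> s x"
proof -
  have \<theta>c: "\<theta> s \<in> sections_c G F" if "s \<in> sections_c G E" for s
    using right_module_hom_closed[OF \<theta>, of s] that by simp
  have \<theta>add: "\<theta> (s \<oplus>\<^bsub>E.Gam\<^esub> t) = \<theta> s \<oplus>\<^bsub>F.Gam\<^esub> \<theta> t" if "s \<in> sections_c G E" "t \<in> sections_c G E" for s t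
    using \<theta> that by (simp add: right_module_hom_def)
  have \<theta>act: "\<theta> (f \<odot>\<^bsub>E.Gam\<^esub> s) = f \<odot>\<^bsub>F.Gam\<^esub> \<theta> s" if "s \<in> sections_c G E" "f \<in> alg_span R G" for s f
    using \<theta> that by (simp add: right_module_hom_def)
  have char: "char_fn R U \<in> alg_span R G" if "U \<in> Bis_c G" for U
    using that by (simp add: char_fn_eq_ind ind_in_alg_span)
  have well: "\<theta> s x = \<theta> t x"
    if s: "s \<in> sections_c G E" and t: "t \<in> sections_c G E" and x: "x \<in> units G" and eq: "s x = t x" for s t x
  proof -
    have op: "openin (unit_top G) (units G)" using openin_topspace[of "unit_top G"] by simp
    have sub: "subtopology (unit_top G) (units G) = unit_top G"
      using subtopology_topspace[of "unit_top G"] by simp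
    have "\<exists>W. W \<in> nbhds_co G x \<and> (\<forall>y\<in>W. s y = t y)"
      by (rule E.continuous_sections_agree[OF op x, of s t])
        (use E.section_st[OF s] E.section_st[OF t] E.section_continuous[OF s] E.section_continuous[OF t] eq sub
          in \<open>auto simp: E.st_iff\<close>)
    then obtain W where W: "compact_open (unit_top G) W" "x \<in> W" "\<And>y. y \<in> W \<Longrightarrow> s y = t y"
      by (auto simp: nbhds_co_def)
    note cW = char[OF compact_open_Bis_c[OF W(1)]]
    have "char_fn R W \<odot>\<^bsub>E.Gam\<^esub> s = char_fn R W \<odot>\<^bsub>E.Gam\<^esub> t"
      by (rule extensionalityI[OF E.Gam_act_extensional E.Gam_act_extensional])
        (simp add: E.Gam_act_char s t W(1,3))
    then have "(char_fn R W \<odot>\<^bsub>F.Gam\<^esub> \<theta> s) x = (char_fn R W \<odot>\<^bsub>F.Gam\<^esub> \<theta> t) x"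
      using \<theta>act[OF s cW] \<theta>act[OF t cW] by simp
    then show ?thesis using W(1,2) x by (simp add: F.Gam_act_char \<theta>c s t)
  qed
  define sec where "sec e = (SOME s. s \<in> sections_c G E \<and> s (sh_proj E e) = e)" for e
  have sec: "sec e \<in> sections_c G E" "sec e (sh_proj E e) = e" if "e \<in> topspace (sh_top E)" for e
  proof -
    have "\<exists>s. s \<in> sections_c G E \<and> s (sh_proj E e) = e" using E.section_through[OF that] by metis
    from someI_ex[OF this] show "sec e \<in> sections_c G E" "sec e (sh_proj E e) = e"
      by (simp_all add: sec_def)
  qed
  define \<phi> where "\<phi> = (\<lambda>e\<in>topspace (sh_top E). \<theta> (sec e) (sh_proj E e))"
  have \<phi>: "\<phi> (s x) = \<theta> s x" if s: "s \<in> sections_c G E" and x: "x \<in> units G" for s x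
  proof -
    have sx: "s x \<in> topspace (sh_top E)" "sh_proj E (s x) = x" using E.section_st[OF s x] by (auto simp: E.st_iff)
    have "\<theta> (sec (s x)) x = \<theta> s x"
      using sec[OF sx(1)] sx(2) by (intro well s x) auto
    then show ?thesis using sx by (simp add: \<phi>_def)
  qed
  have through: "\<exists>s\<in>sections_c G E. s x = e" if "e \<in> carrier (stalk E x)" for e x
    using sec[of e] that by (auto simp: E.st_iff)
  have \<phi>st: "\<phi> e \<in> carrier (stalk F x)" if "x \<in> units G" "e \<in> carrier (stalk E x)" for e x
    using through[OF that(2)] \<phi> F.section_st[OF \<theta>c] that(1) by metis
  have "\<phi> \<in> sheaf_hom R G E F"
    unfolding sheaf_hom_def
  proof (intro CollectI conjI ballI impI)
    show "\<phi> \<in> extensional (topspace (sh_top E))" by (simp add: \<phi>_def)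
    show "continuous_map (sh_top E) (sh_top F) \<phi>"
    proof (rule continuous_map_locally)
      fix e assume e: "e \<in> topspace (sh_top E)"
      let ?s = "sec e"
      \<comment> \<open>On the image of the section through \<open>e\<close>, an open set,
        \<open>\<phi>\<close> equals the section \<open>\<theta> (sec e)\<close> composed with the
        projection.\<close>
      let ?N = "{e' \<in> topspace (sh_top E). ?s (sh_proj E e') = e'}"
      have "openin (sh_top E) ?N"
        using E.section_st[OF sec(1)[OF e]]
        by (intro E.openin_section_image E.section_continuous sec(1)[OF e]) (auto simp: E.st_iff)
      moreover have "e \<in> ?N" using e sec(2) by simp
      moreover have "continuous_map (sh_top E) (sh_top F) (\<lambda>e'. \<theta> ?s (sh_proj E e'))"
        using continuous_map_compose[OF E.continuous_proj F.section_continuous[OF \<theta>c[OF sec(1)[OF e]]]]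
        by (simp add: o_def)
      then have "continuous_map (subtopology (sh_top E) ?N) (sh_top F) \<phi>"
        by (rule continuous_map_eq[OF continuous_map_from_subtopology])
          (use \<phi>[OF sec(1)[OF e]] E.proj_unit in \<open>simp, metis\<close>)
      ultimately show "\<exists>N. openin (sh_top E) N \<and> e \<in> N \<and> continuous_map (subtopology (sh_top E) N) (sh_top F) \<phi>"
        by blast
    qed
    fix e assume e: "e \<in> topspace (sh_top E)"
    then show "sh_proj F (\<phi> e) = sh_proj E e"
      using \<phi>st[OF E.proj_unit[OF e], of e] by (simp add: E.st_iff F.st_iff)
    fix g assume g: "g \<in> arrows G" "sh_proj E e = rng G g"
    obtain U where U: "U \<in> Bis_c G" "g \<in> U" using arrow_in_Bis_c[OF g(1)] by metis
    define s where "s = sec e"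
    have s: "s \<in> sections_c G E" "s (rng G g) = e" using sec[OF e] g(2) by (auto simp: s_def)
    \<comment> \<open>The arrow \<open>g\<close> is replaced by a bisection \<open>U\<close>
      containing it, whose characteristic function \<open>\<theta>\<close> respects.\<close>
    have "\<phi> (sh_act E e g) = \<phi> ((char_fn R U \<odot>\<^bsub>E.Gam\<^esub> s) (src G g))"
      using s U by (simp add: E.Gam_act_char_bisection)
    also have "\<dots> = (char_fn R U \<odot>\<^bsub>F.Gam\<^esub> \<theta> s) (src G g)"
      using s U g by (simp add: \<phi> E.Gam_act_closed char src_unit \<theta>act)
    also have "\<dots> = sh_act F (\<theta> s (rng G g)) g"
      using s U by (simp add: F.Gam_act_char_bisection \<theta>c)
    also have "\<theta> s (rng G g) = \<phi> e"
      using \<phi>[OF s(1) rng_unit[OF g(1)]] s(2) by simp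
    finally show "\<phi> (sh_act E e g) = sh_act F (\<phi> e) g" .
  next
    fix x assume x: "x \<in> units G"
    show "linear_on R (stalk E x) (stalk F x) \<phi>"
      unfolding linear_on_def
    proof (intro conjI ballI)
      show "\<phi> \<in> carrier (stalk E x) \<rightarrow> carrier (stalk F x)" using \<phi>st[OF x] by blast
    next
      fix u v assume "u \<in> carrier (stalk E x)" "v \<in> carrier (stalk E x)"
      then obtain s t where s: "s \<in> sections_c G E" "s x = u" and t: "t \<in> sections_c G E" "t x = v"
        using through by metis
      have "s \<oplus>\<^bsub>E.Gam\<^esub> t \<in> sections_c G E"
        unfolding E.add_Gam using s t by (intro E.add_section)
      then have "\<phi> ((s \<oplus>\<^bsub>E.Gam\<^esub> t) x) = (\<theta> s \<oplus>\<^bsub>F.Gam\<^esub> \<theta> t) x"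
        using \<phi>[OF _ x] \<theta>add[OF s(1) t(1)] by simp
      then show "\<phi> (u \<oplus>\<^bsub>stalk E x\<^esub> v) = \<phi> u \<oplus>\<^bsub>stalk F x\<^esub> \<phi> v"
        using \<phi>[OF s(1) x] \<phi>[OF t(1) x] s(2) t(2) x by (simp add: E.add_Gam F.add_Gam)
    next
      fix c u assume c: "c \<in> carrier R" and "u \<in> carrier (stalk E x)"
      then obtain s where s: "s \<in> sections_c G E" "s x = u" using through by metis
      \<comment> \<open>Scalars are not part of the hypothesis on \<open>\<theta>\<close>; at
        \<open>x\<close>, the scalar \<open>c\<close> acts as \<open>c \<chi>\<^sub>V\<close> for
        any compact open \<open>V\<close> around \<open>x\<close>.\<close>
      obtain V where "V \<in> nbhds_co G x" using nbhds_co_ex[OF x] by metis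
      then have V: "compact_open (unit_top G) V" "x \<in> V" by (auto simp: nbhds_co_def)
      note cV = ind_in_alg_span[OF c compact_open_Bis_c[OF V(1)]]
      have "\<phi> ((ind c V \<odot>\<^bsub>E.Gam\<^esub> s) x) = (ind c V \<odot>\<^bsub>F.Gam\<^esub> \<theta> s) x"
        using \<phi>[OF E.Gam_act_closed[OF s(1) cV] x] \<theta>act[OF s(1) cV] by simp
      then show "\<phi> (c \<odot>\<^bsub>stalk E x\<^esub> u) = c \<odot>\<^bsub>stalk F x\<^esub> \<phi> u"
        using \<phi>[OF s(1) x] s V c by (simp add: E.Gam_act_ind_unit F.Gam_act_ind_unit \<theta>c)
    qed
  qed
  with \<phi> that show ?thesis by metis
qed

end

text \<open>By fullness the inverse of \<open>\<theta>\<close> also comes from a sheaf morphism.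
  Both composites are the identity on values of sections, and these are all points.\<close>

lemma (in groupoid_sheaf_pair) sheaf_iso_of_module_iso:
  assumes \<phi>: "\<phi> \<in> sheaf_hom R G E F"
    and \<theta>: "right_module_iso (groupoid_algebra R G) E.Gam F.Gam \<theta>"
    and eq: "\<And>s x. s \<in> sections_c G E \<Longrightarrow> x \<in> units G \<Longrightarrow> \<phi> (s x) = \<theta> s x"
  shows "sheaf_iso R G E F \<phi>"
proof -
  interpret sw: groupoid_sheaf_pair R G F E by unfold_locales
  obtain \<theta>' where \<theta>': "\<theta>' \<in> right_module_hom (groupoid_algebra R G) F.Gam E.Gam"
    and inv: "\<And>s. s \<in> sections_c G E \<Longrightarrow> \<theta>' (\<theta> s) = s" "\<And>s. s \<in> sections_c G F \<Longrightarrow> \<theta> (\<theta>' s) = s"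
    using \<theta> by (auto simp: right_module_iso_def)
  obtain \<psi> where \<psi>: "\<psi> \<in> sheaf_hom R G F E"
    "\<And>s x. s \<in> sections_c G F \<Longrightarrow> x \<in> units G \<Longrightarrow> \<psi> (s x) = \<theta>' s x"
    using sw.sheaf_hom_of_module_hom[OF \<theta>'] by metis
  have \<theta>c: "\<theta> s \<in> sections_c G F" if "s \<in> sections_c G E" for s
    using \<theta> that right_module_hom_closed[of \<theta> "groupoid_algebra R G" E.Gam F.Gam s]
    by (simp add: right_module_iso_def)
  have \<theta>'c: "\<theta>' s \<in> sections_c G E" if "s \<in> sections_c G F" for s
    using right_module_hom_closed[OF \<theta>', of s] that by simp
  have "\<psi> (\<phi> e) = e" if e: "e \<in> topspace (sh_top E)" for e
  proof -
    obtain s where s: "s \<in> sections_c G E" "s (sh_proj E e) = e" using E.section_through[OF e] by metis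
    have x: "sh_proj E e \<in> units G" by (rule E.proj_unit[OF e])
    have "\<psi> (\<phi> e) = \<theta>' (\<theta> s) (sh_proj E e)"
      using eq[OF s(1) x] \<psi>(2)[OF \<theta>c[OF s(1)] x] s(2) by simp
    then show ?thesis using inv(1)[OF s(1)] s(2) by simp
  qed
  moreover have "\<phi> (\<psi> e) = e" if e: "e \<in> topspace (sh_top F)" for e
  proof -
    obtain s where s: "s \<in> sections_c G F" "s (sh_proj F e) = e" using F.section_through[OF e] by metis
    have x: "sh_proj F e \<in> units G" by (rule F.proj_unit[OF e])
    have "\<phi> (\<psi> e) = \<theta> (\<theta>' s) (sh_proj F e)"
      using \<psi>(2)[OF s(1) x] eq[OF \<theta>'c[OF s(1)] x] s(2) by simp
    then show ?thesis using inv(2)[OF s(1)] s(2) by simp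
  qed
  ultimately show ?thesis using \<phi> \<psi>(1) unfolding sheaf_iso_def by blast
qed

section \<open>Sheaves of germs\<close>

text \<open>Any map \<open>\<gamma>\<close> identifying \<open>(x, m)\<close> and \<open>(x, n)\<close> exactly when \<open>m\<close> and \<open>n\<close> have the same germ at
  \<open>x\<close> can serve as germ map. Working with an arbitrary \<open>\<gamma>\<close> covers both \<open>Sh\<close> and its copies in other
  types, which the equivalence of categories needs.\<close>

locale germ_map = unitary_groupoid_module R G M
  for R :: "'k ring" (structure) and G :: "'g groupoid" and M :: "('g \<Rightarrow> 'k, 'm) module" +
  fixes \<gamma> :: "'g \<Rightarrow> 'm \<Rightarrow> 'e"
  assumes germ_map_eq_iff: "\<lbrakk>x \<in> units G; y \<in> units G; m \<in> carrier M; n \<in> carrier M\<rbrakk> \<Longrightarrow>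
    \<gamma> x m = \<gamma> y n \<longleftrightarrow> x = y \<and> (\<exists>W\<in>nbhds_co G x. cut W m = cut W n)"
begin

lemma germ_map_eqI:
  "x \<in> units G \<Longrightarrow> m \<in> carrier M \<Longrightarrow> n \<in> carrier M \<Longrightarrow> W \<in> nbhds_co G x \<Longrightarrow> cut W m = cut W n \<Longrightarrow> \<gamma> x m = \<gamma> x n"
  using germ_map_eq_iff[of x x m n] by blast

lemma germ_map_eqD:
  assumes "x \<in> units G" "y \<in> units G" "m \<in> carrier M" "n \<in> carrier M" "\<gamma> x m = \<gamma> y n"
  obtains W where "x = y" "compact_open (unit_top G) W" "x \<in> W" "cut W m = cut W n"
  using assms germ_map_eq_iff[of x y m n] by (auto simp: nbhds_co_def)

lemma germ_map_add_cong:
  assumes x: "x \<in> units G" and M: "m \<in> carrier M" "m' \<in> carrier M" "n \<in> carrier M" "n' \<in> carrier M"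
    and eq: "\<gamma> x m = \<gamma> x m'" "\<gamma> x n = \<gamma> x n'"
  shows "\<gamma> x (m \<oplus>\<^bsub>M\<^esub> n) = \<gamma> x (m' \<oplus>\<^bsub>M\<^esub> n')"
proof -
  obtain V where V: "compact_open (unit_top G) V" "x \<in> V" "cut V m = cut V m'"
    using germ_map_eqD[OF x x M(1,2) eq(1)] by metis
  obtain W where W: "compact_open (unit_top G) W" "x \<in> W" "cut W n = cut W n'"
    using germ_map_eqD[OF x x M(3,4) eq(2)] by metis
  note VW = compact_open_Int[OF V(1) W(1)]
  have "cut (V \<inter> W) m = cut (V \<inter> W) m'" "cut (V \<inter> W) n = cut (V \<inter> W) n'"
    using cut_eq_mono[OF VW V(1) _ M(1,2) V(3)] cut_eq_mono[OF VW W(1) _ M(3,4) W(3)] by auto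
  then have "cut (V \<inter> W) (m \<oplus>\<^bsub>M\<^esub> n) = cut (V \<inter> W) (m' \<oplus>\<^bsub>M\<^esub> n')"
    using M VW by (simp add: cut_add)
  then show ?thesis
    using VW V(2) W(2) M by (intro germ_map_eqI[OF x, where W = "V \<inter> W"]) (simp_all add: nbhds_co_def)
qed

lemma germ_map_scale_cong:
  assumes x: "x \<in> units G" and M: "m \<in> carrier M" "m' \<in> carrier M" and c: "c \<in> carrier R"
    and eq: "\<gamma> x m = \<gamma> x m'"
  shows "\<gamma> x (scale R G M c m) = \<gamma> x (scale R G M c m')"
proof -
  obtain V where V: "compact_open (unit_top G) V" "x \<in> V" "cut V m = cut V m'"
    using germ_map_eqD[OF x x M eq] by metis
  have "cut V (scale R G M c k) = ind c V \<odot>\<^bsub>M\<^esub> cut V k" if "k \<in> carrier M" for k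
    using that V(1) c by (simp add: cut_scale ind_cut)
  then have "cut V (scale R G M c m) = cut V (scale R G M c m')" using M V(3) by simp
  then show ?thesis
    using V M c by (intro germ_map_eqI[OF x, where W = V]) (simp_all add: nbhds_co_def scale_closed)
qed

end

context ample_groupoid
begin

lemma bis_mult_units_left:
  assumes U: "U \<subseteq> units G" and V: "V \<in> Bis_c G"
  shows "bis_mult G U V = {g \<in> V. rng G g \<in> U}"
proof -
  have 1: "gmul G u v = v" "u = rng G v" if "u \<in> U" "v \<in> V" "src G u = rng G v" for u v
  proof -
    have "v \<in> arrows G" "src G u = u" using that U Bis_c_subset[OF V] src_of_unit by auto
    with that show "gmul G u v = v" "u = rng G v" using gmul_rng[of v] by auto
  qed
  have 2: "\<exists>u v. g = gmul G u v \<and> u \<in> U \<and> v \<in> V \<and> src G u = rng G v" if "g \<in> V" "rng G g \<in> U" for g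
  proof -
    have "g = gmul G (rng G g) g" "src G (rng G g) = rng G g"
      using that U Bis_c_subset[OF V] by (auto simp: gmul_rng src_of_unit)
    then show ?thesis using that by blast
  qed
  show ?thesis
    unfolding bis_mult_def
  proof (intro equalityI subsetI)
    fix g assume "g \<in> {gmul G u v |u v. u \<in> U \<and> v \<in> V \<and> src G u = rng G v}"
    then obtain u v where "g = gmul G u v" "u \<in> U" "v \<in> V" "src G u = rng G v" by blast
    with 1[of u v] show "g \<in> {g \<in> V. rng G g \<in> U}" by simp
  qed (use 2 in blast)
qed

end

context unitary_groupoid_module
begin

lemma char_act_char_act:
  assumes "U \<in> Bis_c G" "V \<in> Bis_c G" "m \<in> carrier M"
  shows "char_fn R V \<odot>\<^bsub>M\<^esub> (char_fn R U \<odot>\<^bsub>M\<^esub> m) = char_fn R (bis_mult G U V) \<odot>\<^bsub>M\<^esub> m"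
  using assms by (simp add: char_fn_eq_ind act_conv ind_in_alg_span conv_ind_ind)

lemma char_act_closed: "U \<in> Bis_c G \<Longrightarrow> m \<in> carrier M \<Longrightarrow> char_fn R U \<odot>\<^bsub>M\<^esub> m \<in> carrier M"
  by (intro act_closed char_fn_in_alg_span)

end

context germ_map
begin

text \<open>Independence of the representative and of the bisection at once. In a non-Hausdorff
  arrow space \<open>U \<inter> U'\<close> need not be compact, so a bisection \<open>B\<close>
  around \<open>g\<close> inside it is chosen, with ranges in a set \<open>W\<close> where the
  representatives agree. Over the sources of \<open>B\<close> both sides are the action of
  \<open>\<chi>\<^sub>B\<close> on the common restriction to \<open>W\<close>.\<close>

lemma germ_map_act_cong:
  assumes M: "m \<in> carrier M" "m' \<in> carrier M" and g: "g \<in> arrows G"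
    and U: "U \<in> Bis_c G" "g \<in> U" and U': "U' \<in> Bis_c G" "g \<in> U'"
    and eq: "\<gamma> (rng G g) m = \<gamma> (rng G g) m'"
  shows "\<gamma> (src G g) (char_fn R U \<odot>\<^bsub>M\<^esub> m) = \<gamma> (src G g) (char_fn R U' \<odot>\<^bsub>M\<^esub> m')"
proof -
  have xu: "rng G g \<in> units G" "src G g \<in> units G" using g by (simp_all add: rng_unit src_unit)
  obtain W where W: "compact_open (unit_top G) W" "rng G g \<in> W" "cut W m = cut W m'"
    using germ_map_eqD[OF xu(1) xu(1) M eq] by metis
  let ?N = "U \<inter> U' \<inter> {h \<in> arrows G. rng G h \<in> W}"
  have "openin (arr_top G) {h \<in> arrows G. rng G h \<in> W}"
    using openin_continuous_map_preimage[OF continuous_rng compact_open_openin[OF W(1)]] by simp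
  then have "openin (arr_top G) ?N" using U U' by (auto simp: Bis_c_iff)
  moreover have "g \<in> ?N" using g U U' W by simp
  ultimately obtain B where B: "B \<in> Bis_c G" "g \<in> B" "B \<subseteq> ?N" using Bis_c_basis[of ?N g] by blast
  define V where "V = src G ` B"
  have V: "compact_open (unit_top G) V" "src G g \<in> V"
    using compact_open_src_image[OF B(1)] B(2) by (auto simp: V_def)
  have *: "cut V (char_fn R T \<odot>\<^bsub>M\<^esub> k) = char_fn R B \<odot>\<^bsub>M\<^esub> cut W k"
    if T: "T \<in> Bis_c G" "B \<subseteq> T" and k: "k \<in> carrier M" for T k
  proof -
    have "bis_mult G T V = {h \<in> T. src G h \<in> V}"
      by (rule bis_mult_units[OF T(1) compact_open_subset_units[OF V(1)]])
    \<comment> \<open>The source map is injective on \<open>T\<close>, so the only arrow of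
      \<open>T\<close> over the source of an arrow of \<open>B\<close> is that arrow.\<close>
    also have "\<dots> = B"
      using T inj_onD[of "src G" T] by (fastforce simp: V_def Bis_c_iff subset_iff)
    finally have "cut V (char_fn R T \<odot>\<^bsub>M\<^esub> k) = char_fn R B \<odot>\<^bsub>M\<^esub> k"
      using char_act_char_act[OF T(1) compact_open_Bis_c[OF V(1)] k] by (simp add: cut_def)
    moreover have "bis_mult G W B = B"
      using bis_mult_units_left[OF compact_open_subset_units[OF W(1)] B(1)] B(3) by auto
    then have "char_fn R B \<odot>\<^bsub>M\<^esub> cut W k = char_fn R B \<odot>\<^bsub>M\<^esub> k"
      using char_act_char_act[OF compact_open_Bis_c[OF W(1)] B(1) k] by (simp add: cut_def)
    ultimately show ?thesis by simp
  qed
  have "cut V (char_fn R U \<odot>\<^bsub>M\<^esub> m) = cut V (char_fn R U' \<odot>\<^bsub>M\<^esub> m')"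
    using *[OF U(1) _ M(1)] *[OF U'(1) _ M(2)] B(3) W(3) by auto
  then show ?thesis
    using V U U' M by (intro germ_map_eqI[OF xu(2), where W = V]) (auto simp: nbhds_co_def char_act_closed)
qed

section \<open>The topology on the set of germs\<close>

definition germ_points :: "'e set" where
  "germ_points = {\<gamma> x m |x m. x \<in> units G \<and> m \<in> carrier M}"

text \<open>The open sets generated by the basis of germ images, in a form that can be tested
  directly instead of through unions of basic sets.\<close>

definition germ_open :: "'e set \<Rightarrow> bool" where
  "germ_open S \<longleftrightarrow> S \<subseteq> germ_points \<and>
    (\<forall>x\<in>units G. \<forall>m\<in>carrier M. \<gamma> x m \<in> S \<longrightarrow> (\<exists>W\<in>nbhds_co G x. \<forall>y\<in>W. \<gamma> y m \<in> S))"

definition germ_topology :: "'e topology" where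
  "germ_topology = topology (arbitrary union_of
    (\<lambda>S. S \<in> {(\<lambda>x. \<gamma> x m) ` U |U m. compact_open (unit_top G) U \<and> m \<in> carrier M}))"

text \<open>The basic sets form a base of the topology given by \<open>germ_open\<close>. They are
  open in it because an equality of germs at one point comes from an equality of restrictions, hence
  persists on a neighbourhood.\<close>

lemma openin_germ_topology: "openin germ_topology S \<longleftrightarrow> germ_open S"
proof -
  let ?P = "\<lambda>S. S \<in> {(\<lambda>x. \<gamma> x m) ` U |U m. compact_open (unit_top G) U \<and> m \<in> carrier M}"
  have "istopology germ_open"
    unfolding istopology_def
  proof (intro conjI allI impI)
    fix S T assume S: "germ_open S" and T: "germ_open T"
    show "germ_open (S \<inter> T)"
      unfolding germ_open_def
    proof (intro conjI ballI impI)
      show "S \<inter> T \<subseteq> germ_points" using S by (auto simp: germ_open_def)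
      fix x m assume xm: "x \<in> units G" "m \<in> carrier M" "\<gamma> x m \<in> S \<inter> T"
      then obtain V W where "V \<in> nbhds_co G x" "\<forall>y\<in>V. \<gamma> y m \<in> S" "W \<in> nbhds_co G x" "\<forall>y\<in>W. \<gamma> y m \<in> T"
        using S T unfolding germ_open_def by blast
      then show "\<exists>W\<in>nbhds_co G x. \<forall>y\<in>W. \<gamma> y m \<in> S \<inter> T"
        using nbhds_co_Int[of V x W] by (intro bexI[of _ "V \<inter> W"]) auto
    qed
  next
    fix K assume K: "\<forall>S\<in>K. germ_open S"
    show "germ_open (\<Union>K)"
      unfolding germ_open_def
    proof (intro conjI ballI impI)
      show "\<Union>K \<subseteq> germ_points" using K by (auto simp: germ_open_def)
      fix x m assume xm: "x \<in> units G" "m \<in> carrier M" "\<gamma> x m \<in> \<Union>K"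
      then obtain S where S: "S \<in> K" "\<gamma> x m \<in> S" by blast
      then obtain W where "W \<in> nbhds_co G x" "\<forall>y\<in>W. \<gamma> y m \<in> S"
        using K xm unfolding germ_open_def by blast
      with S(1) show "\<exists>W\<in>nbhds_co G x. \<forall>y\<in>W. \<gamma> y m \<in> \<Union>K" by blast
    qed
  qed
  then have op: "openin (topology germ_open) = germ_open" by simp
  have "openin (topology germ_open) = arbitrary union_of ?P"
  proof (subst openin_topology_base_unique, unfold op, intro conjI allI impI)
    fix S assume "?P S"
    then obtain U n where U: "S = (\<lambda>x. \<gamma> x n) ` U" "compact_open (unit_top G) U" "n \<in> carrier M" by blast
    have Uu: "U \<subseteq> units G" using U(2) by (rule compact_open_subset_units)
    show "germ_open S"
      unfolding germ_open_def
    proof (intro conjI ballI impI)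
      show "S \<subseteq> germ_points" using U Uu by (auto simp: germ_points_def)
      fix x m assume x: "x \<in> units G" and m: "m \<in> carrier M" and "\<gamma> x m \<in> S"
      then obtain y where y: "y \<in> U" "\<gamma> x m = \<gamma> y n" using U(1) by auto
      then obtain W where W: "x = y" "compact_open (unit_top G) W" "x \<in> W" "cut W m = cut W n"
        using germ_map_eqD[OF x _ m U(3) y(2)] Uu by blast
      have "\<gamma> z m \<in> S" if z: "z \<in> W \<inter> U" for z
      proof -
        have "\<gamma> z m = \<gamma> z n"
          using z W Uu m U(3) by (intro germ_map_eqI[where W = W]) (auto simp: nbhds_co_def)
        then show ?thesis using z U(1) by auto
      qed
      moreover have "W \<inter> U \<in> nbhds_co G x"
        using W y U(2) by (simp add: nbhds_co_def compact_open_Int)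
      ultimately show "\<exists>W\<in>nbhds_co G x. \<forall>y\<in>W. \<gamma> y m \<in> S" by blast
    qed
  next
    fix S e assume Se: "germ_open S \<and> e \<in> S"
    then obtain x m where x: "e = \<gamma> x m" "x \<in> units G" "m \<in> carrier M"
      by (auto simp: germ_open_def germ_points_def)
    then obtain W where W: "W \<in> nbhds_co G x" "\<forall>y\<in>W. \<gamma> y m \<in> S"
      using Se unfolding germ_open_def by blast
    then show "\<exists>V. ?P V \<and> e \<in> V \<and> V \<subseteq> S"
      using x by (intro exI[of _ "(\<lambda>y. \<gamma> y m) ` W"]) (auto simp: nbhds_co_def)
  qed
  then have "germ_topology = topology germ_open" unfolding germ_topology_def op by simp
  then show ?thesis by (simp add: op)
qed

end

text \<open>The operations are prescribed only by their effect on germs of elements, for every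
  representative and every bisection. A choice of representatives enters only when such an
  \<open>E\<close> is produced.\<close>

locale germ_sheaf = germ_map R G M \<gamma>
  for R :: "'k ring" (structure) and G :: "'g groupoid" and M :: "('g \<Rightarrow> 'k, 'm) module"
    and \<gamma> :: "'g \<Rightarrow> 'm \<Rightarrow> 'e" +
  fixes E :: "('g, 'k, 'e) gsheaf"
  assumes sh_top_eq: "sh_top E = germ_topology"
    and proj_germ: "\<lbrakk>x \<in> units G; m \<in> carrier M\<rbrakk> \<Longrightarrow> sh_proj E (\<gamma> x m) = x"
    and act_germ: "\<lbrakk>g \<in> arrows G; m \<in> carrier M; U \<in> Bis_c G; g \<in> U\<rbrakk> \<Longrightarrow>
      sh_act E (\<gamma> (rng G g) m) g = \<gamma> (src G g) (char_fn R U \<odot>\<^bsub>M\<^esub> m)"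
    and add_germ: "\<lbrakk>x \<in> units G; m \<in> carrier M; n \<in> carrier M\<rbrakk> \<Longrightarrow>
      sh_add E (\<gamma> x m) (\<gamma> x n) = \<gamma> x (m \<oplus>\<^bsub>M\<^esub> n)"
    and zero_germ: "x \<in> units G \<Longrightarrow> sh_zero E x = \<gamma> x \<zero>\<^bsub>M\<^esub>"
    and smult_germ: "\<lbrakk>x \<in> units G; c \<in> carrier R; m \<in> carrier M\<rbrakk> \<Longrightarrow>
      sh_smult E c (\<gamma> x m) = \<gamma> x (scale R G M c m)"
begin

section \<open>The sheaf axioms for germs\<close>

lemma openin_sh_top: "openin (sh_top E) S \<longleftrightarrow> germ_open S"
  by (simp add: sh_top_eq openin_germ_topology)

lemma topspace_sh_top: "topspace (sh_top E) = germ_points"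
proof
  show "topspace (sh_top E) \<subseteq> germ_points"
    using openin_topspace[of "sh_top E"] unfolding openin_sh_top germ_open_def by blast
  have "germ_open germ_points"
    unfolding germ_open_def
  proof (intro conjI ballI impI order_refl)
    fix x m assume x: "x \<in> units G" "m \<in> carrier M"
    obtain W where W: "W \<in> nbhds_co G x" using nbhds_co_ex[OF x(1)] by metis
    have "\<gamma> y m \<in> germ_points" if "y \<in> W" for y
      using W that x compact_open_subset_units by (auto simp: germ_points_def nbhds_co_def)
    with W show "\<exists>W\<in>nbhds_co G x. \<forall>y\<in>W. \<gamma> y m \<in> germ_points" by blast
  qed
  then show "germ_points \<subseteq> topspace (sh_top E)"
    using openin_subset openin_sh_top by blast
qed

lemma germ_in_topspace: "x \<in> units G \<Longrightarrow> m \<in> carrier M \<Longrightarrow> \<gamma> x m \<in> topspace (sh_top E)"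
  by (auto simp: topspace_sh_top germ_points_def)

lemma topspace_germE:
  assumes "e \<in> topspace (sh_top E)"
  obtains x m where "x \<in> units G" "m \<in> carrier M" "e = \<gamma> x m"
  using assms by (auto simp: topspace_sh_top germ_points_def)

lemma continuous_germ:
  assumes m: "m \<in> carrier M"
  shows "continuous_map (unit_top G) (sh_top E) (\<lambda>x. \<gamma> x m)"
  unfolding continuous_map_def
proof (intro conjI allI impI)
  show "(\<lambda>x. \<gamma> x m) \<in> topspace (unit_top G) \<rightarrow> topspace (sh_top E)"
    using m germ_in_topspace by auto
  fix S assume S: "openin (sh_top E) S"
  show "openin (unit_top G) {x \<in> topspace (unit_top G). \<gamma> x m \<in> S}"
  proof (subst openin_subopen, rule ballI)
    fix x assume "x \<in> {x \<in> topspace (unit_top G). \<gamma> x m \<in> S}"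
    then have "x \<in> units G" "\<gamma> x m \<in> S" by auto
    then obtain W where W: "W \<in> nbhds_co G x" "\<forall>y\<in>W. \<gamma> y m \<in> S"
      using S m unfolding openin_sh_top germ_open_def by blast
    then show "\<exists>T. openin (unit_top G) T \<and> x \<in> T \<and> T \<subseteq> {x \<in> topspace (unit_top G). \<gamma> x m \<in> S}"
      using compact_open_subset_units by (intro exI[of _ W]) (auto simp: nbhds_co_def compact_open_def)
  qed
qed

text \<open>Extends the basic open sets from compact open \<open>D\<close> to arbitrary open
  \<open>D\<close>. With all units as \<open>D\<close>, each element of \<open>M\<close> gives an
  open set on which the projection is injective.\<close>

lemma openin_germ_image:
  assumes D: "openin (unit_top G) D" and n: "n \<in> carrier M"
  shows "openin (sh_top E) ((\<lambda>x. \<gamma> x n) ` D)" (is "openin _ ?S")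
  unfolding openin_sh_top germ_open_def
proof (intro conjI ballI impI)
  have Du: "D \<subseteq> units G" using openin_subset[OF D] by simp
  then show "?S \<subseteq> germ_points" using n by (auto simp: germ_points_def)
  fix x m assume x: "x \<in> units G" and m: "m \<in> carrier M" and "\<gamma> x m \<in> ?S"
  then obtain y where y: "y \<in> D" "\<gamma> x m = \<gamma> y n" by auto
  then have yu: "y \<in> units G" using Du by blast
  obtain W where W: "x = y" "compact_open (unit_top G) W" "x \<in> W" "cut W m = cut W n"
    using germ_map_eqD[OF x yu m n y(2)] by metis
  have "openin (unit_top G) (W \<inter> D)" using W(2) D by (auto simp: compact_open_def)
  moreover have "x \<in> W \<inter> D" using W y by simp
  ultimately obtain V where V: "V \<in> nbhds_co G x" "V \<subseteq> W \<inter> D" using nbhds_co_basis[of "W \<inter> D" x] by blast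
  have "\<gamma> z m \<in> ?S" if z: "z \<in> V" for z
  proof -
    have "\<gamma> z m = \<gamma> z n"
      using z V W Du m n by (intro germ_map_eqI[where W = W]) (auto simp: nbhds_co_def)
    then show ?thesis using z V by auto
  qed
  with V(1) show "\<exists>W\<in>nbhds_co G x. \<forall>y\<in>W. \<gamma> y m \<in> ?S" by blast
qed

lemma continuous_map_germ_proj: "continuous_map (sh_top E) (unit_top G) (sh_proj E)"
  unfolding continuous_map_def
proof (intro conjI allI impI)
  show "sh_proj E \<in> topspace (sh_top E) \<rightarrow> topspace (unit_top G)"
    by (auto elim!: topspace_germE simp: proj_germ)
  fix D assume D: "openin (unit_top G) D"
  have "{e \<in> topspace (sh_top E). sh_proj E e \<in> D} = (\<Union>m\<in>carrier M. (\<lambda>x. \<gamma> x m) ` D)"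
    using openin_subset[OF D] germ_in_topspace
    by (fastforce elim!: topspace_germE simp: proj_germ subset_iff)
  then show "openin (sh_top E) {e \<in> topspace (sh_top E). sh_proj E e \<in> D}"
    using openin_germ_image[OF D] by auto
qed

lemma local_homeomorphism_germ_proj: "local_homeomorphism (sh_top E) (unit_top G) (sh_proj E)"
proof (rule local_homeomorphismI[OF continuous_map_germ_proj])
  show "open_map (sh_top E) (unit_top G) (sh_proj E)"
    unfolding open_map_def
  proof (intro allI impI)
    fix S assume S: "openin (sh_top E) S"
    show "openin (unit_top G) (sh_proj E ` S)"
    proof (subst openin_subopen, rule ballI)
      fix x assume "x \<in> sh_proj E ` S"
      then obtain e where e: "e \<in> S" "x = sh_proj E e" by blast
      have "e \<in> topspace (sh_top E)" using e(1) openin_subset[OF S] by blast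
      then obtain y m where ym: "y \<in> units G" "m \<in> carrier M" "e = \<gamma> y m" by (rule topspace_germE)
      then have x: "x = y" using e(2) by (simp add: proj_germ)
      then obtain W where W: "W \<in> nbhds_co G x" "\<forall>y\<in>W. \<gamma> y m \<in> S"
        using S ym e(1) unfolding openin_sh_top germ_open_def by blast
      have "W \<subseteq> sh_proj E ` S"
      proof
        fix z assume z: "z \<in> W"
        then have "z \<in> units G" using W(1) compact_open_subset_units by (auto simp: nbhds_co_def)
        then have "z = sh_proj E (\<gamma> z m)" using ym by (simp add: proj_germ)
        then show "z \<in> sh_proj E ` S" using W(2) z by blast
      qed
      then show "\<exists>T. openin (unit_top G) T \<and> x \<in> T \<and> T \<subseteq> sh_proj E ` S"
        using W(1) by (auto simp: nbhds_co_def compact_open_def)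
    qed
  qed
  fix e assume "e \<in> topspace (sh_top E)"
  then obtain x m where xm: "x \<in> units G" "m \<in> carrier M" "e = \<gamma> x m" by (rule topspace_germE)
  have "openin (unit_top G) (units G)" using openin_topspace[of "unit_top G"] by simp
  then have "openin (sh_top E) ((\<lambda>x. \<gamma> x m) ` units G)" using xm by (intro openin_germ_image)
  moreover have "inj_on (sh_proj E) ((\<lambda>x. \<gamma> x m) ` units G)"
    using xm by (auto simp: inj_on_def proj_germ)
  ultimately show "\<exists>U. e \<in> U \<and> openin (sh_top E) U \<and> inj_on (sh_proj E) U"
    using xm by (intro exI[of _ "(\<lambda>x. \<gamma> x m) ` units G"]) simp
qed

lemma carrier_stalk_germ: "x \<in> units G \<Longrightarrow> carrier (stalk E x) = {\<gamma> x m |m. m \<in> carrier M}"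
  by (auto simp: stalk_def germ_in_topspace proj_germ elim!: topspace_germE)

lemma module_germ_stalk:
  assumes x: "x \<in> units G"
  shows "Module.module R (stalk E x)"
proof -
  have [simp]: "add (stalk E x) = sh_add E" "zero (stalk E x) = sh_zero E x" "smult (stalk E x) = sh_smult E"
    by (simp_all add: stalk_def)
  note c = carrier_stalk_germ[OF x]
  have ab: "abelian_group (stalk E x)"
  proof (rule abelian_groupI)
    fix e assume "e \<in> carrier (stalk E x)"
    then obtain m where m: "m \<in> carrier M" "e = \<gamma> x m" by (auto simp: c)
    have "\<gamma> x (\<ominus>\<^bsub>M\<^esub> m) \<oplus>\<^bsub>stalk E x\<^esub> e = \<zero>\<^bsub>stalk E x\<^esub>"
      using m x by (simp add: add_germ zero_germ M.l_neg)
    then show "\<exists>y\<in>carrier (stalk E x). y \<oplus>\<^bsub>stalk E x\<^esub> e = \<zero>\<^bsub>stalk E x\<^esub>"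
      using m by (intro bexI[of _ "\<gamma> x (\<ominus>\<^bsub>M\<^esub> m)"]) (auto simp: c)
  qed (use x in \<open>auto simp: c add_germ zero_germ M.a_ac\<close>)
  show ?thesis
    by (rule moduleI[OF is_cring ab])
      (use x in \<open>auto simp: c smult_germ add_germ scale_closed scale_add_left scale_add_right scale_mult scale_one\<close>)
qed

text \<open>Fix a representative \<open>m\<close> of \<open>e\<close> and a bisection
  \<open>U\<close> through \<open>g\<close>. On the neighbourhood of germs of \<open>m\<close> and
  arrows of \<open>U\<close>, the action is the germ of one fixed element taken at the source of the
  arrow. Addition and scalar multiplication are treated below in the same manner, with fixed
  representatives.\<close>

lemma continuous_germ_act:
  "continuous_map (subtopology (prod_topology (sh_top E) (arr_top G)) {(e, g). sh_proj E e = rng G g})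
    (sh_top E) (\<lambda>(e, g). sh_act E e g)" (is "continuous_map ?X _ _")
proof (rule continuous_map_locally)
  fix z assume z: "z \<in> topspace ?X"
  obtain e g where eg: "z = (e, g)" by (cases z)
  with z have eg': "e \<in> topspace (sh_top E)" "g \<in> arrows G" "sh_proj E e = rng G g" by auto
  then obtain m where m: "m \<in> carrier M" "e = \<gamma> (rng G g) m"
    by (auto elim!: topspace_germE simp: proj_germ)
  obtain U where U: "U \<in> Bis_c G" "g \<in> U" using arrow_in_Bis_c[OF eg'(2)] by metis
  let ?S = "(\<lambda>x. \<gamma> x m) ` units G"
  let ?N = "{(e, g). sh_proj E e = rng G g} \<inter> ?S \<times> U"
  have opu: "openin (unit_top G) (units G)" using openin_topspace[of "unit_top G"] by simp
  have "openin (prod_topology (sh_top E) (arr_top G)) (?S \<times> U)"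
    using openin_germ_image[OF opu m(1)] U(1) by (simp add: openin_prod_Times_iff Bis_c_iff)
  then have "openin ?X ?N" by (rule openin_subtopology_Int2)
  moreover have "z \<in> ?N" using eg eg' m U rng_unit[OF eg'(2)] by auto
  moreover have "continuous_map (subtopology ?X ?N) (sh_top E) (\<lambda>(e, g). sh_act E e g)"
  proof (rule continuous_map_eq)
    have "continuous_map (prod_topology (sh_top E) (arr_top G)) (sh_top E) (\<lambda>z. \<gamma> (src G (snd z)) (char_fn R U \<odot>\<^bsub>M\<^esub> m))"
      using continuous_map_compose[OF continuous_map_compose[OF continuous_map_snd continuous_src]
          continuous_germ[OF char_act_closed[OF U(1) m(1)]]] by (simp add: o_def)
    then show "continuous_map (subtopology ?X ?N) (sh_top E) (\<lambda>z. \<gamma> (src G (snd z)) (char_fn R U \<odot>\<^bsub>M\<^esub> m))"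
      by (intro continuous_map_from_subtopology)
    fix w assume "w \<in> topspace (subtopology ?X ?N)"
    then obtain x h where w: "w = (\<gamma> x m, h)" "x \<in> units G" "h \<in> U" "sh_proj E (\<gamma> x m) = rng G h" by auto
    then have "x = rng G h" "h \<in> arrows G" using m Bis_c_subset[OF U(1)] by (auto simp: proj_germ)
    then show "\<gamma> (src G (snd w)) (char_fn R U \<odot>\<^bsub>M\<^esub> m) = (\<lambda>(e, g). sh_act E e g) w"
      using w m U(1) by (simp add: act_germ)
  qed
  ultimately show "\<exists>N. openin ?X N \<and> z \<in> N \<and> continuous_map (subtopology ?X N) (sh_top E) (\<lambda>(e, g). sh_act E e g)"
    by blast
qed

lemma continuous_germ_add:
  "continuous_map (subtopology (prod_topology (sh_top E) (sh_top E)) {(e, e'). sh_proj E e = sh_proj E e'})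
    (sh_top E) (\<lambda>(e, e'). sh_add E e e')" (is "continuous_map ?X _ _")
proof (rule continuous_map_locally)
  fix z assume z: "z \<in> topspace ?X"
  obtain e e' where ee: "z = (e, e')" by (cases z)
  with z have ee': "e \<in> topspace (sh_top E)" "e' \<in> topspace (sh_top E)" "sh_proj E e = sh_proj E e'" by auto
  obtain x m where m: "x \<in> units G" "m \<in> carrier M" "e = \<gamma> x m" using ee'(1) by (rule topspace_germE)
  obtain y n where n: "y \<in> units G" "n \<in> carrier M" "e' = \<gamma> y n" using ee'(2) by (rule topspace_germE)
  let ?S = "(\<lambda>x. \<gamma> x m) ` units G" and ?T = "(\<lambda>x. \<gamma> x n) ` units G"
  let ?N = "{(e, e'). sh_proj E e = sh_proj E e'} \<inter> ?S \<times> ?T"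
  have opu: "openin (unit_top G) (units G)" using openin_topspace[of "unit_top G"] by simp
  have "openin (prod_topology (sh_top E) (sh_top E)) (?S \<times> ?T)"
    using openin_germ_image[OF opu] m n by (simp add: openin_prod_Times_iff)
  then have "openin ?X ?N" by (rule openin_subtopology_Int2)
  moreover have "z \<in> ?N" using ee ee' m n by auto
  moreover have "continuous_map (subtopology ?X ?N) (sh_top E) (\<lambda>(e, e'). sh_add E e e')"
  proof (rule continuous_map_eq)
    have "continuous_map (prod_topology (sh_top E) (sh_top E)) (sh_top E) (\<lambda>z. \<gamma> (sh_proj E (fst z)) (m \<oplus>\<^bsub>M\<^esub> n))"
      using continuous_map_compose[OF continuous_map_compose[OF continuous_map_fst continuous_map_germ_proj]
          continuous_germ[of "m \<oplus>\<^bsub>M\<^esub> n"]] m n by (simp add: o_def)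
    then show "continuous_map (subtopology ?X ?N) (sh_top E) (\<lambda>z. \<gamma> (sh_proj E (fst z)) (m \<oplus>\<^bsub>M\<^esub> n))"
      by (intro continuous_map_from_subtopology)
    fix w assume "w \<in> topspace (subtopology ?X ?N)"
    then obtain u v where w: "w = (\<gamma> u m, \<gamma> v n)" "u \<in> units G" "v \<in> units G"
      "sh_proj E (\<gamma> u m) = sh_proj E (\<gamma> v n)" by auto
    then have "u = v" using m n by (simp add: proj_germ)
    then show "\<gamma> (sh_proj E (fst w)) (m \<oplus>\<^bsub>M\<^esub> n) = (\<lambda>(e, e'). sh_add E e e') w"
      using w m n by (simp add: proj_germ add_germ)
  qed
  ultimately show "\<exists>N. openin ?X N \<and> z \<in> N \<and> continuous_map (subtopology ?X N) (sh_top E) (\<lambda>(e, e'). sh_add E e e')"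
    by blast
qed

lemma continuous_germ_smult:
  "continuous_map (prod_topology (discrete_topology (carrier R)) (sh_top E)) (sh_top E) (\<lambda>(c, e). sh_smult E c e)"
  (is "continuous_map ?X _ _")
proof (rule continuous_map_locally)
  fix z assume z: "z \<in> topspace ?X"
  obtain c e where ce: "z = (c, e)" by (cases z)
  with z have c: "c \<in> carrier R" and e: "e \<in> topspace (sh_top E)" by auto
  obtain x m where m: "x \<in> units G" "m \<in> carrier M" "e = \<gamma> x m" using e by (rule topspace_germE)
  let ?N = "{c} \<times> (\<lambda>x. \<gamma> x m) ` units G"
  have opu: "openin (unit_top G) (units G)" using openin_topspace[of "unit_top G"] by simp
  have "openin ?X ?N"
    using openin_germ_image[OF opu] m c by (simp add: openin_prod_Times_iff)
  moreover have "z \<in> ?N" using ce m by auto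
  moreover have "continuous_map (subtopology ?X ?N) (sh_top E) (\<lambda>(c, e). sh_smult E c e)"
  proof (rule continuous_map_eq)
    have "continuous_map ?X (sh_top E) (\<lambda>z. \<gamma> (sh_proj E (snd z)) (scale R G M c m))"
      using continuous_map_compose[OF continuous_map_compose[OF continuous_map_snd continuous_map_germ_proj]
          continuous_germ[OF scale_closed[OF c m(2)]]] by (simp add: o_def)
    then show "continuous_map (subtopology ?X ?N) (sh_top E) (\<lambda>z. \<gamma> (sh_proj E (snd z)) (scale R G M c m))"
      by (intro continuous_map_from_subtopology)
    fix w assume "w \<in> topspace (subtopology ?X ?N)"
    then show "\<gamma> (sh_proj E (snd w)) (scale R G M c m) = (\<lambda>(c, e). sh_smult E c e) w"
      using m c by (auto simp: proj_germ smult_germ)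
  qed
  ultimately show "\<exists>N. openin ?X N \<and> z \<in> N \<and> continuous_map (subtopology ?X N) (sh_top E) (\<lambda>(c, e). sh_smult E c e)"
    by blast
qed

lemma gsheaf_of_modules: "gsheaf_of_modules R G E"
proof (rule gsheaf_of_modules.intro)
  show "local_homeomorphism (sh_top E) (unit_top G) (sh_proj E)" by (rule local_homeomorphism_germ_proj)
  show "continuous_map (subtopology (prod_topology (sh_top E) (arr_top G)) {(e, g). sh_proj E e = rng G g})
    (sh_top E) (\<lambda>(e, g). sh_act E e g)" by (rule continuous_germ_act)
  show "Module.module R (stalk E x)" if "x \<in> units G" for x using that by (rule module_germ_stalk)
  show "continuous_map (unit_top G) (sh_top E) (sh_zero E)"
    by (rule continuous_map_eq[OF continuous_germ[OF M.zero_closed]]) (simp add: zero_germ)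
  show "continuous_map (subtopology (prod_topology (sh_top E) (sh_top E)) {(e, e'). sh_proj E e = sh_proj E e'})
    (sh_top E) (\<lambda>(e, e'). sh_add E e e')" by (rule continuous_germ_add)
  show "continuous_map (prod_topology (discrete_topology (carrier R)) (sh_top E)) (sh_top E)
    (\<lambda>(c, e). sh_smult E c e)" by (rule continuous_germ_smult)
  show "sh_act E e (sh_proj E e) = e" if e: "e \<in> topspace (sh_top E)" for e
  proof -
    obtain x m where m: "x \<in> units G" "m \<in> carrier M" "e = \<gamma> x m" using e by (rule topspace_germE)
    obtain W where "W \<in> nbhds_co G x" using nbhds_co_ex[OF m(1)] by metis
    then have W: "compact_open (unit_top G) W" "x \<in> W" by (auto simp: nbhds_co_def)
    \<comment> \<open>A compact open neighbourhood \<open>W\<close> of the unit \<open>x\<close> is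
      itself a bisection through \<open>x\<close>, and restricting to it does not change the germ at
      \<open>x\<close>.\<close>
    have "sh_act E e x = \<gamma> x (cut W m)"
      using act_germ[of x m W] m W by (simp add: unit_arrow compact_open_Bis_c rng_of_unit src_of_unit cut_def)
    also have "\<dots> = e"
      using m W unfolding m(3) by (intro germ_map_eqI[where W = W]) (auto simp: cut_closed cut_cut nbhds_co_def)
    finally show ?thesis using m by (simp add: proj_germ)
  qed
  fix e g assume e: "e \<in> topspace (sh_top E)" and g: "g \<in> arrows G" and eg: "sh_proj E e = rng G g"
  obtain m where m: "m \<in> carrier M" "e = \<gamma> (rng G g) m"
    using e eg by (auto elim!: topspace_germE simp: proj_germ)
  obtain U where U: "U \<in> Bis_c G" "g \<in> U" using arrow_in_Bis_c[OF g] by metis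
  have act: "sh_act E e g = \<gamma> (src G g) (char_fn R U \<odot>\<^bsub>M\<^esub> m)" using m U g by (simp add: act_germ)
  then show "sh_proj E (sh_act E e g) = src G g"
    using g m U by (simp add: proj_germ src_unit char_act_closed)
  fix h assume h: "h \<in> arrows G" and gh: "src G g = rng G h"
  obtain V where V: "V \<in> Bis_c G" "h \<in> V" using arrow_in_Bis_c[OF h] by metis
  have "sh_act E (sh_act E e g) h = \<gamma> (src G h) (char_fn R V \<odot>\<^bsub>M\<^esub> (char_fn R U \<odot>\<^bsub>M\<^esub> m))"
    using act act_germ[OF h char_act_closed[OF U(1) m(1)] V] gh by simp
  also have "\<dots> = \<gamma> (src G h) (char_fn R (bis_mult G U V) \<odot>\<^bsub>M\<^esub> m)"
    using U V m by (simp add: char_act_char_act)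
  also have "\<dots> = sh_act E e (gmul G g h)"
  proof -
    have "gmul G g h \<in> bis_mult G U V" using U V gh by (auto simp: bis_mult_def)
    then show ?thesis
      using act_germ[OF gmul_closed[OF g h gh] m(1) bis_mult_closed[OF U(1) V(1)]] m(2) g h gh
      by (simp add: src_gmul rng_gmul)
  qed
  finally show "sh_act E (sh_act E e g) h = sh_act E e (gmul G g h)" .
next
  fix g assume g: "g \<in> arrows G"
  have u: "rng G g \<in> units G" "src G g \<in> units G" using g by (simp_all add: rng_unit src_unit)
  obtain U where U: "U \<in> Bis_c G" "g \<in> U" using arrow_in_Bis_c[OF g] by metis
  have [simp]: "add (stalk E x) = sh_add E" "smult (stalk E x) = sh_smult E" for x
    by (simp_all add: stalk_def)
  \<comment> \<open>A single \<open>W\<close> is taken that contains the ranges of \<open>U\<close>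
    and on which \<open>m\<close> is fixed. Then \<open>c\<close> acts on \<open>m\<close> as
    \<open>c \<chi>\<^sub>W\<close>, and multiplying this by \<open>\<chi>\<^sub>U\<close> gives
    \<open>c \<chi>\<^sub>U\<close>.\<close>
  have sc: "scale R G M c (char_fn R U \<odot>\<^bsub>M\<^esub> m) = char_fn R U \<odot>\<^bsub>M\<^esub> scale R G M c m"
    if c: "c \<in> carrier R" and m: "m \<in> carrier M" for c m
  proof -
    obtain V where V: "compact_open (unit_top G) V" "cut V m = m" using fixed_by_cut[OF m] by metis
    obtain W where W: "compact_open (unit_top G) W" "V \<union> rng G ` U \<subseteq> W"
      using compact_open_Un[OF V(1) compact_open_rng_image[OF U(1)]] by blast
    have WV: "cut W m = m" using cut_fixed_mono[OF V(1) W(1) _ m V(2)] W(2) by blast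
    have "bis_mult G W U = U"
      using bis_mult_units_left[OF compact_open_subset_units[OF W(1)] U(1)] W(2) by auto
    then have "ind c W \<star> char_fn R U = ind c U"
      using conv_ind_ind[OF compact_open_Bis_c[OF W(1)] U(1) c one_closed] c by (simp add: char_fn_eq_ind)
    then have "char_fn R U \<odot>\<^bsub>M\<^esub> scale R G M c m = ind c U \<odot>\<^bsub>M\<^esub> m"
      using act_conv[OF ind_in_alg_span[OF c compact_open_Bis_c[OF W(1)]] char_fn_in_alg_span[OF U(1)] m]
        scale_eq[OF m c W(1) WV] by simp
    then show ?thesis using ind_act_eq_scale[OF c U(1) m] by simp
  qed
  show "linear_on R (stalk E (rng G g)) (stalk E (src G g)) (\<lambda>e. sh_act E e g)"
    unfolding linear_on_def carrier_stalk_germ[OF u(1)] carrier_stalk_germ[OF u(2)]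
    using u U g
    by (auto simp: act_germ[OF g _ U] add_germ smult_germ act_add_left char_fn_in_alg_span
        char_act_closed scale_closed sc)
qed

end

section \<open>Sections of sheaves of germs\<close>

context germ_sheaf
begin

sublocale S: groupoid_sheaf R G E
  by (intro groupoid_sheaf.intro gsheaf_of_modules ample_groupoid_over_ring_axioms)

definition germ_section :: "'m \<Rightarrow> 'g \<Rightarrow> 'e" where
  "germ_section m = (\<lambda>x\<in>units G. \<gamma> x m)"

lemma germ_section_apply: "x \<in> units G \<Longrightarrow> germ_section m x = \<gamma> x m"
  by (simp add: germ_section_def)

lemma germ_section_extensional: "germ_section m \<in> extensional (units G)"
  by (simp add: germ_section_def)

text \<open>\<open>V\<close> is closed, so \<open>x\<close> has a compact open neighbourhood
  disjoint from \<open>V\<close>, and restricting \<open>cut V m\<close> to it gives zero.\<close>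

lemma germ_outside_support:
  assumes m: "m \<in> carrier M" and V: "compact_open (unit_top G) V" "cut V m = m" and x: "x \<in> units G" "x \<notin> V"
  shows "\<gamma> x m = \<gamma> x \<zero>\<^bsub>M\<^esub>"
proof -
  have op: "openin (unit_top G) (units G - V)"
    using compact_open_closedin[OF V(1)] by (metis openin_closedin_eq closedin_def topspace_unit_top)
  have "x \<in> units G - V" using x by simp
  then obtain W where W: "W \<in> nbhds_co G x" "W \<subseteq> units G - V"
    using nbhds_co_basis[OF op] by metis
  then have Wc: "compact_open (unit_top G) W" by (simp add: nbhds_co_def)
  have "W \<inter> V = {}" using W(2) by blast
  then have "cut W (cut V m) = \<zero>\<^bsub>M\<^esub>" using cut_cut[OF Wc V(1) m] cut_empty[OF m] by simp
  then show ?thesis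
    using W(1) Wc V(2) m by (intro germ_map_eqI[OF x(1), where W = W]) (simp_all add: cut_zero)
qed

lemma germ_section_closed:
  assumes m: "m \<in> carrier M"
  shows "germ_section m \<in> sections_c G E"
  unfolding S.sections_c_iff
proof (intro conjI germ_section_extensional)
  show "continuous_map (unit_top G) (sh_top E) (germ_section m)"
    by (rule continuous_map_eq[OF continuous_germ[OF m]]) (simp add: germ_section_apply)
  show "\<forall>x\<in>units G. sh_proj E (germ_section m x) = x"
    using m by (simp add: germ_section_apply proj_germ)
  obtain V where "compact_open (unit_top G) V" "cut V m = m" using fixed_by_cut[OF m] by metis
  then show "\<exists>U. compact_open (unit_top G) U \<and> (\<forall>x\<in>units G - U. germ_section m x = sh_zero E x)"
    using m by (intro exI[of _ V]) (auto simp: germ_section_apply zero_germ germ_outside_support)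
qed

lemma germ_section_add:
  assumes "m \<in> carrier M" "n \<in> carrier M"
  shows "germ_section (m \<oplus>\<^bsub>M\<^esub> n) = germ_section m \<oplus>\<^bsub>S.Gam\<^esub> germ_section n"
  using assms by (intro extensionalityI[where A = "units G"])
    (simp_all add: germ_section_extensional S.add_Gam germ_section_apply add_germ)

text \<open>Over the source image of \<open>U\<close> the bisection in the rule for the action on
  germs may be taken to be \<open>U\<close> itself. Elsewhere the germ is zero, since the result is
  fixed by restriction to that image.\<close>

lemma germ_section_act_ind:
  assumes c: "c \<in> carrier R" and U: "U \<in> Bis_c G" and m: "m \<in> carrier M"
  shows "germ_section (ind c U \<odot>\<^bsub>M\<^esub> m) = ind c U \<odot>\<^bsub>S.Gam\<^esub> germ_section m"
proof (rule extensionalityI[OF germ_section_extensional S.Gam_act_extensional])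
  fix x assume x: "x \<in> units G"
  note Uc = ind_in_alg_span[OF c U]
  note act = S.Gam_act_ind[OF germ_section_closed[OF m] U c x]
  show "germ_section (ind c U \<odot>\<^bsub>M\<^esub> m) x = (ind c U \<odot>\<^bsub>S.Gam\<^esub> germ_section m) x"
  proof (cases "x \<in> src G ` U")
    case True
    define l where "l = lift U x"
    have l: "l \<in> U" "l \<in> arrows G" "src G l = x"
      using True lift_in lift_arrow[OF U] src_lift by (auto simp: l_def)
    have "(ind c U \<odot>\<^bsub>S.Gam\<^esub> germ_section m) x = sh_smult E c (sh_act E (\<gamma> (rng G l) m) l)"
      using act True rng_unit[OF l(2)] by (simp add: l_def germ_section_apply)
    also have "sh_act E (\<gamma> (rng G l) m) l = \<gamma> x (char_fn R U \<odot>\<^bsub>M\<^esub> m)"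
      using act_germ[OF l(2) m U l(1)] l(3) by simp
    also have "sh_smult E c (\<gamma> x (char_fn R U \<odot>\<^bsub>M\<^esub> m)) = \<gamma> x (ind c U \<odot>\<^bsub>M\<^esub> m)"
      using x c U m by (simp add: smult_germ char_act_closed ind_act_eq_scale)
    finally show ?thesis using x by (simp add: germ_section_apply)
  next
    case False
    have "\<gamma> x (ind c U \<odot>\<^bsub>M\<^esub> m) = \<gamma> x \<zero>\<^bsub>M\<^esub>"
      using False compact_open_src_image[OF U] x m
      by (intro germ_outside_support[where V = "src G ` U"] act_closed Uc cut_act)
        (auto simp: ind_def split: if_splits)
    then show ?thesis using act False x by (simp add: germ_section_apply zero_germ)
  qed
qed

lemma germ_section_act:
  assumes m: "m \<in> carrier M" and "f \<in> alg_span R G"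
  shows "germ_section (f \<odot>\<^bsub>M\<^esub> m) = f \<odot>\<^bsub>S.Gam\<^esub> germ_section m"
  using assms(2)
proof (induction rule: alg_span_induct)
  case zero
  show ?case
    unfolding S.Gam_act_zero act_zero_fun[OF m] S.zero_Gam germ_section_def
    by (rule restrict_ext) (simp add: zero_germ)
next
  case (add c U f)
  note U = ind_in_alg_span[OF add(1,2)]
  show ?case
    using add(4) m
    by (simp add: act_add_right U add(3) germ_section_add act_closed germ_section_act_ind add(1,2)
        S.Gam_act_add germ_section_closed)
qed

text \<open>Equal germs at every point mean equal restrictions near every point. Additivity of
  restriction over disjoint unions carries this to a compact open set that fixes both
  elements.\<close>

lemma inj_germ_section: "inj_on germ_section (carrier M)"
proof (rule inj_onI)
  fix m n assume m: "m \<in> carrier M" and n: "n \<in> carrier M" and eq: "germ_section m = germ_section n"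
  obtain V where V: "compact_open (unit_top G) V" "cut V m = m" "cut V n = n"
    using fixed_by_cut2[OF m n] by metis
  have "cut V m = cut V n"
  proof (rule compact_open_disjoint_induct[OF V(1), where P = "\<lambda>W. cut W m = cut W n"])
    fix x assume "x \<in> V"
    then have x: "x \<in> units G" using compact_open_subset_units[OF V(1)] by blast
    have "\<gamma> x m = \<gamma> x n" using fun_cong[OF eq, of x] x by (simp add: germ_section_apply)
    then show "\<exists>W. compact_open (unit_top G) W \<and> x \<in> W \<and> cut W m = cut W n"
      using germ_map_eqD[OF x x m n] by metis
  next
    show "cut {} m = cut {} n" using m n by (simp add: cut_empty)
  next
    fix U W assume "compact_open (unit_top G) U" "compact_open (unit_top G) W" "U \<subseteq> W" "cut W m = cut W n"
    then show "cut U m = cut U n" using m n by (intro cut_eq_mono[of U W])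
  next
    fix U W assume "compact_open (unit_top G) U" "compact_open (unit_top G) W" "U \<inter> W = {}"
      "cut U m = cut U n" "cut W m = cut W n"
    then show "cut (U \<union> W) m = cut (U \<union> W) n" using m n by (simp add: cut_Un)
  qed
  then show "m = n" using V by simp
qed

lemma germ_section_surj:
  assumes s: "s \<in> sections_c G E"
  obtains m where "m \<in> carrier M" "germ_section m = s"
proof -
  obtain U where U: "compact_open (unit_top G) U" "\<And>x. x \<in> units G \<Longrightarrow> x \<notin> U \<Longrightarrow> s x = sh_zero E x"
    using S.section_support[OF s] by metis
  have "\<exists>m\<in>carrier M. \<forall>x\<in>U. s x = \<gamma> x m"
  proof (rule compact_open_disjoint_induct[OF U(1), where P = "\<lambda>W. \<exists>m\<in>carrier M. \<forall>x\<in>W. s x = \<gamma> x m"])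
    fix x assume "x \<in> U"
    then have x: "x \<in> units G" using compact_open_subset_units[OF U(1)] by blast
    have "s x \<in> carrier (stalk E x)" by (rule S.section_st[OF s x])
    then obtain m where m: "m \<in> carrier M" "s x = \<gamma> x m" by (auto simp: carrier_stalk_germ[OF x])
    have op: "openin (unit_top G) (units G)" using openin_topspace[of "unit_top G"] by simp
    have sub: "subtopology (unit_top G) (units G) = unit_top G"
      using subtopology_topspace[of "unit_top G"] by simp
    have "\<exists>W. W \<in> nbhds_co G x \<and> (\<forall>y\<in>W. s y = \<gamma> y m)"
      by (rule S.continuous_sections_agree[OF op x, of s "\<lambda>y. \<gamma> y m"])
        (use S.section_st[OF s] S.section_continuous[OF s] continuous_germ[OF m(1)] m sub
          in \<open>auto simp: S.st_iff proj_germ\<close>)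
    then show "\<exists>W. compact_open (unit_top G) W \<and> x \<in> W \<and> (\<exists>m\<in>carrier M. \<forall>x\<in>W. s x = \<gamma> x m)"
      using m(1) by (auto simp: nbhds_co_def)
  next
    show "\<exists>m\<in>carrier M. \<forall>x\<in>{}. s x = \<gamma> x m" using M.zero_closed by blast
  next
    fix V W assume "V \<subseteq> W" "\<exists>m\<in>carrier M. \<forall>x\<in>W. s x = \<gamma> x m"
    then show "\<exists>m\<in>carrier M. \<forall>x\<in>V. s x = \<gamma> x m" by blast
  next
    fix V W assume V: "compact_open (unit_top G) V" and W: "compact_open (unit_top G) W" and dis: "V \<inter> W = {}"
      and "\<exists>m\<in>carrier M. \<forall>x\<in>V. s x = \<gamma> x m" "\<exists>m\<in>carrier M. \<forall>x\<in>W. s x = \<gamma> x m"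
    then obtain m n where m: "m \<in> carrier M" "\<forall>x\<in>V. s x = \<gamma> x m" and n: "n \<in> carrier M" "\<forall>x\<in>W. s x = \<gamma> x n"
      by blast
    \<comment> \<open>The summands are cut down first: as \<open>V\<close> and \<open>W\<close> are
      disjoint, each becomes zero when restricted to the other set and leaves the germs there
      unchanged.\<close>
    let ?k = "cut V m \<oplus>\<^bsub>M\<^esub> cut W n"
    have k: "?k \<in> carrier M" using V W m n by (simp add: cut_closed)
    have "W \<inter> V = {}" using dis by blast
    then have "cut V ?k = cut V m" "cut W ?k = cut W n"
      using V W m n dis by (simp_all add: cut_add cut_closed cut_cut cut_empty)
    then have "\<gamma> x ?k = \<gamma> x m" if "x \<in> V" for x
      using that V m k compact_open_subset_units[OF V]
      by (intro germ_map_eqI[where W = V]) (auto simp: nbhds_co_def)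
    moreover have "\<gamma> x ?k = \<gamma> x n" if "x \<in> W" for x
      using that W n k compact_open_subset_units[OF W] \<open>cut W ?k = cut W n\<close>
      by (intro germ_map_eqI[where W = W]) (auto simp: nbhds_co_def)
    ultimately show "\<exists>m\<in>carrier M. \<forall>x\<in>V \<union> W. s x = \<gamma> x m" using m n k by (intro bexI[of _ ?k]) auto
  qed
  then obtain m where m: "m \<in> carrier M" "\<And>x. x \<in> U \<Longrightarrow> s x = \<gamma> x m" by blast
  \<comment> \<open>The element found so far is controlled only over \<open>U\<close>. Cutting it
    down to \<open>U\<close> makes its germs zero outside, where \<open>s\<close> vanishes.\<close>
  have cU: "cut U m \<in> carrier M" "cut U (cut U m) = cut U m" using m U(1) by (simp_all add: cut_closed cut_cut)
  have "germ_section (cut U m) = s"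
  proof (rule S.section_ext[OF germ_section_closed[OF cU(1)] s])
    fix x assume x: "x \<in> units G"
    show "germ_section (cut U m) x = s x"
    proof (cases "x \<in> U")
      case True
      then have "\<gamma> x (cut U m) = \<gamma> x m"
        using U(1) m cU by (intro germ_map_eqI[OF x, where W = U]) (auto simp: nbhds_co_def)
      then show ?thesis using True x m by (simp add: germ_section_apply)
    next
      case False
      then show ?thesis
        using U x cU by (simp add: germ_section_apply germ_outside_support zero_germ)
    qed
  qed
  with cU(1) that show ?thesis by blast
qed

lemma germ_section_hom: "restrict germ_section (carrier M) \<in> right_module_hom (groupoid_algebra R G) M S.Gam"
  by (auto simp: right_module_hom_def germ_section_closed germ_section_add germ_section_act act_closed)

lemma germ_section_iso: "right_module_iso (groupoid_algebra R G) M S.Gam (restrict germ_section (carrier M))"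
proof (rule right_module_isoI[OF germ_section_hom _ M.right_module_axioms])
  have "germ_section ` carrier M = sections_c G E"
    using germ_section_closed germ_section_surj by (metis (no_types, lifting) image_iff image_subsetI subsetI subset_antisym)
  then show "bij_betw (restrict germ_section (carrier M)) (carrier M) (carrier S.Gam)"
    using inj_germ_section by (simp add: bij_betw_def inj_on_restrict_eq image_restrict_eq)
qed

end

section \<open>Concrete sheaves of germs\<close>

context germ_map
begin

text \<open>The definition of \<open>Sh_obj\<close> with the germ map, the base point and the
  representative as parameters; \<open>Sh_obj\<close> is the instance with \<open>fst\<close> and
  \<open>germ_rep\<close>.\<close>

definition germ_sheaf_of :: "('e \<Rightarrow> 'g) \<Rightarrow> ('e \<Rightarrow> 'm) \<Rightarrow> ('g, 'k, 'e) gsheaf" where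
  "germ_sheaf_of base rep =
     \<lparr>sh_top = germ_topology,
      sh_proj = base,
      sh_act = (\<lambda>e g. \<gamma> (src G g) (char_fn R (SOME U. U \<in> Bis_c G \<and> g \<in> U) \<odot>\<^bsub>M\<^esub> rep e)),
      sh_add = (\<lambda>e e'. \<gamma> (base e) (rep e \<oplus>\<^bsub>M\<^esub> rep e')),
      sh_zero = (\<lambda>x. \<gamma> x \<zero>\<^bsub>M\<^esub>),
      sh_smult = (\<lambda>c e. \<gamma> (base e) (scale R G M c (rep e)))\<rparr>"

lemma germ_sheaf_germ_sheaf_of:
  assumes base: "\<And>x m. x \<in> units G \<Longrightarrow> m \<in> carrier M \<Longrightarrow> base (\<gamma> x m) = x"
    and rep: "\<And>x m. x \<in> units G \<Longrightarrow> m \<in> carrier M \<Longrightarrow> rep (\<gamma> x m) \<in> carrier M"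
    "\<And>x m. x \<in> units G \<Longrightarrow> m \<in> carrier M \<Longrightarrow> \<gamma> x (rep (\<gamma> x m)) = \<gamma> x m"
  shows "germ_sheaf R G M \<gamma> (germ_sheaf_of base rep)"
proof
  let ?E = "germ_sheaf_of base rep"
  show "sh_top ?E = germ_topology" by (simp add: germ_sheaf_of_def)
  show "sh_proj ?E (\<gamma> x m) = x" if "x \<in> units G" "m \<in> carrier M" for x m
    using that base by (simp add: germ_sheaf_of_def)
  show "sh_act ?E (\<gamma> (rng G g) m) g = \<gamma> (src G g) (char_fn R U \<odot>\<^bsub>M\<^esub> m)"
    if g: "g \<in> arrows G" and m: "m \<in> carrier M" and U: "U \<in> Bis_c G" "g \<in> U" for g m U
  proof -
    let ?U = "SOME U. U \<in> Bis_c G \<and> g \<in> U"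
    have "?U \<in> Bis_c G \<and> g \<in> ?U" using someI[of "\<lambda>U. U \<in> Bis_c G \<and> g \<in> U" U] U by blast
    then have "\<gamma> (src G g) (char_fn R ?U \<odot>\<^bsub>M\<^esub> rep (\<gamma> (rng G g) m)) = \<gamma> (src G g) (char_fn R U \<odot>\<^bsub>M\<^esub> m)"
      using rep[OF rng_unit[OF g] m] g m U by (intro germ_map_act_cong) auto
    then show ?thesis by (simp add: germ_sheaf_of_def)
  qed
  show "sh_add ?E (\<gamma> x m) (\<gamma> x n) = \<gamma> x (m \<oplus>\<^bsub>M\<^esub> n)"
    if "x \<in> units G" "m \<in> carrier M" "n \<in> carrier M" for x m n
  proof -
    have "\<gamma> x (rep (\<gamma> x m) \<oplus>\<^bsub>M\<^esub> rep (\<gamma> x n)) = \<gamma> x (m \<oplus>\<^bsub>M\<^esub> n)"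
      using that rep by (intro germ_map_add_cong) auto
    then show ?thesis using that base by (simp add: germ_sheaf_of_def)
  qed
  show "sh_zero ?E x = \<gamma> x \<zero>\<^bsub>M\<^esub>" for x by (simp add: germ_sheaf_of_def)
  show "sh_smult ?E c (\<gamma> x m) = \<gamma> x (scale R G M c m)"
    if "x \<in> units G" "c \<in> carrier R" "m \<in> carrier M" for x c m
  proof -
    have "\<gamma> x (scale R G M c (rep (\<gamma> x m))) = \<gamma> x (scale R G M c m)"
      using that rep by (intro germ_map_scale_cong) auto
    then show ?thesis using that base by (simp add: germ_sheaf_of_def)
  qed
qed

end

context unitary_groupoid_module
begin

lemma germ_map_germ: "germ_map R G M (germ R G M)"
  by unfold_locales (rule germ_eq_iff)

lemma germ_sheaf_Sh_obj: "germ_sheaf R G M (germ R G M) (Sh_obj R G M)"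
proof -
  interpret germ_map R G M "germ R G M" by (rule germ_map_germ)
  have "Sh_obj R G M = germ_sheaf_of fst (germ_rep R G M)"
    by (simp add: Sh_obj_def germ_sheaf_of_def germ_topology_def germ_basis_def)
  then show ?thesis
    using germ_sheaf_germ_sheaf_of[of fst "germ_rep R G M"] germ_rep_closed germ_germ_rep by simp
qed

text \<open>A germ is encoded by its base point and its canonical representative
  \<open>germ_rep\<close>, a pair in \<open>'g \<times> 'm\<close> rather than a set of pairs. This
  is where the bound \<open>units G \<times> UNIV\<close> in \<open>large_enough\<close> comes
  from.\<close>

lemma germ_sheaf_in_type:
  fixes i :: "'g \<times> 'm \<Rightarrow> 'e"
  assumes i: "inj_on i (units G \<times> UNIV)"
  obtains \<gamma> and E :: "('g, 'k, 'e) gsheaf" where "germ_sheaf R G M \<gamma> E"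
proof -
  define \<gamma> where "\<gamma> x m = i (x, germ_rep R G M (germ R G M x m))" for x m
  have i_eq: "i (x, m) = i (y, n) \<longleftrightarrow> x = y \<and> m = n" if "x \<in> units G" "y \<in> units G" for x y m n
    using inj_onD[OF i, of "(x, m)" "(y, n)"] that by auto
  interpret germ_map R G M \<gamma>
  proof
    fix x y m n assume xy: "x \<in> units G" "y \<in> units G" and m: "m \<in> carrier M" and n: "n \<in> carrier M"
    have "\<gamma> x m = \<gamma> y n \<longleftrightarrow> x = y \<and> germ_rep R G M (germ R G M x m) = germ_rep R G M (germ R G M x n)"
      using i_eq[OF xy] by (auto simp: \<gamma>_def)
    also have "\<dots> \<longleftrightarrow> x = y \<and> germ R G M x m = germ R G M x n"
      using germ_germ_rep[OF xy(1) m] germ_germ_rep[OF xy(1) n] by metis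
    also have "\<dots> \<longleftrightarrow> x = y \<and> (\<exists>W\<in>nbhds_co G x. cut W m = cut W n)"
      using germ_eq_iff[OF xy(1) m n] by auto
    finally show "\<gamma> x m = \<gamma> y n \<longleftrightarrow> x = y \<and> (\<exists>W\<in>nbhds_co G x. cut W m = cut W n)" .
  qed
  let ?d = "inv_into (units G \<times> UNIV) i"
  have d: "?d (\<gamma> x m) = (x, germ_rep R G M (germ R G M x m))" if "x \<in> units G" for x m
    using that by (simp add: \<gamma>_def inv_into_f_f[OF i])
  have "germ_sheaf R G M \<gamma> (germ_sheaf_of (fst \<circ> ?d) (snd \<circ> ?d))"
    using germ_rep_closed germ_germ_rep by (intro germ_sheaf_germ_sheaf_of) (simp_all add: d, simp add: \<gamma>_def)
  then show ?thesis by (rule that)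
qed

end

section \<open>Transport of modules\<close>

text \<open>An isomorphism comes with some inverse homomorphism; injectivity forces
  \<open>inv_into\<close> to agree with it on the target, which gives a named inverse.\<close>

lemma right_module_iso_inv:
  assumes "right_module_iso A M N f"
  shows "right_module_iso A N M (\<lambda>n\<in>carrier N. inv_into (carrier M) f n)"
    and "m \<in> carrier M \<Longrightarrow> inv_into (carrier M) f (f m) = m"
    and "n \<in> carrier N \<Longrightarrow> f (inv_into (carrier M) f n) = n"
    and "n \<in> carrier N \<Longrightarrow> inv_into (carrier M) f n \<in> carrier M"
proof -
  obtain g where f: "f \<in> right_module_hom A M N" and g: "g \<in> right_module_hom A N M"
    and gf: "\<And>m. m \<in> carrier M \<Longrightarrow> g (f m) = m" and fg: "\<And>n. n \<in> carrier N \<Longrightarrow> f (g n) = n"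
    using assms by (auto simp: right_module_iso_def)
  have inj: "inj_on f (carrier M)" by (rule inj_on_inverseI[of _ g]) (rule gf)
  have eq: "inv_into (carrier M) f n = g n" if "n \<in> carrier N" for n
    using inv_into_f_eq[OF inj right_module_hom_closed[OF g that] fg[OF that]] .
  then have "(\<lambda>n\<in>carrier N. inv_into (carrier M) f n) = g"
    by (intro extensionalityI[OF _ right_module_hom_extensional[OF g]]) auto
  then show "right_module_iso A N M (\<lambda>n\<in>carrier N. inv_into (carrier M) f n)"
    using f g gf fg by (auto simp: right_module_iso_def)
  show "inv_into (carrier M) f (f m) = m" if "m \<in> carrier M" using inj that by simp
  show "f (inv_into (carrier M) f n) = n" if "n \<in> carrier N" using eq fg that by simp
  show "inv_into (carrier M) f n \<in> carrier M" if "n \<in> carrier N"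
    using eq right_module_hom_closed[OF g] that by simp
qed

lemma unitary_module_in_type:
  fixes M :: "('r, 'm) module" and j :: "'m \<Rightarrow> 'n"
  assumes M: "unitary_module A M" and j: "inj_on j (carrier M)"
  obtains N :: "('r, 'n) module" where "unitary_module A N" "right_module_iso A M N (restrict j (carrier M))"
proof -
  interpret M: right_module A M using M by (simp add: unitary_module_def)
  let ?i = "inv_into (carrier M) j"
  define N :: "('r, 'n) module" where
    "N = \<lparr>carrier = j ` carrier M, mult = (\<lambda>_ _. undefined), one = undefined, zero = j \<zero>\<^bsub>M\<^esub>,
      add = (\<lambda>a b. j (?i a \<oplus>\<^bsub>M\<^esub> ?i b)), smult = (\<lambda>r a. j (r \<odot>\<^bsub>M\<^esub> ?i a))\<rparr>"
  have N: "carrier N = j ` carrier M" "\<zero>\<^bsub>N\<^esub> = j \<zero>\<^bsub>M\<^esub>" by (simp_all add: N_def)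
  have add: "j m \<oplus>\<^bsub>N\<^esub> j n = j (m \<oplus>\<^bsub>M\<^esub> n)" if "m \<in> carrier M" "n \<in> carrier M" for m n
    using that j by (simp add: N_def)
  have act: "r \<odot>\<^bsub>N\<^esub> j m = j (r \<odot>\<^bsub>M\<^esub> m)" if "m \<in> carrier M" for r m
    using that j by (simp add: N_def)
  have ab: "abelian_group N"
  proof (rule abelian_groupI)
    fix a assume "a \<in> carrier N"
    then obtain m where m: "m \<in> carrier M" "a = j m" by (auto simp: N)
    have "j (\<ominus>\<^bsub>M\<^esub> m) \<oplus>\<^bsub>N\<^esub> a = \<zero>\<^bsub>N\<^esub>" using m by (simp add: add N M.l_neg)
    then show "\<exists>b\<in>carrier N. b \<oplus>\<^bsub>N\<^esub> a = \<zero>\<^bsub>N\<^esub>"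
      using m by (intro bexI[of _ "j (\<ominus>\<^bsub>M\<^esub> m)"]) (auto simp: N)
  qed (auto simp: N add M.a_ac)
  interpret Nab: abelian_group N by (rule ab)
  have rm: "right_module A N"
    by unfold_locales (auto simp: N(1) add act M.action_closed M.action_add_right M.action_add_left M.action_mult)
  have hom: "restrict j (carrier M) \<in> right_module_hom A M N"
    by (auto simp: right_module_hom_def N(1) add act M.action_closed)
  have iso: "right_module_iso A M N (restrict j (carrier M))"
    by (rule right_module_isoI[OF hom _ M.right_module_axioms])
      (use j in \<open>simp add: bij_betw_def inj_on_restrict_eq image_restrict_eq N(1)\<close>)
  \<comment> \<open>Generation of additive subgroups commutes with images under group homomorphisms,
    so unitarity is carried along \<open>j\<close>.\<close>
  interpret gh: group_hom "add_monoid M" "add_monoid N" j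
    by unfold_locales (auto simp: hom_def N(1) add)
  let ?S = "{a \<odot>\<^bsub>M\<^esub> m |a m. a \<in> carrier A \<and> m \<in> carrier M}"
  have "?S \<subseteq> carrier (add_monoid M)" by (auto simp: M.action_closed)
  then have "generate (add_monoid N) (j ` ?S) = j ` generate (add_monoid M) ?S"
    using gh.generate_img by simp
  also have "\<dots> = carrier N" using M by (simp add: unitary_module_def N(1))
  also have "j ` ?S = {a \<odot>\<^bsub>N\<^esub> n |a n. a \<in> carrier A \<and> n \<in> carrier N}"
    by (force simp: N(1) act image_iff)
  finally have "unitary_module A N" using rm by (simp add: unitary_module_def)
  with iso that show ?thesis by blast
qed

section \<open>Equivalence of the two categories\<close>

text \<open>An equivalence presented by a relation instead of a functor: \<open>t \<in> T\<close> matches the object \<open>l t\<close> of \<open>C\<close>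
  with the object \<open>r t\<close> of \<open>D\<close>, and \<open>Q t u\<close> is the graph of a bijection between the corresponding sets
  of morphisms. It is used with \<open>t = (M, E, \<beta>)\<close> for an isomorphism \<open>\<beta>\<close> from \<open>M\<close> to \<open>\<Gamma>\<^sub>c E\<close>.\<close>

locale category_correspondence =
  fixes C :: "('o, 'a) category" and D :: "('p, 'b) category"
    and T :: "'t set" and l :: "'t \<Rightarrow> 'o" and r :: "'t \<Rightarrow> 'p"
    and Q :: "'t \<Rightarrow> 't \<Rightarrow> 'a \<Rightarrow> 'b \<Rightarrow> bool"
  assumes category_C: "is_category C" and category_D: "is_category D"
    and l_obj: "t \<in> T \<Longrightarrow> l t \<in> Obj C" and r_obj: "t \<in> T \<Longrightarrow> r t \<in> Obj D"
    and l_surj: "a \<in> Obj C \<Longrightarrow> \<exists>t\<in>T. l t = a" and r_surj: "d \<in> Obj D \<Longrightarrow> \<exists>t\<in>T. r t = d"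
    and Q_right: "\<lbrakk>t \<in> T; u \<in> T; f \<in> Hom C (l t) (l u)\<rbrakk> \<Longrightarrow> \<exists>!\<phi>. \<phi> \<in> Hom D (r t) (r u) \<and> Q t u f \<phi>"
    and Q_left: "\<lbrakk>t \<in> T; u \<in> T; \<phi> \<in> Hom D (r t) (r u)\<rbrakk> \<Longrightarrow> \<exists>!f. f \<in> Hom C (l t) (l u) \<and> Q t u f \<phi>"
    and Q_id: "t \<in> T \<Longrightarrow> Q t t (Idn C (l t)) (Idn D (r t))"
    and Q_comp: "\<lbrakk>t \<in> T; u \<in> T; v \<in> T; f \<in> Hom C (l t) (l u); g \<in> Hom C (l u) (l v);
      \<phi> \<in> Hom D (r t) (r u); \<psi> \<in> Hom D (r u) (r v); Q t u f \<phi>; Q u v g \<psi>\<rbrakk> \<Longrightarrow>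
      Q t v (Cmp C (l t) (l u) (l v) g f) (Cmp D (r t) (r u) (r v) \<psi> \<phi>)"
begin

text \<open>The conditions are symmetric in the two categories, so whatever is built from left to
  right is also available from right to left.\<close>

lemma swap: "category_correspondence D C T r l (\<lambda>t u \<phi> f. Q t u f \<phi>)"
  using category_C category_D l_obj r_obj l_surj r_surj Q_right Q_left Q_id Q_comp
  by unfold_locales simp_all

definition to_right :: "'t \<Rightarrow> 't \<Rightarrow> 'a \<Rightarrow> 'b" where
  "to_right t u f = (THE \<phi>. \<phi> \<in> Hom D (r t) (r u) \<and> Q t u f \<phi>)"

lemma to_right:
  assumes "t \<in> T" "u \<in> T" "f \<in> Hom C (l t) (l u)"
  shows to_right_Hom: "to_right t u f \<in> Hom D (r t) (r u)" and to_right_Q: "Q t u f (to_right t u f)"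
  using theI'[OF Q_right[OF assms]] by (simp_all add: to_right_def)

lemma to_right_eqI:
  "t \<in> T \<Longrightarrow> u \<in> T \<Longrightarrow> f \<in> Hom C (l t) (l u) \<Longrightarrow> \<phi> \<in> Hom D (r t) (r u) \<Longrightarrow> Q t u f \<phi> \<Longrightarrow> to_right t u f = \<phi>"
  using Q_right[of t u f] to_right[of t u f] by blast

definition right_functor :: "('o \<Rightarrow> 't) \<Rightarrow> ('o, 'a, 'p, 'b) cfunctor" where
  "right_functor \<tau> = \<lparr>on_obj = (\<lambda>a. r (\<tau> a)), on_arr = (\<lambda>a b. to_right (\<tau> a) (\<tau> b))\<rparr>"

lemma comp_closed_C: "\<lbrakk>a \<in> Obj C; b \<in> Obj C; c \<in> Obj C; f \<in> Hom C a b; g \<in> Hom C b c\<rbrakk> \<Longrightarrow> Cmp C a b c g f \<in> Hom C a c"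
  using category_C unfolding is_category_def by blast

lemma comp_closed_D: "\<lbrakk>a \<in> Obj D; b \<in> Obj D; c \<in> Obj D; f \<in> Hom D a b; g \<in> Hom D b c\<rbrakk> \<Longrightarrow> Cmp D a b c g f \<in> Hom D a c"
  using category_D unfolding is_category_def by blast

lemma id_C: "a \<in> Obj C \<Longrightarrow> Idn C a \<in> Hom C a a"
  using category_C unfolding is_category_def by blast

lemma id_D: "a \<in> Obj D \<Longrightarrow> Idn D a \<in> Hom D a a"
  using category_D unfolding is_category_def by blast

lemma comp_id_D: "\<lbrakk>a \<in> Obj D; b \<in> Obj D; f \<in> Hom D a b\<rbrakk> \<Longrightarrow> Cmp D a a b f (Idn D a) = f \<and> Cmp D a b b (Idn D b) f = f"
  using category_D unfolding is_category_def by blast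

lemma right_functor:
  assumes \<tau>: "\<And>a. a \<in> Obj C \<Longrightarrow> \<tau> a \<in> T \<and> l (\<tau> a) = a"
  shows "is_functor C D (right_functor \<tau>)"
  unfolding is_functor_def
proof (intro conjI ballI category_C category_D)
  fix a assume a: "a \<in> Obj C"
  show "on_obj (right_functor \<tau>) a \<in> Obj D"
    using \<tau>[OF a] r_obj by (simp add: right_functor_def)
  show "on_arr (right_functor \<tau>) a a (Idn C a) = Idn D (on_obj (right_functor \<tau>) a)"
    using \<tau>[OF a] id_C[OF a] id_D[of "r (\<tau> a)"] r_obj[of "\<tau> a"] Q_id[of "\<tau> a"]
    by (auto simp: right_functor_def intro: to_right_eqI)
  fix b assume b: "b \<in> Obj C"
  { fix f assume f: "f \<in> Hom C a b"
    show "on_arr (right_functor \<tau>) a b f \<in> Hom D (on_obj (right_functor \<tau>) a) (on_obj (right_functor \<tau>) b)"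
      using \<tau>[OF a] \<tau>[OF b] f to_right_Hom by (simp add: right_functor_def) }
  fix c f g assume c: "c \<in> Obj C" and f: "f \<in> Hom C a b" and g: "g \<in> Hom C b c"
  note \<tau>' = \<tau>[OF a] \<tau>[OF b] \<tau>[OF c]
  note fr = to_right[of "\<tau> a" "\<tau> b" f] and gr = to_right[of "\<tau> b" "\<tau> c" g]
  have "to_right (\<tau> a) (\<tau> c) (Cmp C a b c g f) =
      Cmp D (r (\<tau> a)) (r (\<tau> b)) (r (\<tau> c)) (to_right (\<tau> b) (\<tau> c) g) (to_right (\<tau> a) (\<tau> b) f)"
  proof (rule to_right_eqI)
    show "Cmp C a b c g f \<in> Hom C (l (\<tau> a)) (l (\<tau> c))" using \<tau>' comp_closed_C[OF a b c f g] by simp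
    show "Cmp D (r (\<tau> a)) (r (\<tau> b)) (r (\<tau> c)) (to_right (\<tau> b) (\<tau> c) g) (to_right (\<tau> a) (\<tau> b) f) \<in> Hom D (r (\<tau> a)) (r (\<tau> c))"
      using \<tau>' f g fr gr r_obj by (intro comp_closed_D) simp_all
    show "Q (\<tau> a) (\<tau> c) (Cmp C a b c g f)
        (Cmp D (r (\<tau> a)) (r (\<tau> b)) (r (\<tau> c)) (to_right (\<tau> b) (\<tau> c) g) (to_right (\<tau> a) (\<tau> b) f))"
      using Q_comp[of "\<tau> a" "\<tau> b" "\<tau> c" f g "to_right (\<tau> a) (\<tau> b) f" "to_right (\<tau> b) (\<tau> c) g"] \<tau>' f g fr gr
      by simp
  qed (use \<tau>' in auto)
  then show "on_arr (right_functor \<tau>) a c (Cmp C a b c g f) =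
      Cmp D (on_obj (right_functor \<tau>) a) (on_obj (right_functor \<tau>) b) (on_obj (right_functor \<tau>) c)
        (on_arr (right_functor \<tau>) b c g) (on_arr (right_functor \<tau>) a b f)"
    by (simp add: right_functor_def)
qed

end

locale category_correspondence_choice = category_correspondence C D T l r Q
  for C :: "('o, 'a) category" and D :: "('p, 'b) category"
    and T :: "'t set" and l :: "'t \<Rightarrow> 'o" and r :: "'t \<Rightarrow> 'p"
    and Q :: "'t \<Rightarrow> 't \<Rightarrow> 'a \<Rightarrow> 'b \<Rightarrow> bool" +
  fixes \<tau> :: "'o \<Rightarrow> 't" and \<upsilon> :: "'p \<Rightarrow> 't"
  assumes \<tau>: "a \<in> Obj C \<Longrightarrow> \<tau> a \<in> T \<and> l (\<tau> a) = a"
    and \<upsilon>: "d \<in> Obj D \<Longrightarrow> \<upsilon> d \<in> T \<and> r (\<upsilon> d) = d"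
begin

sublocale sw: category_correspondence D C T r l "\<lambda>t u \<phi> f. Q t u f \<phi>"
  by (rule swap)

lemma comp_left_eqI:
  assumes "t \<in> T" "u \<in> T" "f \<in> Hom C (l t) (l u)" "f' \<in> Hom C (l t) (l u)" "\<phi> \<in> Hom D (r t) (r u)"
    and "Q t u f \<phi>" "Q t u f' \<phi>"
  shows "f = f'"
  using Q_left[of t u \<phi>] assms by blast

text \<open>\<open>u a\<close> and \<open>\<tau> a\<close> have the same right-hand object
  \<open>F a\<close>, so the identity of \<open>F a\<close> is matched with arrows in both
  directions between \<open>l (u a)\<close> and \<open>a\<close>. Every required equation in
  \<open>C\<close> holds because its two sides are matched with the same morphism of
  \<open>D\<close>.\<close>

lemma unit_isomorphism:
  "naturally_isomorphic C C (comp_functor (sw.right_functor \<upsilon>) (right_functor \<tau>)) id_functor"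
proof -
  define F where "F a = r (\<tau> a)" for a
  define u where "u a = \<upsilon> (F a)" for a
  define \<eta> where "\<eta> a = sw.to_right (u a) (\<tau> a) (Idn D (F a))" for a
  define \<eta>' where "\<eta>' a = sw.to_right (\<tau> a) (u a) (Idn D (F a))" for a
  have F: "F a \<in> Obj D" if "a \<in> Obj C" for a using that \<tau> r_obj by (simp add: F_def)
  have u: "u a \<in> T" "r (u a) = F a" "l (u a) \<in> Obj C" if "a \<in> Obj C" for a
    using \<upsilon>[OF F[OF that]] l_obj by (auto simp: u_def)
  have t: "\<tau> a \<in> T" "r (\<tau> a) = F a" "l (\<tau> a) = a" if "a \<in> Obj C" for a
    using \<tau>[OF that] by (auto simp: F_def)
  have \<eta>: "\<eta> a \<in> Hom C (l (u a)) a" "Q (u a) (\<tau> a) (\<eta> a) (Idn D (F a))" if a: "a \<in> Obj C" for a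
    using sw.to_right[of "u a" "\<tau> a" "Idn D (F a)"] id_D[OF F[OF a]] u[OF a] t[OF a] by (auto simp: \<eta>_def)
  have \<eta>': "\<eta>' a \<in> Hom C a (l (u a))" "Q (\<tau> a) (u a) (\<eta>' a) (Idn D (F a))" if a: "a \<in> Obj C" for a
    using sw.to_right[of "\<tau> a" "u a" "Idn D (F a)"] id_D[OF F[OF a]] u[OF a] t[OF a] by (auto simp: \<eta>'_def)
  have "is_iso C (l (u a)) a (\<eta> a)" if a: "a \<in> Obj C" for a
    unfolding is_iso_def
  proof (intro conjI bexI[of _ "\<eta>' a"] \<eta>(1)[OF a] \<eta>'(1)[OF a])
    have i: "Cmp D (F a) (F a) (F a) (Idn D (F a)) (Idn D (F a)) = Idn D (F a)"
      using comp_id_D[OF F[OF a] F[OF a] id_D[OF F[OF a]]] by simp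
    note ut = u[OF a] t[OF a] id_D[OF F[OF a]]
    show "Cmp C (l (u a)) a (l (u a)) (\<eta>' a) (\<eta> a) = Idn C (l (u a))"
    proof (rule comp_left_eqI[OF ut(1) ut(1)])
      show "Cmp C (l (u a)) a (l (u a)) (\<eta>' a) (\<eta> a) \<in> Hom C (l (u a)) (l (u a))"
        using a ut \<eta>[OF a] \<eta>'[OF a] by (intro comp_closed_C)
      show "Idn C (l (u a)) \<in> Hom C (l (u a)) (l (u a))" using ut by (intro id_C)
      show "Idn D (F a) \<in> Hom D (r (u a)) (r (u a))" using ut by simp
      show "Q (u a) (u a) (Cmp C (l (u a)) a (l (u a)) (\<eta>' a) (\<eta> a)) (Idn D (F a))"
        using Q_comp[of "u a" "\<tau> a" "u a" "\<eta> a" "\<eta>' a" "Idn D (F a)" "Idn D (F a)"] ut \<eta>[OF a] \<eta>'[OF a] i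
        by simp
      show "Q (u a) (u a) (Idn C (l (u a))) (Idn D (F a))" using Q_id[of "u a"] ut by simp
    qed
    show "Cmp C a (l (u a)) a (\<eta> a) (\<eta>' a) = Idn C a"
    proof (rule comp_left_eqI[OF ut(4) ut(4)])
      show "Cmp C a (l (u a)) a (\<eta> a) (\<eta>' a) \<in> Hom C (l (\<tau> a)) (l (\<tau> a))"
        using a ut \<eta>[OF a] \<eta>'[OF a] comp_closed_C[of a "l (u a)" a "\<eta>' a" "\<eta> a"] by simp
      show "Idn C a \<in> Hom C (l (\<tau> a)) (l (\<tau> a))" using ut id_C[OF a] by simp
      show "Idn D (F a) \<in> Hom D (r (\<tau> a)) (r (\<tau> a))" using ut by simp
      show "Q (\<tau> a) (\<tau> a) (Cmp C a (l (u a)) a (\<eta> a) (\<eta>' a)) (Idn D (F a))"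
        using Q_comp[of "\<tau> a" "u a" "\<tau> a" "\<eta>' a" "\<eta> a" "Idn D (F a)" "Idn D (F a)"] ut \<eta>[OF a] \<eta>'[OF a] i
        by simp
      show "Q (\<tau> a) (\<tau> a) (Idn C a) (Idn D (F a))" using Q_id[of "\<tau> a"] ut by simp
    qed
  qed
  moreover have "Cmp C (l (u a)) a b f (\<eta> a) =
      Cmp C (l (u a)) (l (u b)) b (\<eta> b) (sw.to_right (u a) (u b) (to_right (\<tau> a) (\<tau> b) f))"
    if a: "a \<in> Obj C" and b: "b \<in> Obj C" and f: "f \<in> Hom C a b" for a b f
  proof -
    note A = u[OF a] t[OF a] id_D[OF F[OF a]] F[OF a] and B = u[OF b] t[OF b] id_D[OF F[OF b]] F[OF b]
    let ?\<phi> = "to_right (\<tau> a) (\<tau> b) f"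
    let ?f = "sw.to_right (u a) (u b) ?\<phi>"
    have \<phi>: "?\<phi> \<in> Hom D (F a) (F b)" "Q (\<tau> a) (\<tau> b) f ?\<phi>"
      using to_right[of "\<tau> a" "\<tau> b" f] A B f by simp_all
    have f': "?f \<in> Hom C (l (u a)) (l (u b))" "Q (u a) (u b) ?f ?\<phi>"
      using sw.to_right[of "u a" "u b" ?\<phi>] A B \<phi> by simp_all
    note i = comp_id_D[OF F[OF a] F[OF b] \<phi>(1)]
    show ?thesis
    proof (rule comp_left_eqI[OF A(1) B(4)])
      show "Cmp C (l (u a)) a b f (\<eta> a) \<in> Hom C (l (u a)) (l (\<tau> b))"
        using comp_closed_C[of "l (u a)" a b "\<eta> a" f] a b A B f \<eta>[OF a] by simp
      show "Cmp C (l (u a)) (l (u b)) b (\<eta> b) ?f \<in> Hom C (l (u a)) (l (\<tau> b))"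
        using comp_closed_C[of "l (u a)" "l (u b)" b ?f "\<eta> b"] b A B f' \<eta>[OF b] by simp
      show "?\<phi> \<in> Hom D (r (u a)) (r (\<tau> b))" using \<phi> A B by simp
      show "Q (u a) (\<tau> b) (Cmp C (l (u a)) a b f (\<eta> a)) ?\<phi>"
        using Q_comp[of "u a" "\<tau> a" "\<tau> b" "\<eta> a" f "Idn D (F a)" ?\<phi>] A B f \<eta>[OF a] \<phi> i by simp
      show "Q (u a) (\<tau> b) (Cmp C (l (u a)) (l (u b)) b (\<eta> b) ?f) ?\<phi>"
        using Q_comp[of "u a" "u b" "\<tau> b" ?f "\<eta> b" ?\<phi> "Idn D (F b)"] A B f' \<eta>[OF b] \<phi> i by simp
    qed
  qed
  ultimately show ?thesis
    unfolding naturally_isomorphic_def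
    by (intro exI[of _ \<eta>])
      (simp add: comp_functor_def id_functor_def right_functor_def sw.right_functor_def u_def F_def)
qed

end

lemma (in category_correspondence) equivalent: "equivalent_categories C D"
proof -
  obtain \<tau> where \<tau>: "\<And>a. a \<in> Obj C \<Longrightarrow> \<tau> a \<in> T \<and> l (\<tau> a) = a" using l_surj by metis
  obtain \<upsilon> where \<upsilon>: "\<And>d. d \<in> Obj D \<Longrightarrow> \<upsilon> d \<in> T \<and> r (\<upsilon> d) = d" using r_surj by metis
  interpret sw: category_correspondence D C T r l "\<lambda>t u \<phi> f. Q t u f \<phi>" by (rule swap)
  interpret A: category_correspondence_choice C D T l r Q \<tau> \<upsilon>
    by unfold_locales (use \<tau> \<upsilon> in auto)
  interpret B: category_correspondence_choice D C T r l "\<lambda>t u \<phi> f. Q t u f \<phi>" \<upsilon> \<tau>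
    by unfold_locales (use \<tau> \<upsilon> in auto)
  show ?thesis
    unfolding equivalent_categories_def
    using right_functor[OF \<tau>] sw.right_functor[OF \<upsilon>] A.unit_isomorphism B.unit_isomorphism by blast
qed

section \<open>The module and sheaf categories, and the section functor\<close>

context ample_groupoid_over_ring
begin

lemma is_category_right_module_cat: "is_category (right_module_cat R G)"
  unfolding is_category_def right_module_cat_def category.simps
proof (intro conjI ballI)
  let ?A = "groupoid_algebra R G"
  fix M assume "M \<in> {M. unitary_module ?A M}"
  then have M: "right_module ?A M" by (simp add: unitary_module_def)
  show "(\<lambda>m\<in>carrier M. m) \<in> right_module_hom ?A M M" by (rule identity_right_module_hom[OF M])
  fix N assume "N \<in> {M. unitary_module ?A M}"
  then have N: "right_module ?A N" by (simp add: unitary_module_def)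
  { fix f assume f: "f \<in> right_module_hom ?A M N"
    show "compose (carrier M) f (\<lambda>m\<in>carrier M. m) = f"
      by (rule extensionalityI[OF _ right_module_hom_extensional[OF f]]) (auto simp: compose_def)
    show "compose (carrier M) (\<lambda>m\<in>carrier N. m) f = f"
      by (rule extensionalityI[OF _ right_module_hom_extensional[OF f]])
        (use right_module_hom_closed[OF f] in \<open>auto simp: compose_def\<close>) }
  fix P assume "P \<in> {M. unitary_module ?A M}"
  { fix f g assume f: "f \<in> right_module_hom ?A M N" and g: "g \<in> right_module_hom ?A N P"
    show "compose (carrier M) g f \<in> right_module_hom ?A M P" by (rule compose_right_module_hom[OF f g M]) }
  fix K f g h assume f: "f \<in> right_module_hom ?A M N" and g: "g \<in> right_module_hom ?A N P"
    and h: "h \<in> right_module_hom ?A P K"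
  show "compose (carrier M) h (compose (carrier M) g f) = compose (carrier M) (compose (carrier N) h g) f"
    using right_module_hom_closed[OF f] by (auto simp: compose_def fun_eq_iff)
qed

lemma is_category_sheaf_cat: "is_category (sheaf_cat R G)"
  unfolding is_category_def sheaf_cat_def category.simps
proof (intro conjI ballI)
  fix E assume "E \<in> {E. gsheaf_of_modules R G E}"
  then have E: "gsheaf_of_modules R G E" by simp
  show "(\<lambda>e\<in>topspace (sh_top E). e) \<in> sheaf_hom R G E E" by (rule identity_sheaf_hom[OF E])
  fix F assume "F \<in> {E. gsheaf_of_modules R G E}"
  { fix f assume f: "f \<in> sheaf_hom R G E F"
    show "compose (topspace (sh_top E)) f (\<lambda>e\<in>topspace (sh_top E). e) = f"
      by (rule extensionalityI[OF _ sheaf_hom_extensional[OF f]]) (auto simp: compose_def)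
    show "compose (topspace (sh_top E)) (\<lambda>e\<in>topspace (sh_top F). e) f = f"
      by (rule extensionalityI[OF _ sheaf_hom_extensional[OF f]])
        (use sheaf_hom_closed[OF f] in \<open>auto simp: compose_def\<close>) }
  fix H assume "H \<in> {E. gsheaf_of_modules R G E}"
  { fix f g assume f: "f \<in> sheaf_hom R G E F" and g: "g \<in> sheaf_hom R G F H"
    show "compose (topspace (sh_top E)) g f \<in> sheaf_hom R G E H" by (rule compose_sheaf_hom[OF E f g]) }
  fix K f g h assume f: "f \<in> sheaf_hom R G E F" and g: "g \<in> sheaf_hom R G F H" and h: "h \<in> sheaf_hom R G H K"
  show "compose (topspace (sh_top E)) h (compose (topspace (sh_top E)) g f) =
      compose (topspace (sh_top E)) (compose (topspace (sh_top F)) h g) f"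
    using sheaf_hom_closed[OF f] by (auto simp: compose_def fun_eq_iff)
qed

lemma groupoid_sheafI: "gsheaf_of_modules R G E \<Longrightarrow> groupoid_sheaf R G E"
  by (intro groupoid_sheaf.intro ample_groupoid_over_ring_axioms)

lemma groupoid_sheaf_pairI: "gsheaf_of_modules R G E \<Longrightarrow> gsheaf_of_modules R G F \<Longrightarrow> groupoid_sheaf_pair R G E F"
  by (intro groupoid_sheaf_pair.intro groupoid_sheafI ample_groupoid_over_ring_axioms)

lemma unitary_groupoid_moduleI: "unitary_module (groupoid_algebra R G) M \<Longrightarrow> unitary_groupoid_module R G M"
  by (intro unitary_groupoid_module.intro ample_groupoid_over_ring_axioms unitary_groupoid_module_axioms.intro)

lemma is_functor_Gamma_c:
  "is_functor (sheaf_cat R G :: (('g, 'k, 'e) gsheaf, 'e \<Rightarrow> 'e) category) (right_module_cat R G) (Gamma_c R G)"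
  unfolding is_functor_def
proof (intro conjI ballI is_category_sheaf_cat is_category_right_module_cat)
  fix E F H :: "('g, 'k, 'e) gsheaf"
  assume "E \<in> Obj (sheaf_cat R G)"
  then have E: "gsheaf_of_modules R G E" by (simp add: sheaf_cat_def)
  interpret E: groupoid_sheaf R G E by (rule groupoid_sheafI[OF E])
  show "on_obj (Gamma_c R G) E \<in> Obj (right_module_cat R G)"
    using E.unitary_module_Gam by (simp add: Gamma_c_def right_module_cat_def)
  have "compose (units G) (\<lambda>e\<in>topspace (sh_top E). e) s = s" if s: "s \<in> sections_c G E" for s
    by (rule extensionalityI[OF _ E.section_extensional[OF s]])
      (use E.section_st[OF s] in \<open>auto simp: compose_def E.st_iff\<close>)
  then show "on_arr (Gamma_c R G) E E (Idn (sheaf_cat R G) E) = Idn (right_module_cat R G) (on_obj (Gamma_c R G) E)"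
    by (auto simp: Gamma_c_def right_module_cat_def sheaf_cat_def intro!: restrict_ext)
  assume "F \<in> Obj (sheaf_cat R G)"
  then have F: "gsheaf_of_modules R G F" by (simp add: sheaf_cat_def)
  interpret EF: groupoid_sheaf_pair R G E F by (rule groupoid_sheaf_pairI[OF E F])
  { fix \<phi> assume "\<phi> \<in> Hom (sheaf_cat R G) E F"
    then show "on_arr (Gamma_c R G) E F \<phi> \<in> Hom (right_module_cat R G) (on_obj (Gamma_c R G) E) (on_obj (Gamma_c R G) F)"
      using EF.Gamma_c_hom by (simp add: Gamma_c_def right_module_cat_def sheaf_cat_def) }
  fix \<phi> \<psi> :: "'e \<Rightarrow> 'e" assume "\<phi> \<in> Hom (sheaf_cat R G) E F"
  then have \<phi>: "\<phi> \<in> sheaf_hom R G E F" by (simp add: sheaf_cat_def)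
  have "compose (units G) (compose (topspace (sh_top E)) \<psi> \<phi>) s = compose (units G) \<psi> (compose (units G) \<phi> s)"
    if s: "s \<in> sections_c G E" for s
    using E.section_st[OF s] by (auto simp: compose_def E.st_iff fun_eq_iff)
  then show "on_arr (Gamma_c R G) E H (Cmp (sheaf_cat R G) E F H \<psi> \<phi>) =
      Cmp (right_module_cat R G) (on_obj (Gamma_c R G) E) (on_obj (Gamma_c R G) F) (on_obj (Gamma_c R G) H)
        (on_arr (Gamma_c R G) F H \<psi>) (on_arr (Gamma_c R G) E F \<phi>)"
    using EF.compose_section[OF \<phi>]
    by (auto simp: Gamma_c_def right_module_cat_def sheaf_cat_def compose_def[of "sections_c G E"] intro!: restrict_ext)
qed

text \<open>Conjugating \<open>f\<close> with the two isomorphisms gives a homomorphism between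
  modules of sections, to which fullness applies. Uniqueness holds because every section has the
  form \<open>\<beta> m\<close>.\<close>

lemma module_hom_to_sheaf_hom:
  assumes M: "unitary_module (groupoid_algebra R G) M" and N: "unitary_module (groupoid_algebra R G) N"
    and E: "gsheaf_of_modules R G E" and F: "gsheaf_of_modules R G F"
    and \<beta>: "right_module_iso (groupoid_algebra R G) M (Gamma_c_obj R G E) \<beta>"
    and \<gamma>: "right_module_iso (groupoid_algebra R G) N (Gamma_c_obj R G F) \<gamma>"
    and f: "f \<in> right_module_hom (groupoid_algebra R G) M N"
  shows "\<exists>!\<phi>. \<phi> \<in> sheaf_hom R G E F \<and> (\<forall>m\<in>carrier M. \<forall>x\<in>units G. \<phi> (\<beta> m x) = \<gamma> (f m) x)"
proof -
  let ?A = "groupoid_algebra R G"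
  interpret EF: groupoid_sheaf_pair R G E F by (rule groupoid_sheaf_pairI[OF E F])
  note \<beta>' = right_module_iso_inv[OF \<beta>]
  define b where "b = (\<lambda>s\<in>carrier EF.E.Gam. inv_into (carrier M) \<beta> s)"
  have b: "b \<in> right_module_hom ?A EF.E.Gam M" using \<beta>'(1) by (simp add: right_module_iso_def b_def)
  have \<gamma>h: "\<gamma> \<in> right_module_hom ?A N EF.F.Gam" using \<gamma> by (simp add: right_module_iso_def)
  have bs: "\<beta> (b s) = s" "b s \<in> carrier M" if "s \<in> sections_c G E" for s
    using \<beta>'(3,4)[of s] that by (simp_all add: b_def)
  have \<beta>m: "\<beta> m \<in> sections_c G E" "b (\<beta> m) = m" if "m \<in> carrier M" for m
  proof -
    show "\<beta> m \<in> sections_c G E"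
      using \<beta> right_module_hom_closed[of \<beta> ?A M EF.E.Gam m] that by (simp add: right_module_iso_def)
    then show "b (\<beta> m) = m" using \<beta>'(2)[OF that] by (simp add: b_def)
  qed
  define \<theta> where "\<theta> = compose (carrier EF.E.Gam) \<gamma> (compose (carrier EF.E.Gam) f b)"
  have \<theta>: "\<theta> \<in> right_module_hom ?A EF.E.Gam EF.F.Gam"
    unfolding \<theta>_def
    by (intro compose_right_module_hom[of _ _ _ N] compose_right_module_hom[of _ _ _ M] b f \<gamma>h EF.E.right_module_Gam)
  have \<theta>s: "\<theta> s = \<gamma> (f (b s))" if "s \<in> sections_c G E" for s
    using that by (simp add: \<theta>_def compose_def)
  obtain \<phi> where \<phi>: "\<phi> \<in> sheaf_hom R G E F" "\<And>s x. s \<in> sections_c G E \<Longrightarrow> x \<in> units G \<Longrightarrow> \<phi> (s x) = \<theta> s x"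
    using EF.sheaf_hom_of_module_hom[OF \<theta>] by metis
  have "\<phi> (\<beta> m x) = \<gamma> (f m) x" if "m \<in> carrier M" "x \<in> units G" for m x
    using \<phi>(2)[OF \<beta>m(1)[OF that(1)] that(2)] \<theta>s[OF \<beta>m(1)[OF that(1)]] \<beta>m(2)[OF that(1)] by simp
  moreover have "\<psi> = \<phi>"
    if \<psi>: "\<psi> \<in> sheaf_hom R G E F" and eq: "\<forall>m\<in>carrier M. \<forall>x\<in>units G. \<psi> (\<beta> m x) = \<gamma> (f m) x" for \<psi>
  proof (rule EF.sheaf_hom_eqI[OF \<psi> \<phi>(1)])
    fix s x assume s: "s \<in> sections_c G E" and x: "x \<in> units G"
    have "\<psi> (\<beta> (b s) x) = \<gamma> (f (b s)) x" using eq bs(2)[OF s] x by blast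
    then show "\<psi> (s x) = \<phi> (s x)" using bs(1)[OF s] \<phi>(2)[OF s x] \<theta>s[OF s] by simp
  qed
  ultimately show ?thesis using \<phi>(1) by blast
qed

text \<open>\<open>f\<close> is \<open>\<beta>\<close>, followed by composition with
  \<open>\<phi>\<close> and the inverse of \<open>\<gamma>\<close>. The condition determines
  \<open>\<gamma> (f m)\<close> at every unit, hence \<open>f m\<close> by injectivity of
  \<open>\<gamma>\<close>.\<close>

lemma sheaf_hom_to_module_hom:
  assumes M: "unitary_module (groupoid_algebra R G) M" and N: "unitary_module (groupoid_algebra R G) N"
    and E: "gsheaf_of_modules R G E" and F: "gsheaf_of_modules R G F"
    and \<beta>: "right_module_iso (groupoid_algebra R G) M (Gamma_c_obj R G E) \<beta>"
    and \<gamma>: "right_module_iso (groupoid_algebra R G) N (Gamma_c_obj R G F) \<gamma>"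
    and \<phi>: "\<phi> \<in> sheaf_hom R G E F"
  shows "\<exists>!f. f \<in> right_module_hom (groupoid_algebra R G) M N \<and> (\<forall>m\<in>carrier M. \<forall>x\<in>units G. \<phi> (\<beta> m x) = \<gamma> (f m) x)"
proof -
  let ?A = "groupoid_algebra R G"
  interpret EF: groupoid_sheaf_pair R G E F by (rule groupoid_sheaf_pairI[OF E F])
  note \<gamma>' = right_module_iso_inv[OF \<gamma>]
  define c where "c = (\<lambda>s\<in>carrier EF.F.Gam. inv_into (carrier N) \<gamma> s)"
  have c: "c \<in> right_module_hom ?A EF.F.Gam N" using \<gamma>'(1) by (simp add: right_module_iso_def c_def)
  have \<beta>h: "\<beta> \<in> right_module_hom ?A M EF.E.Gam" using \<beta> by (simp add: right_module_iso_def)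
  have Mr: "right_module ?A M" using M by (simp add: unitary_module_def)
  define f where "f = compose (carrier M) c (compose (carrier M) (\<lambda>s\<in>sections_c G E. compose (units G) \<phi> s) \<beta>)"
  have f: "f \<in> right_module_hom ?A M N"
    unfolding f_def
    by (intro compose_right_module_hom[of _ _ _ EF.F.Gam] compose_right_module_hom[of _ _ _ EF.E.Gam]
        c \<beta>h EF.Gamma_c_hom[OF \<phi>] Mr)
  have \<beta>m: "\<beta> m \<in> sections_c G E" if "m \<in> carrier M" for m
    using right_module_hom_closed[OF \<beta>h that] by simp
  have fm: "\<gamma> (f m) = compose (units G) \<phi> (\<beta> m)" if "m \<in> carrier M" for m
    using \<gamma>'(3)[of "compose (units G) \<phi> (\<beta> m)"] EF.compose_section[OF \<phi> \<beta>m[OF that]] \<beta>m[OF that] that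
    by (simp add: f_def compose_def[of "carrier M"] c_def)
  have "\<phi> (\<beta> m x) = \<gamma> (f m) x" if "m \<in> carrier M" "x \<in> units G" for m x
    using fm[OF that(1)] that(2) by (simp add: EF.compose_section_apply)
  moreover have "h = f"
    if h: "h \<in> right_module_hom ?A M N" and eq: "\<forall>m\<in>carrier M. \<forall>x\<in>units G. \<phi> (\<beta> m x) = \<gamma> (h m) x" for h
  proof (rule right_module_hom_eqI[OF h f])
    fix m assume m: "m \<in> carrier M"
    have hm: "h m \<in> carrier N" "f m \<in> carrier N" using right_module_hom_closed h f m by metis+
    have \<gamma>c: "\<gamma> n \<in> sections_c G F" if "n \<in> carrier N" for n
      using \<gamma> right_module_hom_closed[of \<gamma> ?A N EF.F.Gam n] that by (simp add: right_module_iso_def)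
    have "\<gamma> (h m) = \<gamma> (f m)"
    proof (rule EF.F.section_ext[OF \<gamma>c[OF hm(1)] \<gamma>c[OF hm(2)]])
      fix x assume x: "x \<in> units G"
      show "\<gamma> (h m) x = \<gamma> (f m) x" using eq m x fm[OF m] by (simp add: EF.compose_section_apply)
    qed
    then show "h m = f m" using \<gamma>'(2)[OF hm(1)] \<gamma>'(2)[OF hm(2)] by metis
  qed
  ultimately show ?thesis using f by blast
qed

section \<open>The functor of germs and the two natural isomorphisms\<close>

definition germ_sec :: "('g \<Rightarrow> 'k, 'm) module \<Rightarrow> 'm \<Rightarrow> 'g \<Rightarrow> ('g, 'm) germ" where
  "germ_sec M = (\<lambda>m\<in>carrier M. \<lambda>x\<in>units G. germ R G M x m)"

lemma gsheaf_Sh_obj: "unitary_module (groupoid_algebra R G) M \<Longrightarrow> gsheaf_of_modules R G (Sh_obj R G M)"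
  using germ_sheaf.gsheaf_of_modules[OF unitary_groupoid_module.germ_sheaf_Sh_obj[OF unitary_groupoid_moduleI]] .

lemma germ_sec_iso:
  assumes M: "unitary_module (groupoid_algebra R G) M"
  shows "right_module_iso (groupoid_algebra R G) M (Gamma_c_obj R G (Sh_obj R G M)) (germ_sec M)"
proof -
  interpret germ_sheaf R G M "germ R G M" "Sh_obj R G M"
    by (rule unitary_groupoid_module.germ_sheaf_Sh_obj[OF unitary_groupoid_moduleI[OF M]])
  have "germ_sec M = restrict germ_section (carrier M)"
    by (simp add: germ_sec_def germ_section_def fun_eq_iff)
  then show ?thesis using germ_section_iso by simp
qed

lemma Sh_pointE:
  assumes M: "unitary_module (groupoid_algebra R G) M" and e: "e \<in> topspace (sh_top (Sh_obj R G M))"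
  shows "fst e \<in> units G" and "germ_rep R G M e \<in> carrier M" and "germ R G M (fst e) (germ_rep R G M e) = e"
proof -
  interpret germ_sheaf R G M "germ R G M" "Sh_obj R G M"
    by (rule unitary_groupoid_module.germ_sheaf_Sh_obj[OF unitary_groupoid_moduleI[OF M]])
  obtain x m where "x \<in> units G" "m \<in> carrier M" "e = germ R G M x m" using e by (rule topspace_germE)
  then show "fst e \<in> units G" "germ_rep R G M e \<in> carrier M" "germ R G M (fst e) (germ_rep R G M e) = e"
    using germ_rep_closed germ_germ_rep by simp_all
qed

text \<open>Full faithfulness provides a sheaf morphism with the right values on sections of germs.
  The explicit formula with representatives agrees with it at every point, so continuity and
  equivariance need no separate check.\<close>

lemma Sh_arr:
  assumes M: "unitary_module (groupoid_algebra R G) M" and N: "unitary_module (groupoid_algebra R G) N"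
    and f: "f \<in> right_module_hom (groupoid_algebra R G) M N"
  shows Sh_arr_hom: "on_arr (Sh R G) M N f \<in> sheaf_hom R G (Sh_obj R G M) (Sh_obj R G N)"
    and Sh_arr_germ: "x \<in> units G \<Longrightarrow> m \<in> carrier M \<Longrightarrow> on_arr (Sh R G) M N f (germ R G M x m) = germ R G N x (f m)"
proof -
  have ex: "\<exists>\<phi>. \<phi> \<in> sheaf_hom R G (Sh_obj R G M) (Sh_obj R G N) \<and>
      (\<forall>m\<in>carrier M. \<forall>x\<in>units G. \<phi> (germ_sec M m x) = germ_sec N (f m) x)"
    using module_hom_to_sheaf_hom[OF M N gsheaf_Sh_obj[OF M] gsheaf_Sh_obj[OF N] germ_sec_iso[OF M] germ_sec_iso[OF N] f]
    by (rule ex1_implies_ex)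
  then obtain \<phi> where \<phi>: "\<phi> \<in> sheaf_hom R G (Sh_obj R G M) (Sh_obj R G N)"
    "\<And>m x. m \<in> carrier M \<Longrightarrow> x \<in> units G \<Longrightarrow> \<phi> (germ_sec M m x) = germ_sec N (f m) x" by blast
  have fm: "f m \<in> carrier N" if "m \<in> carrier M" for m using right_module_hom_closed[OF f that] .
  have g: "\<phi> (germ R G M x m) = germ R G N x (f m)" if "x \<in> units G" "m \<in> carrier M" for x m
    using \<phi>(2)[OF that(2,1)] that fm by (simp add: germ_sec_def)
  have "on_arr (Sh R G) M N f = \<phi>"
  proof (rule extensionalityI[OF _ sheaf_hom_extensional[OF \<phi>(1)]])
    show "on_arr (Sh R G) M N f \<in> extensional (topspace (sh_top (Sh_obj R G M)))" by (simp add: Sh_def)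
    fix e assume e: "e \<in> topspace (sh_top (Sh_obj R G M))"
    then show "on_arr (Sh R G) M N f e = \<phi> e"
      using g[OF Sh_pointE(1,2)[OF M e]] Sh_pointE(3)[OF M e] by (simp add: Sh_def)
  qed
  then show "on_arr (Sh R G) M N f \<in> sheaf_hom R G (Sh_obj R G M) (Sh_obj R G N)"
    "x \<in> units G \<Longrightarrow> m \<in> carrier M \<Longrightarrow> on_arr (Sh R G) M N f (germ R G M x m) = germ R G N x (f m)"
    using \<phi>(1) g by simp_all
qed

lemma is_functor_Sh:
  "is_functor (right_module_cat R G :: (('g \<Rightarrow> 'k, 'm) module, 'm \<Rightarrow> 'm) category) (sheaf_cat R G) (Sh R G)"
  unfolding is_functor_def
proof (intro conjI ballI is_category_sheaf_cat is_category_right_module_cat)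
  let ?A = "groupoid_algebra R G"
  fix M N P :: "('g \<Rightarrow> 'k, 'm) module"
  assume "M \<in> Obj (right_module_cat R G)"
  then have M: "unitary_module ?A M" by (simp add: right_module_cat_def)
  show "on_obj (Sh R G) M \<in> Obj (sheaf_cat R G)"
    using gsheaf_Sh_obj[OF M] by (simp add: Sh_def sheaf_cat_def)
  show "on_arr (Sh R G) M M (Idn (right_module_cat R G) M) = Idn (sheaf_cat R G) (on_obj (Sh R G) M)"
    using Sh_pointE[OF M] by (auto simp: Sh_def right_module_cat_def sheaf_cat_def intro!: restrict_ext)
  assume "N \<in> Obj (right_module_cat R G)"
  then have N: "unitary_module ?A N" by (simp add: right_module_cat_def)
  { fix f assume "f \<in> Hom (right_module_cat R G) M N"
    then have f: "f \<in> right_module_hom ?A M N" by (simp add: right_module_cat_def)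
    show "on_arr (Sh R G) M N f \<in> Hom (sheaf_cat R G) (on_obj (Sh R G) M) (on_obj (Sh R G) N)"
      using Sh_arr_hom[OF M N f] by (simp add: Sh_def sheaf_cat_def) }
  fix f g assume "P \<in> Obj (right_module_cat R G)" "f \<in> Hom (right_module_cat R G) M N"
    "g \<in> Hom (right_module_cat R G) N P"
  then have P: "unitary_module ?A P" and f: "f \<in> right_module_hom ?A M N" and g: "g \<in> right_module_hom ?A N P"
    by (simp_all add: right_module_cat_def)
  have gf: "compose (carrier M) g f \<in> right_module_hom ?A M P"
    using M by (intro compose_right_module_hom[OF f g]) (simp add: unitary_module_def)
  let ?T = "topspace (sh_top (Sh_obj R G M))"
  have "on_arr (Sh R G) M P (compose (carrier M) g f) = compose ?T (on_arr (Sh R G) N P g) (on_arr (Sh R G) M N f)"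
  proof (rule extensionalityI[OF sheaf_hom_extensional[OF Sh_arr_hom[OF M P gf]]])
    show "compose ?T (on_arr (Sh R G) N P g) (on_arr (Sh R G) M N f) \<in> extensional ?T" by simp
    fix e assume e: "e \<in> ?T"
    define x m where "x = fst e" and "m = germ_rep R G M e"
    have xm: "x \<in> units G" "m \<in> carrier M" "e = germ R G M x m" using Sh_pointE[OF M e] by (simp_all add: x_def m_def)
    have fm: "f m \<in> carrier N" using right_module_hom_closed[OF f xm(2)] .
    have "on_arr (Sh R G) M P (compose (carrier M) g f) e = germ R G P x (g (f m))"
      using xm Sh_arr_germ[OF M P gf xm(1,2)] by (simp add: compose_def)
    also have "\<dots> = on_arr (Sh R G) N P g (on_arr (Sh R G) M N f e)"
      using xm fm Sh_arr_germ[OF M N f xm(1,2)] Sh_arr_germ[OF N P g xm(1) fm] by simp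
    finally show "on_arr (Sh R G) M P (compose (carrier M) g f) e =
        compose ?T (on_arr (Sh R G) N P g) (on_arr (Sh R G) M N f) e"
      using e by (simp add: compose_def)
  qed
  then show "on_arr (Sh R G) M P (Cmp (right_module_cat R G) M N P g f) =
      Cmp (sheaf_cat R G) (on_obj (Sh R G) M) (on_obj (Sh R G) N) (on_obj (Sh R G) P)
        (on_arr (Sh R G) N P g) (on_arr (Sh R G) M N f)"
    by (simp add: right_module_cat_def sheaf_cat_def Sh_def)
qed

definition eta :: "('g \<Rightarrow> 'k, 'm) module \<Rightarrow> ('g \<Rightarrow> ('g, 'm) germ) \<Rightarrow> 'm" where
  "eta M = (\<lambda>s\<in>carrier (Gamma_c_obj R G (Sh_obj R G M)). inv_into (carrier M) (germ_sec M) s)"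

lemma eta_iso:
  "unitary_module (groupoid_algebra R G) M \<Longrightarrow>
    right_module_iso (groupoid_algebra R G) (Gamma_c_obj R G (Sh_obj R G M)) M (eta M)"
  unfolding eta_def by (intro right_module_iso_inv(1) germ_sec_iso)

lemma germ_sec_closed:
  "unitary_module (groupoid_algebra R G) M \<Longrightarrow> m \<in> carrier M \<Longrightarrow> germ_sec M m \<in> sections_c G (Sh_obj R G M)"
  using germ_sec_iso[of M] right_module_hom_closed[of "germ_sec M" "groupoid_algebra R G" M "Gamma_c_obj R G (Sh_obj R G M)" m]
  by (simp add: right_module_iso_def Gamma_c_obj_def)

lemma eta_germ_sec:
  assumes "unitary_module (groupoid_algebra R G) M" "m \<in> carrier M"
  shows "eta M (germ_sec M m) = m"
  using right_module_iso_inv(2)[OF germ_sec_iso[OF assms(1)] assms(2)] germ_sec_closed[OF assms]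
  by (simp add: eta_def Gamma_c_obj_def)

lemma germ_sec_eta:
  assumes "unitary_module (groupoid_algebra R G) M" "s \<in> sections_c G (Sh_obj R G M)"
  shows "germ_sec M (eta M s) = s" "eta M s \<in> carrier M"
  using right_module_iso_inv(3,4)[OF germ_sec_iso[OF assms(1)], of s] assms(2)
  by (simp_all add: eta_def Gamma_c_obj_def)

text \<open>Checked on the inverse \<open>germ_sec\<close>, where it is the rule that
  \<open>Sh\<close> of \<open>f\<close> sends the germ of \<open>m\<close> to the germ of
  \<open>f m\<close>.\<close>

lemma eta_natural:
  assumes M: "unitary_module (groupoid_algebra R G) M" and N: "unitary_module (groupoid_algebra R G) N"
    and f: "f \<in> right_module_hom (groupoid_algebra R G) M N" and s: "s \<in> sections_c G (Sh_obj R G M)"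
  shows "f (eta M s) = eta N (compose (units G) (on_arr (Sh R G) M N f) s)"
proof -
  define m where "m = eta M s"
  have m: "m \<in> carrier M" "s = germ_sec M m" using germ_sec_eta[OF M s] by (simp_all add: m_def)
  have fm: "f m \<in> carrier N" using right_module_hom_closed[OF f m(1)] .
  have "compose (units G) (on_arr (Sh R G) M N f) s = germ_sec N (f m)"
    using m fm Sh_arr_germ[OF M N f] by (auto simp: germ_sec_def compose_def fun_eq_iff)
  then show ?thesis using eta_germ_sec[OF N fm] by (simp add: m_def)
qed

definition epsilon :: "('g, 'k, 'e) gsheaf \<Rightarrow> ('g, 'g \<Rightarrow> 'e) germ \<Rightarrow> 'e" where
  "epsilon E = (\<lambda>e\<in>topspace (sh_top (Sh_obj R G (Gamma_c_obj R G E))).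
     germ_rep R G (Gamma_c_obj R G E) e (fst e))"

text \<open>\<open>\<epsilon>\<close> is the sheaf morphism corresponding, by fullness of \<open>\<Gamma>\<^sub>c\<close>, to \<open>\<eta>\<close> at \<open>\<Gamma>\<^sub>c E\<close>.\<close>

lemma epsilon:
  assumes E: "gsheaf_of_modules R G E"
  shows epsilon_iso: "sheaf_iso R G (Sh_obj R G (Gamma_c_obj R G E)) E (epsilon E)"
    and epsilon_germ: "x \<in> units G \<Longrightarrow> s \<in> sections_c G E \<Longrightarrow> epsilon E (germ R G (Gamma_c_obj R G E) x s) = s x"
proof -
  interpret E: groupoid_sheaf R G E by (rule groupoid_sheafI[OF E])
  note M = E.unitary_module_Gam
  let ?S = "Sh_obj R G E.Gam"
  interpret P: groupoid_sheaf_pair R G ?S E by (rule groupoid_sheaf_pairI[OF gsheaf_Sh_obj[OF M] E])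
  have "eta E.Gam \<in> right_module_hom (groupoid_algebra R G) P.E.Gam E.Gam"
    using eta_iso[OF M] by (simp add: right_module_iso_def)
  then obtain \<phi> where \<phi>: "\<phi> \<in> sheaf_hom R G ?S E"
    "\<And>t x. t \<in> sections_c G ?S \<Longrightarrow> x \<in> units G \<Longrightarrow> \<phi> (t x) = eta E.Gam t x"
    using P.sheaf_hom_of_module_hom by metis
  have g: "\<phi> (germ R G E.Gam x s) = s x" if "x \<in> units G" "s \<in> sections_c G E" for x s
  proof -
    have s: "s \<in> carrier E.Gam" using that by simp
    have "\<phi> (germ_sec E.Gam s x) = s x"
      using \<phi>(2)[OF germ_sec_closed[OF M s] that(1)] eta_germ_sec[OF M s] by simp
    then show ?thesis using that by (simp add: germ_sec_def)
  qed
  have eq: "epsilon E = \<phi>"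
  proof (rule extensionalityI[OF _ sheaf_hom_extensional[OF \<phi>(1)]])
    show "epsilon E \<in> extensional (topspace (sh_top ?S))" by (simp add: epsilon_def)
    fix e assume e: "e \<in> topspace (sh_top ?S)"
    then show "epsilon E e = \<phi> e"
      using g[of "fst e" "germ_rep R G E.Gam e"] Sh_pointE[OF M e] by (simp add: epsilon_def)
  qed
  then show "x \<in> units G \<Longrightarrow> s \<in> sections_c G E \<Longrightarrow> epsilon E (germ R G (Gamma_c_obj R G E) x s) = s x"
    using g by simp
  show "sheaf_iso R G ?S E (epsilon E)"
    unfolding eq by (rule P.sheaf_iso_of_module_iso[OF \<phi>(1) eta_iso[OF M] \<phi>(2)])
qed

text \<open>On the germ of \<open>s\<close> at \<open>x\<close> both sides are
  \<open>\<phi> (s x)\<close>.\<close>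

lemma epsilon_natural:
  assumes E: "gsheaf_of_modules R G E" and F: "gsheaf_of_modules R G F" and \<phi>: "\<phi> \<in> sheaf_hom R G E F"
    and e: "e \<in> topspace (sh_top (Sh_obj R G (Gamma_c_obj R G E)))"
  shows "\<phi> (epsilon E e) =
    epsilon F (on_arr (Sh R G) (Gamma_c_obj R G E) (Gamma_c_obj R G F) (\<lambda>s\<in>sections_c G E. compose (units G) \<phi> s) e)"
proof -
  interpret P: groupoid_sheaf_pair R G E F by (rule groupoid_sheaf_pairI[OF E F])
  note ME = P.E.unitary_module_Gam and MF = P.F.unitary_module_Gam
  define x s where "x = fst e" and "s = germ_rep R G P.E.Gam e"
  have xs: "x \<in> units G" "s \<in> sections_c G E" "e = germ R G P.E.Gam x s"
    using Sh_pointE[OF ME e] by (simp_all add: x_def s_def)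
  have "on_arr (Sh R G) P.E.Gam P.F.Gam (\<lambda>s\<in>sections_c G E. compose (units G) \<phi> s) e =
      germ R G P.F.Gam x (compose (units G) \<phi> s)"
    using Sh_arr_germ[OF ME MF P.Gamma_c_hom[OF \<phi>] xs(1), of s] xs by simp
  then show ?thesis
    using epsilon_germ[OF F xs(1) P.compose_section[OF \<phi> xs(2)]] epsilon_germ[OF E xs(1,2)] xs
    by (simp add: P.compose_section_apply)
qed

text \<open>The two halves of \<open>large_enough\<close> supply the injections \<open>i\<close> and
  \<open>j\<close>: a module is matched with a sheaf of germs encoded through \<open>i\<close>, and
  a sheaf with a copy of its module of sections along \<open>j\<close>.\<close>

lemma equivalence:
  assumes "large_enough G TYPE('m) TYPE('e)"
  shows "equivalent_categories
    (right_module_cat R G :: (('g \<Rightarrow> 'k, 'm) module, 'm \<Rightarrow> 'm) category)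
    (sheaf_cat R G :: (('g, 'k, 'e) gsheaf, 'e \<Rightarrow> 'e) category)"
proof -
  let ?A = "groupoid_algebra R G"
  let ?T = "{(M :: ('g \<Rightarrow> 'k, 'm) module, E :: ('g, 'k, 'e) gsheaf, \<beta>). unitary_module ?A M \<and> gsheaf_of_modules R G E \<and>
    right_module_iso ?A M (Gamma_c_obj R G E) \<beta>}"
  \<comment> \<open>The commutative square
    \<open>\<Gamma>\<^sub>c \<phi> \<circ> \<beta> = \<gamma> \<circ> f\<close>, evaluated at
    units.\<close>
  let ?Q = "\<lambda>(M, E, \<beta>) (N, F, \<gamma>) f \<phi>. \<forall>m\<in>carrier M. \<forall>x\<in>units G. \<phi> (\<beta> m x) = \<gamma> (f m) x"
  obtain j :: "('g \<Rightarrow> 'e) \<Rightarrow> 'm" where j: "inj_on j (units G \<rightarrow>\<^sub>E UNIV)"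
    using assms by (auto simp: large_enough_def lepoll_def)
  obtain i :: "'g \<times> 'm \<Rightarrow> 'e" where i: "inj_on i (units G \<times> UNIV)"
    using assms by (auto simp: large_enough_def lepoll_def)
  interpret category_correspondence
    "right_module_cat R G :: (('g \<Rightarrow> 'k, 'm) module, 'm \<Rightarrow> 'm) category"
    "sheaf_cat R G :: (('g, 'k, 'e) gsheaf, 'e \<Rightarrow> 'e) category"
    ?T fst "\<lambda>t. fst (snd t)" ?Q
  proof
    show "is_category (right_module_cat R G :: (('g \<Rightarrow> 'k, 'm) module, 'm \<Rightarrow> 'm) category)"
      by (rule is_category_right_module_cat)
    show "is_category (sheaf_cat R G :: (('g, 'k, 'e) gsheaf, 'e \<Rightarrow> 'e) category)"
      by (rule is_category_sheaf_cat)
    show "fst t \<in> Obj (right_module_cat R G)" if "t \<in> ?T" for t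
      using that by (auto simp: right_module_cat_def)
    show "fst (snd t) \<in> Obj (sheaf_cat R G)" if "t \<in> ?T" for t
      using that by (auto simp: sheaf_cat_def)
    show "\<exists>t\<in>?T. fst t = M" if "M \<in> Obj (right_module_cat R G)" for M
    proof -
      have M: "unitary_module ?A M" using that by (simp add: right_module_cat_def)
      obtain \<gamma> and E :: "('g, 'k, 'e) gsheaf" where "germ_sheaf R G M \<gamma> E"
        using unitary_groupoid_module.germ_sheaf_in_type[OF unitary_groupoid_moduleI[OF M] i] by metis
      then have "gsheaf_of_modules R G E"
        "right_module_iso ?A M (Gamma_c_obj R G E) (restrict (germ_sheaf.germ_section G \<gamma>) (carrier M))"
        by (rule germ_sheaf.gsheaf_of_modules germ_sheaf.germ_section_iso)+
      with M show ?thesis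
        by (intro bexI[of _ "(M, E, restrict (germ_sheaf.germ_section G \<gamma>) (carrier M))"]) auto
    qed
    show "\<exists>t\<in>?T. fst (snd t) = E" if "E \<in> Obj (sheaf_cat R G)" for E
    proof -
      have E: "gsheaf_of_modules R G E" using that by (simp add: sheaf_cat_def)
      interpret E: groupoid_sheaf R G E by (rule groupoid_sheafI[OF E])
      have "carrier E.Gam \<subseteq> units G \<rightarrow>\<^sub>E UNIV" using E.section_extensional by (auto simp: PiE_def)
      then have "inj_on j (carrier E.Gam)" using j inj_on_subset by blast
      then obtain M :: "('g \<Rightarrow> 'k, 'm) module" where M: "unitary_module ?A M"
        "right_module_iso ?A E.Gam M (restrict j (carrier E.Gam))"
        using unitary_module_in_type[OF E.unitary_module_Gam] by metis
      from M(1) E right_module_iso_inv(1)[OF M(2)] show ?thesis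
        by (intro bexI[of _ "(M, E, \<lambda>n\<in>carrier M. inv_into (carrier E.Gam) (restrict j (carrier E.Gam)) n)"]) auto
    qed
  next
    fix t u f assume t: "t \<in> ?T" and u: "u \<in> ?T" and f: "f \<in> Hom (right_module_cat R G) (fst t) (fst u)"
    obtain M E \<beta> N F \<gamma> where tu: "t = (M, E, \<beta>)" "u = (N, F, \<gamma>)" by (metis prod_cases3)
    show "\<exists>!\<phi>. \<phi> \<in> Hom (sheaf_cat R G) (fst (snd t)) (fst (snd u)) \<and> ?Q t u f \<phi>"
      using module_hom_to_sheaf_hom[of M N E F \<beta> \<gamma> f] t u f
      by (simp add: tu right_module_cat_def sheaf_cat_def)
  next
    fix t u \<phi> assume t: "t \<in> ?T" and u: "u \<in> ?T" and \<phi>: "\<phi> \<in> Hom (sheaf_cat R G) (fst (snd t)) (fst (snd u))"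
    obtain M E \<beta> N F \<gamma> where tu: "t = (M, E, \<beta>)" "u = (N, F, \<gamma>)" by (metis prod_cases3)
    show "\<exists>!f. f \<in> Hom (right_module_cat R G) (fst t) (fst u) \<and> ?Q t u f \<phi>"
      using sheaf_hom_to_module_hom[of M N E F \<beta> \<gamma> \<phi>] t u \<phi>
      by (simp add: tu right_module_cat_def sheaf_cat_def)
  next
    \<comment> \<open>Identities and composites of sheaf morphisms are restricted to the total
      space, so the values at which they are evaluated must be known to lie in it.\<close>
    have closed: "\<beta> m x \<in> topspace (sh_top E)"
      if "(M, E, \<beta>) \<in> ?T" "m \<in> carrier M" "x \<in> units G" for M E \<beta> m x
    proof -
      interpret E: groupoid_sheaf R G E using that by (intro groupoid_sheafI) simp
      have "\<beta> \<in> right_module_hom ?A M E.Gam" using that by (simp add: right_module_iso_def)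
      then have "\<beta> m \<in> sections_c G E" using right_module_hom_closed[of \<beta> ?A M E.Gam m] that by simp
      then show ?thesis using E.section_st[of "\<beta> m" x] that(3) by (simp add: E.st_iff)
    qed
    fix t assume t: "t \<in> ?T"
    obtain M E \<beta> where t': "t = (M, E, \<beta>)" by (metis prod_cases3)
    show "?Q t t (Idn (right_module_cat R G) (fst t)) (Idn (sheaf_cat R G) (fst (snd t)))"
      using closed[of M E \<beta>] t by (simp add: t' right_module_cat_def sheaf_cat_def)
    fix u v f g \<phi> \<psi> assume u: "u \<in> ?T" and v: "v \<in> ?T" and f: "f \<in> Hom (right_module_cat R G) (fst t) (fst u)"
      and Q: "?Q t u f \<phi>" "?Q u v g \<psi>"
    obtain N F \<gamma> where u': "u = (N, F, \<gamma>)" by (metis prod_cases3)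
    obtain P H \<delta> where v': "v = (P, H, \<delta>)" by (metis prod_cases3)
    have fm: "f m \<in> carrier N" if "m \<in> carrier M" for m
      using f that right_module_hom_closed[of f ?A M N m] by (simp add: t' u' right_module_cat_def)
    show "?Q t v (Cmp (right_module_cat R G) (fst t) (fst u) (fst v) g f)
        (Cmp (sheaf_cat R G) (fst (snd t)) (fst (snd u)) (fst (snd v)) \<psi> \<phi>)"
      using Q fm closed[of M E \<beta>] t by (simp add: t' u' v' right_module_cat_def sheaf_cat_def compose_def)
  qed
  show ?thesis by (rule equivalent)
qed

end

text \<open>The elements of \<open>\<Gamma>\<^sub>c (Sh M)\<close> and of \<open>M\<close> have
  different types, and likewise for sheaves. Hence the two natural isomorphisms are families of
  isomorphisms across types with an elementwise naturality condition, whereas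
  \<open>naturally_isomorphic\<close> compares functors into one category.\<close>

theorem theorem3p4:
  fixes R :: "'k ring" and G :: "'g groupoid"
  assumes "cring R" and "ample_groupoid G"
  shows
    "is_functor (sheaf_cat R G :: (('g, 'k, 'e) gsheaf, 'e \<Rightarrow> 'e) category) (right_module_cat R G) (Gamma_c R G) \<and>
     is_functor (right_module_cat R G :: (('g \<Rightarrow> 'k, 'm) module, 'm \<Rightarrow> 'm) category) (sheaf_cat R G) (Sh R G) \<and>
     (\<exists>\<eta>. (\<forall>M :: ('g \<Rightarrow> 'k, 'm) module. unitary_module (groupoid_algebra R G) M \<longrightarrow>
              right_module_iso (groupoid_algebra R G) (on_obj (comp_functor (Gamma_c R G) (Sh R G)) M) M (\<eta> M)) \<and>
          (\<forall>(M :: ('g \<Rightarrow> 'k, 'm) module) N. \<forall>f \<in> right_module_hom (groupoid_algebra R G) M N.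
              unitary_module (groupoid_algebra R G) M \<and> unitary_module (groupoid_algebra R G) N \<longrightarrow>
              (\<forall>s \<in> carrier (on_obj (comp_functor (Gamma_c R G) (Sh R G)) M).
                 f (\<eta> M s) = \<eta> N (on_arr (comp_functor (Gamma_c R G) (Sh R G)) M N f s)))) \<and>
     (\<exists>\<epsilon>. (\<forall>E :: ('g, 'k, 'e) gsheaf. gsheaf_of_modules R G E \<longrightarrow>
              sheaf_iso R G (on_obj (comp_functor (Sh R G) (Gamma_c R G)) E) E (\<epsilon> E)) \<and>
          (\<forall>(E :: ('g, 'k, 'e) gsheaf) F. \<forall>\<phi> \<in> sheaf_hom R G E F.
              gsheaf_of_modules R G E \<and> gsheaf_of_modules R G F \<longrightarrow>
              (\<forall>e \<in> topspace (sh_top (on_obj (comp_functor (Sh R G) (Gamma_c R G)) E)).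
                 \<phi> (\<epsilon> E e) = \<epsilon> F (on_arr (comp_functor (Sh R G) (Gamma_c R G)) E F \<phi> e)))) \<and>
     (large_enough G TYPE('m) TYPE('e) \<longrightarrow>
        equivalent_categories
          (right_module_cat R G :: (('g \<Rightarrow> 'k, 'm) module, 'm \<Rightarrow> 'm) category)
          (sheaf_cat R G :: (('g, 'k, 'e) gsheaf, 'e \<Rightarrow> 'e) category))"
proof -
  interpret ample_groupoid_over_ring R G
    using assms by (rule ample_groupoid_over_ring.intro)
  have Gam: "on_obj (Gamma_c R G) E = Gamma_c_obj R G E" for E :: "('g, 'k, 'x) gsheaf"
    by (simp add: Gamma_c_def)
  have Gam_arr: "on_arr (Gamma_c R G) E F \<phi> = (\<lambda>s\<in>sections_c G E. compose (units G) \<phi> s)"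
    for E F :: "('g, 'k, 'x) gsheaf" and \<phi> :: "'x \<Rightarrow> 'x"
    by (simp add: Gamma_c_def)
  have Sh: "on_obj (Sh R G) M = Sh_obj R G M" for M :: "('g \<Rightarrow> 'k, 'x) module"
    by (simp add: Sh_def)
  have carrier_Gam: "carrier (Gamma_c_obj R G E) = sections_c G E" for E :: "('g, 'k, 'x) gsheaf"
    by (simp add: Gamma_c_obj_def)
  show ?thesis
  proof (intro conjI impI is_functor_Gamma_c is_functor_Sh)
    show "\<exists>\<eta>. (\<forall>M :: ('g \<Rightarrow> 'k, 'm) module. unitary_module (groupoid_algebra R G) M \<longrightarrow>
              right_module_iso (groupoid_algebra R G) (on_obj (comp_functor (Gamma_c R G) (Sh R G)) M) M (\<eta> M)) \<and>
          (\<forall>(M :: ('g \<Rightarrow> 'k, 'm) module) N. \<forall>f \<in> right_module_hom (groupoid_algebra R G) M N.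
              unitary_module (groupoid_algebra R G) M \<and> unitary_module (groupoid_algebra R G) N \<longrightarrow>
              (\<forall>s \<in> carrier (on_obj (comp_functor (Gamma_c R G) (Sh R G)) M).
                 f (\<eta> M s) = \<eta> N (on_arr (comp_functor (Gamma_c R G) (Sh R G)) M N f s)))"
      by (intro exI[of _ eta] conjI allI ballI impI)
        (simp_all add: comp_functor_def Gam Gam_arr Sh carrier_Gam eta_iso eta_natural)
    show "\<exists>\<epsilon>. (\<forall>E :: ('g, 'k, 'e) gsheaf. gsheaf_of_modules R G E \<longrightarrow>
              sheaf_iso R G (on_obj (comp_functor (Sh R G) (Gamma_c R G)) E) E (\<epsilon> E)) \<and>
          (\<forall>(E :: ('g, 'k, 'e) gsheaf) F. \<forall>\<phi> \<in> sheaf_hom R G E F.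
              gsheaf_of_modules R G E \<and> gsheaf_of_modules R G F \<longrightarrow>
              (\<forall>e \<in> topspace (sh_top (on_obj (comp_functor (Sh R G) (Gamma_c R G)) E)).
                 \<phi> (\<epsilon> E e) = \<epsilon> F (on_arr (comp_functor (Sh R G) (Gamma_c R G)) E F \<phi> e)))"
      by (intro exI[of _ epsilon] conjI allI ballI impI)
        (simp_all add: comp_functor_def Gam Gam_arr Sh epsilon_iso epsilon_natural)
  qed (rule equivalence)
qed

end
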